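(* Let $\mathcal{X}$ be an infinite dimensional complex Banach space, $T\in\mathcal{L}(\mathcal{X})$, $\lambda\in\mathbb{C}$, and let $\pi(T)\in\mathcal{C}(\mathcal{X})$ be the coset of $T$ in the Calkin algebra. The following statements hold. (i) $\lambda\in\mathrm{iso}\,\sigma(\pi(T))$ if and only if there exists an idempotent $P\in\mathcal{L}(\mathcal{X})$, $P\notin\mathcal{K}(\mathcal{X})$, such that if $\mathcal{X}_1=P(\mathcal{X})$ and $\mathcal{X}_2=(I-P)(\mathcal{X})$, then there are $T_1\in\mathscr{R}(\mathcal{X}_1)$, $T_2\in\Phi(\mathcal{X}_2)$ and $K\in\mathcal{K}(\mathcal{X})$ such that $T-\lambda=T_1\oplus T_2+K$. (ii) $\lambda$ is a pole of $\pi(T)$ (i.e. $\lambda\in\Pi(\pi(T))$) if and only if there exists an idempotent $P\in\mathcal{L}(\mathcal{X})$, $P\notin\mathcal{K}(\mathcal{X})$, such that if $\mathcal{X}_1=P(\mathcal{X})$ and $\mathcal{X}_2=(I-P)(\mathcal{X})$, then there are $T_1\in\mathscr{PK}(\mathcal{X}_1)$, $T_2\in\Phi(\mathcal{X}_2)$ and $K\in\mathcal{K}(\mathcal{X})$ such that $T-\lambda=T_1\oplus T_2+K$. (iii) $\lambda\in I(\pi(T))$ if and only if there exists an idempotent $P\in\mathcal{L}(\mathcal{X})$, $P\notin\mathcal{K}(\mathcal{X})$, such that if $\mathcal{X}_1=P(\mathcal{X})$ and $\mathcal{X}_2=(I-P)(\mathcal{X})$, then there are $T_1\in\mathscr{R}(\mathcal{X}_1)\setminus\mathscr{PK}(\mathcal{X}_1)$,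 $T_2\in\Phi(\mathcal{X}_2)$ and $K\in\mathcal{K}(\mathcal{X})$ such that $T-\lambda=T_1\oplus T_2+K$.
   Context: $\mathcal{L}(\mathcal{X})$ is the algebra of bounded linear operators on $\mathcal{X}$, $\mathcal{K}(\mathcal{X})$ the closed ideal of compact operators, $\mathcal{C}(\mathcal{X})=\mathcal{L}(\mathcal{X})/\mathcal{K}(\mathcal{X})$ the Calkin algebra, and $\pi\colon\mathcal{L}(\mathcal{X})\to\mathcal{C}(\mathcal{X})$ the quotient map. $T-\lambda$ means $T-\lambda I$. $T_1\oplus T_2$ is the operator on $\mathcal{X}=\mathcal{X}_1\oplus\mathcal{X}_2$ acting as $T_1$ on $\mathcal{X}_1$ and $T_2$ on $\mathcal{X}_2$. For a Banach space $\mathcal{Y}$: $\Phi(\mathcal{Y})$ is the set of Fredholm operators on $\mathcal{Y}$ (closed range, finite-dimensional kernel and cokernel; every operator on a finite-dimensional space is Fredholm); $\mathscr{R}(\mathcal{Y})$ is the set of Riesz operators, i.e. $S\in\mathcal{L}(\mathcal{Y})$ whose coset in $\mathcal{C}(\mathcal{Y})$ is quasi-nilpotent; $\mathscr{PK}(\mathcal{Y})$ is the set of power compact operators, i.e. $S\in\mathcal{L}(\mathcal{Y})$ with $S^n\in\mathcal{K}(\mathcal{Y})$ for some $n\in\mathbb{N}$, $n\geq 1$. For an element $b$ of a complex unital Banach algebra: $\sigma(b)$ is the spectrum; $\mathrm{iso}\,\sigma(b)$ is the set of isolated points of $\sigma(b)$; $\Pi(b)\subseteq\mathrm{iso}\,\sigma(b)$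 is the set of poles of the resolvent function $\mu\mapsto(\mu-b)^{-1}$, i.e. those isolated points $\lambda_0$ for which the Laurent expansion of the resolvent around $\lambda_0$ has a nonzero singular part with only finitely many nonzero coefficients; $I(b)=\mathrm{iso}\,\sigma(b)\setminus\Pi(b)$. *)

theory Defs
  imports "HOL-Analysis.Analysis" "HOL-Algebra.QuotRing" "HOL-Algebra.Module"
begin

section \<open>Complex Banach spaces\<close>

class complex_banach = banach +
  fixes scaleC :: "complex \<Rightarrow> 'a \<Rightarrow> 'a"  (infixr \<open>*\<^sub>C\<close> 75)
  assumes scaleC_add_right: "c *\<^sub>C (x + y) = c *\<^sub>C x + c *\<^sub>C y"
    and scaleC_add_left: "(c + d) *\<^sub>C x = c *\<^sub>C x + d *\<^sub>C x"
    and scaleC_scaleC: "c *\<^sub>C (d *\<^sub>C x) = (c * d) *\<^sub>C x"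
    and scaleC_one: "1 *\<^sub>C x = x"
    and scaleR_scaleC: "r *\<^sub>R x = complex_of_real r *\<^sub>C x"
    and norm_scaleC: "norm (c *\<^sub>C x) = cmod c * norm x"

global_interpretation complex_vector: vector_space "scaleC :: complex \<Rightarrow> 'a \<Rightarrow> 'a :: complex_banach"
  defines cspan = "complex_vector.span" and csubspace = "complex_vector.subspace"
  by unfold_locales (simp_all add: scaleC_add_right scaleC_add_left scaleC_scaleC scaleC_one)

definition finite_dimensional :: "'a::complex_banach set \<Rightarrow> bool" where
  "finite_dimensional V \<longleftrightarrow> (\<exists>B. finite B \<and> B \<subseteq> V \<and> V = cspan B)"


section \<open>Complex unital Banach algebras\<close>

text \<open>Algebras are given by carriers: the ring and module operations of \<open>HOL-Algebra\<close> over the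
  type of complex numbers, together with a norm.\<close>

record 'b normed_algebra = "(complex, 'b) module" +
  alg_norm :: "'b \<Rightarrow> real"

definition spectrum :: "('b, 'm) normed_algebra_scheme \<Rightarrow> 'b \<Rightarrow> complex set" where
  "spectrum A b = {\<mu>. \<mu> \<odot>\<^bsub>A\<^esub> \<one>\<^bsub>A\<^esub> \<ominus>\<^bsub>A\<^esub> b \<notin> Units A}"

definition resolvent :: "('b, 'm) normed_algebra_scheme \<Rightarrow> 'b \<Rightarrow> complex \<Rightarrow> 'b" where
  "resolvent A b \<mu> = inv\<^bsub>A\<^esub> (\<mu> \<odot>\<^bsub>A\<^esub> \<one>\<^bsub>A\<^esub> \<ominus>\<^bsub>A\<^esub> b)"

definition iso_spectrum :: "('b, 'm) normed_algebra_scheme \<Rightarrow> 'b \<Rightarrow> complex set" where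
  "iso_spectrum A b = {\<mu>. \<mu> isolated_in spectrum A b}"

text \<open>Only the inclusion is required: in the zero algebra the spectrum of \<open>0\<close> is empty, and
  \<open>0\<close> is quasi-nilpotent.\<close>

definition quasi_nilpotent :: "('b, 'm) normed_algebra_scheme \<Rightarrow> 'b \<Rightarrow> bool" where
  "quasi_nilpotent A b \<longleftrightarrow> b \<in> carrier A \<and> spectrum A b \<subseteq> {0}"

text \<open>\<open>f \<mu> = (\<Sum>n\<in>\<int>. (\<mu> - w)\<^sup>n a\<^sub>n)\<close> in a punctured disc around \<open>w\<close>. The two-sided series is summed
  along the net of finite subsets of the integers, as in \<^const>\<open>has_sum\<close>; a Laurent series that
  converges in a punctured disc converges absolutely there.\<close>

definition laurent_expansion ::
  "('b, 'm) normed_algebra_scheme \<Rightarrow> (complex \<Rightarrow> 'b) \<Rightarrow> complex \<Rightarrow> (int \<Rightarrow> 'b) \<Rightarrow> bool" where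
  "laurent_expansion A f w a \<longleftrightarrow>
     (\<forall>n. a n \<in> carrier A) \<and>
     (\<exists>r>0. \<forall>\<mu>. 0 < cmod (\<mu> - w) \<and> cmod (\<mu> - w) < r \<longrightarrow>
        ((\<lambda>F. alg_norm A (f \<mu> \<ominus>\<^bsub>A\<^esub> (\<Oplus>\<^bsub>A\<^esub>n\<in>F. ((\<mu> - w) powi n) \<odot>\<^bsub>A\<^esub> a n)))
           \<longlongrightarrow> 0) (finite_subsets_at_top UNIV))"

definition resolvent_poles :: "('b, 'm) normed_algebra_scheme \<Rightarrow> 'b \<Rightarrow> complex set" where
  "resolvent_poles A b = {w \<in> iso_spectrum A b.
     \<exists>a. laurent_expansion A (resolvent A b) w a \<and>
         {n. n < 0 \<and> a n \<noteq> \<zero>\<^bsub>A\<^esub>} \<noteq> {} \<and> finite {n. n < 0 \<and> a n \<noteq> \<zero>\<^bsub>A\<^esub>}}"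

definition iso_nonpoles :: "('b, 'm) normed_algebra_scheme \<Rightarrow> 'b \<Rightarrow> complex set" where
  "iso_nonpoles A b = iso_spectrum A b - resolvent_poles A b"

definition quotient_algebra ::
  "('b, 'm) normed_algebra_scheme \<Rightarrow> 'b set \<Rightarrow> 'b set normed_algebra" where
  "quotient_algebra A J =
     \<lparr>carrier = carrier (A Quot J), mult = mult (A Quot J), one = one (A Quot J),
      zero = zero (A Quot J), add = add (A Quot J),
      smult = (\<lambda>c X. \<Union>x\<in>X. J +>\<^bsub>A\<^esub> (c \<odot>\<^bsub>A\<^esub> x)),
      alg_norm = (\<lambda>X. INF x\<in>X. alg_norm A x)\<rparr>"


section \<open>Operators on a closed subspace\<close>

text \<open>The Banach spaces occurring below are closed complex subspaces \<open>Y\<close> of a type of class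
  \<^class>\<open>complex_banach\<close>, including the whole space \<^const>\<open>UNIV\<close>. An operator on \<open>Y\<close> is represented by
  the function that is \<^const>\<open>undefined\<close> outside \<open>Y\<close>, so that equality of operators is equality
  of functions; for \<open>Y = UNIV\<close> this is no restriction.\<close>

definition bounded_ops :: "'a::complex_banach set \<Rightarrow> ('a \<Rightarrow> 'a) set" where
  "bounded_ops Y = {S \<in> Y \<rightarrow>\<^sub>E Y.
     (\<forall>x\<in>Y. \<forall>y\<in>Y. S (x + y) = S x + S y) \<and>
     (\<forall>c. \<forall>x\<in>Y. S (c *\<^sub>C x) = c *\<^sub>C S x) \<and>
     (\<exists>C. \<forall>x\<in>Y. norm (S x) \<le> C * norm x)}"

definition compact_ops :: "'a::complex_banach set \<Rightarrow> ('a \<Rightarrow> 'a) set" where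
  "compact_ops Y = {S \<in> bounded_ops Y. compact (closure (S ` (Y \<inter> cball 0 1)))}"

definition op_algebra :: "'a::complex_banach set \<Rightarrow> ('a \<Rightarrow> 'a) normed_algebra" where
  "op_algebra Y =
     \<lparr>carrier = bounded_ops Y, mult = compose Y, one = (\<lambda>x\<in>Y. x),
      zero = (\<lambda>x\<in>Y. 0), add = (\<lambda>S T. \<lambda>x\<in>Y. S x + T x),
      smult = (\<lambda>c S. \<lambda>x\<in>Y. c *\<^sub>C S x),
      alg_norm = (\<lambda>S. SUP x\<in>Y \<inter> cball 0 1. norm (S x))\<rparr>"

definition calkin_algebra :: "'a::complex_banach set \<Rightarrow> ('a \<Rightarrow> 'a) set normed_algebra" where
  "calkin_algebra Y = quotient_algebra (op_algebra Y) (compact_ops Y)"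

definition calkin_proj :: "'a::complex_banach set \<Rightarrow> ('a \<Rightarrow> 'a) \<Rightarrow> ('a \<Rightarrow> 'a) set" where
  "calkin_proj Y S = compact_ops Y +>\<^bsub>op_algebra Y\<^esub> S"

text \<open>The last conjunct says that the cokernel \<open>Y / S(Y)\<close> is spanned by the classes of finitely
  many vectors.\<close>

definition fredholm_ops :: "'a::complex_banach set \<Rightarrow> ('a \<Rightarrow> 'a) set" where
  "fredholm_ops Y = {S \<in> bounded_ops Y.
     closed (S ` Y) \<and>
     finite_dimensional {x \<in> Y. S x = 0} \<and>
     (\<exists>B. finite B \<and> B \<subseteq> Y \<and> (\<forall>y\<in>Y. \<exists>x\<in>Y. y - S x \<in> cspan B))}"

definition riesz_ops :: "'a::complex_banach set \<Rightarrow> ('a \<Rightarrow> 'a) set" where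
  "riesz_ops Y = {S \<in> bounded_ops Y. quasi_nilpotent (calkin_algebra Y) (calkin_proj Y S)}"

definition power_compact_ops :: "'a::complex_banach set \<Rightarrow> ('a \<Rightarrow> 'a) set" where
  "power_compact_ops Y =
     {S \<in> bounded_ops Y. \<exists>n\<ge>1. S [^]\<^bsub>op_algebra Y\<^esub> (n::nat) \<in> compact_ops Y}"

text \<open>The operator \<open>T1 \<oplus> T2\<close> with respect to the decomposition of the space into the ranges of
  the idempotents \<open>P\<close> and \<open>I - P\<close>.\<close>

definition direct_sum_op ::
  "('a::complex_banach \<Rightarrow> 'a) \<Rightarrow> ('a \<Rightarrow> 'a) \<Rightarrow> ('a \<Rightarrow> 'a) \<Rightarrow> 'a \<Rightarrow> 'a" where
  "direct_sum_op P T1 T2 x = T1 (P x) + T2 (x - P x)"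


section \<open>The compact operators on a closed subspace form an ideal\<close>

lemma op_algebra_simps [simp]:
  "carrier (op_algebra Y) = bounded_ops Y"
  "mult (op_algebra Y) = compose Y"
  "one (op_algebra Y) = (\<lambda>x\<in>Y. x)"
  "zero (op_algebra Y) = (\<lambda>x\<in>Y. 0)"
  "add (op_algebra Y) = (\<lambda>S T. \<lambda>x\<in>Y. S x + T x)"
  "smult (op_algebra Y) = (\<lambda>c S. \<lambda>x\<in>Y. c *\<^sub>C S x)"
  by (simp_all add: op_algebra_def)

lemma bounded_ops_iff:
  "S \<in> bounded_ops Y \<longleftrightarrow> S \<in> extensional Y \<and> (\<forall>x\<in>Y. S x \<in> Y) \<and>
     (\<forall>x\<in>Y. \<forall>y\<in>Y. S (x + y) = S x + S y) \<and>
     (\<forall>c. \<forall>x\<in>Y. S (c *\<^sub>C x) = c *\<^sub>C S x) \<and>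
     (\<exists>C. \<forall>x\<in>Y. norm (S x) \<le> C * norm x)"
  by (auto simp: bounded_ops_def PiE_iff)

lemma bounded_ops_bound:
  assumes "S \<in> bounded_ops Y"
  obtains C where "C > 0" "\<And>x. x \<in> Y \<Longrightarrow> norm (S x) \<le> C * norm x"
proof -
  from assms obtain C where C: "\<forall>x\<in>Y. norm (S x) \<le> C * norm x"
    by (auto simp: bounded_ops_iff)
  have "norm (S x) \<le> (\<bar>C\<bar> + 1) * norm x" if "x \<in> Y" for x
    by (rule order_trans[OF C[rule_format, OF that]]) (intro mult_right_mono, auto)
  then show thesis by (intro that[of "\<bar>C\<bar> + 1"]) auto
qed

lemma bounded_ops_add:
  assumes Y: "csubspace Y" and S: "S \<in> bounded_ops Y" and T: "T \<in> bounded_ops Y"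
  shows "(\<lambda>x\<in>Y. S x + T x) \<in> bounded_ops Y"
proof -
  obtain C where C: "\<And>x. x \<in> Y \<Longrightarrow> norm (S x) \<le> C * norm x" using bounded_ops_bound[OF S] by metis
  obtain D where D: "\<And>x. x \<in> Y \<Longrightarrow> norm (T x) \<le> D * norm x" using bounded_ops_bound[OF T] by metis
  have "norm (S x + T x) \<le> (C + D) * norm x" if "x \<in> Y" for x
    using norm_triangle_ineq[of "S x" "T x"] C[OF that] D[OF that] by (simp add: distrib_right)
  then show ?thesis using Y S T
    by (auto simp: bounded_ops_iff complex_vector.subspace_def scaleC_add_right intro!: exI[of _ "C + D"])
qed

lemma bounded_ops_smult:
  assumes Y: "csubspace Y" and S: "S \<in> bounded_ops Y"
  shows "(\<lambda>x\<in>Y. c *\<^sub>C S x) \<in> bounded_ops Y"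
proof -
  obtain C where C: "\<And>x. x \<in> Y \<Longrightarrow> norm (S x) \<le> C * norm x" using bounded_ops_bound[OF S] by metis
  have "norm (c *\<^sub>C S x) \<le> (cmod c * C) * norm x" if "x \<in> Y" for x
    using mult_left_mono[OF C[OF that], of "cmod c"] by (simp add: norm_scaleC mult.assoc)
  then show ?thesis using Y S
    by (auto simp: bounded_ops_iff complex_vector.subspace_def scaleC_add_right scaleC_scaleC mult.commute
          intro!: exI[of _ "cmod c * C"])
qed

lemma bounded_ops_compose:
  assumes Y: "csubspace Y" and S: "S \<in> bounded_ops Y" and T: "T \<in> bounded_ops Y"
  shows "compose Y S T \<in> bounded_ops Y"
proof -
  obtain C where C: "C > 0" "\<And>x. x \<in> Y \<Longrightarrow> norm (S x) \<le> C * norm x"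
    using bounded_ops_bound[OF S] by metis
  obtain D where D: "\<And>x. x \<in> Y \<Longrightarrow> norm (T x) \<le> D * norm x" using bounded_ops_bound[OF T] by metis
  have "norm (S (T x)) \<le> (C * D) * norm x" if "x \<in> Y" for x
  proof -
    have "T x \<in> Y" using T that by (auto simp: bounded_ops_iff)
    then have "norm (S (T x)) \<le> C * norm (T x)" by (rule C)
    also have "\<dots> \<le> C * (D * norm x)" using D[OF that] C(1) by simp
    finally show ?thesis by (simp add: mult.assoc)
  qed
  then show ?thesis using Y S T
    by (auto simp: bounded_ops_iff compose_def complex_vector.subspace_def intro!: exI[of _ "C * D"])
qed

lemma bounded_ops_zero: "csubspace Y \<Longrightarrow> (\<lambda>x\<in>Y. 0) \<in> bounded_ops Y"
  by (auto simp: bounded_ops_iff complex_vector.subspace_def intro!: exI[of _ 0])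

lemma bounded_ops_one: "csubspace Y \<Longrightarrow> (\<lambda>x\<in>Y. x) \<in> bounded_ops Y"
  by (auto simp: bounded_ops_iff complex_vector.subspace_def intro!: exI[of _ 1])

lemma ring_op_algebra:
  assumes Y: "csubspace Y"
  shows "ring (op_algebra Y)"
proof (rule ringI)
  show "abelian_group (op_algebra Y)"
  proof (rule abelian_groupI)
    fix S assume S: "S \<in> carrier (op_algebra Y)"
    then show "\<exists>T\<in>carrier (op_algebra Y). T \<oplus>\<^bsub>op_algebra Y\<^esub> S = \<zero>\<^bsub>op_algebra Y\<^esub>"
      using Y bounded_ops_smult[OF Y, of S "-1"]
      by (intro bexI[of _ "\<lambda>x\<in>Y. (-1) *\<^sub>C S x"]) (auto simp: fun_eq_iff restrict_def scaleC_one)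
  next
    fix S T assume "S \<in> carrier (op_algebra Y)" "T \<in> carrier (op_algebra Y)"
    then show "S \<oplus>\<^bsub>op_algebra Y\<^esub> T \<in> carrier (op_algebra Y)"
      using bounded_ops_add[OF Y] by simp
  next
    show "\<zero>\<^bsub>op_algebra Y\<^esub> \<in> carrier (op_algebra Y)"
      using bounded_ops_zero[OF Y] by simp
  qed (auto simp: bounded_ops_iff extensional_def fun_eq_iff restrict_def add_ac)
  show "monoid (op_algebra Y)"
  proof (rule monoidI)
    fix S T assume "S \<in> carrier (op_algebra Y)" "T \<in> carrier (op_algebra Y)"
    then show "S \<otimes>\<^bsub>op_algebra Y\<^esub> T \<in> carrier (op_algebra Y)"
      using bounded_ops_compose[OF Y] by simp
  next
    show "\<one>\<^bsub>op_algebra Y\<^esub> \<in> carrier (op_algebra Y)"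
      using bounded_ops_one[OF Y] by simp
  qed (auto simp: bounded_ops_iff compose_def extensional_def fun_eq_iff restrict_def)
qed (use Y in \<open>auto simp: bounded_ops_iff compose_def extensional_def fun_eq_iff restrict_def
        complex_vector.subspace_def\<close>)

lemma bounded_ops_continuous_on:
  assumes Y: "csubspace Y" and S: "S \<in> bounded_ops Y"
  shows "continuous_on Y S"
proof -
  obtain C where C: "C > 0" "\<And>x. x \<in> Y \<Longrightarrow> norm (S x) \<le> C * norm x"
    using bounded_ops_bound[OF S] by metis
  have "dist (S x) (S y) \<le> C * dist x y" if "x \<in> Y" "y \<in> Y" for x y
  proof -
    have d: "x - y \<in> Y" using Y that by (rule complex_vector.subspace_diff)
    have "S ((x - y) + y) = S (x - y) + S y" using S d that unfolding bounded_ops_iff by blast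
    then have "S x - S y = S (x - y)" by simp
    then show ?thesis using C(2)[OF d] by (simp add: dist_norm)
  qed
  then have "C-lipschitz_on Y S" using C(1) by (intro lipschitz_onI) auto
  then show ?thesis by (rule lipschitz_on_continuous_on)
qed

lemma compact_opsI:
  assumes "S \<in> bounded_ops Y" "compact D" "\<And>x. x \<in> Y \<Longrightarrow> norm x \<le> 1 \<Longrightarrow> S x \<in> D"
  shows "S \<in> compact_ops Y"
proof -
  have "closure (S ` (Y \<inter> cball 0 1)) \<subseteq> D"
    using assms(2,3) by (intro closure_minimal compact_imp_closed) auto
  then have "compact (closure (S ` (Y \<inter> cball 0 1)))"
    using compact_Int_closed[OF assms(2) closed_closure] by (metis inf.absorb2)
  then show ?thesis using assms(1) by (simp add: compact_ops_def)
qed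

lemma compact_opsE:
  assumes "S \<in> compact_ops Y" "closed Y"
  obtains D where "compact D" "D \<subseteq> Y" "\<And>x. x \<in> Y \<Longrightarrow> norm x \<le> 1 \<Longrightarrow> S x \<in> D"
proof
  let ?D = "closure (S ` (Y \<inter> cball 0 1))"
  show "compact ?D" using assms(1) by (simp add: compact_ops_def)
  show "?D \<subseteq> Y" using assms
    by (intro closure_minimal) (auto simp: compact_ops_def bounded_ops_iff)
  show "S x \<in> ?D" if "x \<in> Y" "norm x \<le> 1" for x
    using that by (intro subsetD[OF closure_subset]) auto
qed

lemma compact_ops_smult:
  assumes Y: "csubspace Y" "closed Y" and S: "S \<in> compact_ops Y"
  shows "(\<lambda>x\<in>Y. c *\<^sub>C S x) \<in> compact_ops Y"
proof -
  obtain D where D: "compact D" "D \<subseteq> Y" "\<And>x. x \<in> Y \<Longrightarrow> norm x \<le> 1 \<Longrightarrow> S x \<in> D"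
    using compact_opsE[OF S Y(2)] by metis
  have "dist (c *\<^sub>C x) (c *\<^sub>C y) = cmod c * dist x y" for x y :: 'a
    by (metis complex_vector.scale_right_diff_distrib dist_norm norm_scaleC)
  then have "(cmod c)-lipschitz_on D (\<lambda>x. c *\<^sub>C x)"
    by (intro lipschitz_onI) auto
  then have "compact ((\<lambda>x. c *\<^sub>C x) ` D)"
    using D(1) compact_continuous_image lipschitz_on_continuous_on by blast
  moreover have "S \<in> bounded_ops Y" using S by (simp add: compact_ops_def)
  ultimately show ?thesis
    by (intro compact_opsI[where D = "(\<lambda>x. c *\<^sub>C x) ` D"] bounded_ops_smult Y(1))
       (auto intro: D(3))
qed

lemma ideal_compact_ops:
  assumes Y: "csubspace Y" "closed Y"
  shows "ideal (compact_ops Y) (op_algebra Y)"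
proof (rule idealI)
  show ring: "ring (op_algebra Y)" by (rule ring_op_algebra[OF Y(1)])
  then interpret ring "op_algebra Y" .
  show "subgroup (compact_ops Y) (add_monoid (op_algebra Y))"
  proof (rule add.subgroupI)
    show "compact_ops Y \<subseteq> carrier (op_algebra Y)" by (auto simp: compact_ops_def)
    have "(\<lambda>x\<in>Y. 0) \<in> compact_ops Y"
      by (rule compact_opsI[where D = "{0}"]) (auto simp: bounded_ops_zero[OF Y(1)])
    then show "compact_ops Y \<noteq> {}" by blast
  next
    fix S assume S: "S \<in> compact_ops Y"
    let ?N = "\<lambda>x\<in>Y. (-1) *\<^sub>C S x"
    have N: "?N \<in> compact_ops Y" by (rule compact_ops_smult[OF Y S])
    have "?N \<oplus>\<^bsub>op_algebra Y\<^esub> S = \<zero>\<^bsub>op_algebra Y\<^esub>" by (auto simp: fun_eq_iff restrict_def scaleC_one)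
    then have "\<ominus>\<^bsub>op_algebra Y\<^esub> S = ?N"
      using N S by (intro minus_equality) (auto simp: compact_ops_def)
    then show "\<ominus>\<^bsub>op_algebra Y\<^esub> S \<in> compact_ops Y" using N by simp
  next
    fix S T assume S: "S \<in> compact_ops Y" and T: "T \<in> compact_ops Y"
    obtain D where D: "compact D" "\<And>x. x \<in> Y \<Longrightarrow> norm x \<le> 1 \<Longrightarrow> S x \<in> D"
      using compact_opsE[OF S Y(2)] by metis
    obtain E where E: "compact E" "\<And>x. x \<in> Y \<Longrightarrow> norm x \<le> 1 \<Longrightarrow> T x \<in> E"
      using compact_opsE[OF T Y(2)] by metis
    have "(\<lambda>x\<in>Y. S x + T x) \<in> bounded_ops Y"
      using S T by (intro bounded_ops_add[OF Y(1)]) (auto simp: compact_ops_def)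
    then have "(\<lambda>x\<in>Y. S x + T x) \<in> compact_ops Y"
      by (rule compact_opsI[OF _ compact_sums[OF D(1) E(1)]]) (use D(2) E(2) in auto)
    then show "S \<oplus>\<^bsub>op_algebra Y\<^esub> T \<in> compact_ops Y" by simp
  qed
next
  fix S T assume S: "S \<in> compact_ops Y" and "T \<in> carrier (op_algebra Y)"
  then have T: "T \<in> bounded_ops Y" by simp
  have S': "S \<in> bounded_ops Y" using S by (simp add: compact_ops_def)
  obtain D where D: "compact D" "D \<subseteq> Y" "\<And>x. x \<in> Y \<Longrightarrow> norm x \<le> 1 \<Longrightarrow> S x \<in> D"
    using compact_opsE[OF S Y(2)] by metis
  have "compact (T ` D)"
    using bounded_ops_continuous_on[OF Y(1) T] D(1,2) compact_continuous_image continuous_on_subset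
    by blast
  then have "compose Y T S \<in> compact_ops Y"
    by (rule compact_opsI[OF bounded_ops_compose[OF Y(1) T S']]) (auto simp: compose_def D(3))
  then show "T \<otimes>\<^bsub>op_algebra Y\<^esub> S \<in> compact_ops Y" by simp
  obtain C where C: "C > 0" "\<And>x. x \<in> Y \<Longrightarrow> norm (T x) \<le> C * norm x"
    using bounded_ops_bound[OF T] by metis
  have "S (T x) \<in> (\<lambda>y. C *\<^sub>R y) ` D" if x: "x \<in> Y" "norm x \<le> 1" for x
  proof
    let ?u = "(1 / complex_of_real C) *\<^sub>C T x"
    have Tx: "T x \<in> Y" using T x by (auto simp: bounded_ops_iff)
    have u: "?u \<in> Y" using Y(1) Tx by (rule complex_vector.subspace_scale)
    have "norm (T x) \<le> C * 1"
      using C(2)[OF x(1)] mult_left_mono[OF x(2), of C] C(1) by linarith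
    then have "norm ?u \<le> 1" using C(1) by (simp add: norm_scaleC norm_divide divide_le_eq)
    then show "S ?u \<in> D" using u D(3) by blast
    have "S ?u = (1 / complex_of_real C) *\<^sub>C S (T x)" using S' Tx unfolding bounded_ops_iff by blast
    then show "S (T x) = C *\<^sub>R S ?u"
      using C(1) by (simp add: scaleR_scaleC scaleC_scaleC scaleC_one)
  qed
  then have "compose Y S T \<in> compact_ops Y"
    by (intro compact_opsI[OF bounded_ops_compose[OF Y(1) S' T] compact_scaling[OF D(1)]])
       (auto simp: compose_def)
  then show "S \<otimes>\<^bsub>op_algebra Y\<^esub> T \<in> compact_ops Y" by simp
qed

end

theory Submission
  imports Defs
begin

text \<open>Let \<open>c\<close> be the class of \<open>T - z\<close> in the Calkin algebra. If \<open>0\<close> is isolated in the spectrum of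
  \<open>c\<close>, the Riesz idempotent \<open>p\<close> splits \<open>c\<close> into a quasi-nilpotent part \<open>c p\<close> and a part invertible in
  the corner of \<open>1 - p\<close>. Here \<open>p\<close> is obtained without contour integrals, as the limit of
  \<open>(1 - (c / r)\<^sup>n)\<^sup>-\<^sup>1\<close>, which by partial fractions is the average of \<open>l (l - c)\<^sup>-\<^sup>1\<close> over the \<open>n\<close>-th
  roots of \<open>r\<^sup>n\<close>. Conversely such a splitting determines the resolvent near \<open>0\<close>: the coefficients of
  the singular part are the \<open>(c p)\<^sup>n p\<close>, so \<open>0\<close> is isolated, and it is a pole if and only if \<open>c p\<close> is
  nilpotent. Idempotents lift from the Calkin algebra to idempotent operators \<open>P\<close>, because an operator
  \<open>S\<close> with \<open>S\<^sup>2 - S\<close> compact has a spectrum that misses some annulus between \<open>0\<close> and \<open>1\<close>. With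
  Atkinson's theorem, the two parts of \<open>c\<close> are then the classes of a Riesz operator on the range of
  \<open>P\<close> and of a Fredholm operator on the range of \<open>I - P\<close>; the Riesz operator is power compact if and
  only if \<open>c p\<close> is nilpotent.\<close>

section \<open>Complex Banach algebras\<close>

text \<open>The Riesz idempotent is constructed twice, in the Calkin algebra to split
  \<open>c\<close> and among the operators to lift \<open>p\<close>. Both algebras are therefore
  also built as types of one class, and the carrier-based Calkin algebra of the statement is
  identified with its type by an isometric isomorphism. The range of \<open>P\<close> is only a set,
  so an operator \<open>S\<close> on it is studied through its extension \<open>S P\<close> by zero:
  \<open>S\<close> is Riesz or power compact exactly if the class of \<open>S P\<close> is
  quasi-nilpotent or nilpotent, and Fredholm exactly if the class of \<open>S P + (I - P)\<close> is
  invertible. All splitting thus happens in one Calkin algebra. Averages over roots are not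
  idempotent themselves, and neither is the idempotence of their limit immediate: two different
  radii give a product formula, and continuity in the radius lets the radii coincide. That
  \<open>P\<close> is not compact means \<open>p \<noteq> 0\<close>, which is what puts the point
  into the spectrum. Whether \<open>c p\<close> is nilpotent can be read off from any decomposition
  whatever; this is what (iii) needs beyond (i) and (ii).\<close>

text \<open>The equation \<open>1 = 0\<close> is not excluded, as a type of operators has to cover the zero space and
  the Calkin algebra of a finite-dimensional space is zero.\<close>

class complex_banach_algebra = complex_banach + real_normed_algebra + monoid_mult +
  assumes scaleC_mult_left: "(c *\<^sub>C x) * y = c *\<^sub>C (x * y)"
    and scaleC_mult_right: "x * (c *\<^sub>C y) = c *\<^sub>C (x * y)"

lemma bounded_bilinear_scaleC: "bounded_bilinear (scaleC :: complex \<Rightarrow> 'a::complex_banach \<Rightarrow> 'a)"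
proof
  fix a a' :: complex and b b' :: 'a and r :: real
  show "(a + a') *\<^sub>C b = a *\<^sub>C b + a' *\<^sub>C b" by (rule scaleC_add_left)
  show "a *\<^sub>C (b + b') = a *\<^sub>C b + a *\<^sub>C b'" by (rule scaleC_add_right)
  show "(r *\<^sub>R a) *\<^sub>C b = r *\<^sub>R (a *\<^sub>C b)"
    by (simp add: scaleR_scaleC scaleC_scaleC scaleR_conv_of_real)
  show "a *\<^sub>C (r *\<^sub>R b) = r *\<^sub>R (a *\<^sub>C b)"
    by (simp add: scaleR_scaleC scaleC_scaleC mult.commute)
  show "\<exists>K. \<forall>a b. norm (a *\<^sub>C b :: 'a) \<le> norm a * norm b * K"
    by (intro exI[of _ 1]) (simp add: norm_scaleC)
qed

interpretation scaleC: bounded_bilinear "scaleC :: complex \<Rightarrow> 'a::complex_banach \<Rightarrow> 'a"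
  by (rule bounded_bilinear_scaleC)

lemmas tendsto_scaleC = scaleC.tendsto
lemmas continuous_on_scaleC = scaleC.continuous_on
lemmas scaleC_simps = scaleC_add_left scaleC_add_right scaleC.diff_left scaleC.diff_right
  scaleC_scaleC scaleC_mult_left scaleC_mult_right scaleC_one

section \<open>Units, one-sided inverses and the Neumann series\<close>

definition is_unit_el :: "'a::complex_banach_algebra \<Rightarrow> bool" where
  "is_unit_el u \<longleftrightarrow> (\<exists>v. u * v = 1 \<and> v * u = 1)"

definition inv_el :: "'a::complex_banach_algebra \<Rightarrow> 'a" where
  "inv_el u = (SOME v. u * v = 1 \<and> v * u = 1)"

lemma is_unit_elI: "u * v = 1 \<Longrightarrow> v * u = 1 \<Longrightarrow> is_unit_el u"
  by (auto simp: is_unit_el_def)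

lemma inv_el:
  assumes "is_unit_el u" shows "u * inv_el u = 1" "inv_el u * u = 1"
  using someI_ex[OF assms[unfolded is_unit_el_def]] by (auto simp: inv_el_def)

lemma left_right_inverse_eq: "v * u = 1 \<Longrightarrow> u * w = 1 \<Longrightarrow> v = (w::'a::monoid_mult)"
  by (metis mult.assoc mult_1_left mult_1_right)

lemma inv_el_eqI: "u * v = 1 \<Longrightarrow> v * u = 1 \<Longrightarrow> inv_el u = v"
  by (metis inv_el(2) is_unit_elI left_right_inverse_eq)

lemma inverse_commutes:
  fixes a :: "'a::monoid_mult"
  assumes "u * v = 1" "v * u = 1" "a * u = u * a"
  shows "a * v = v * a"
proof -
  have "a * v = (v * u) * (a * v)" by (subst assms(2)) simp
  also have "\<dots> = v * (a * u) * v" by (simp only: assms(3) mult.assoc)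
  also have "\<dots> = v * a" by (simp only: mult.assoc assms(1) mult_1_right)
  finally show ?thesis .
qed

text \<open>The one-sided inverses are \<open>y * ?w\<close> and \<open>?w * y\<close>; commutation
  gives the left one, and associativity makes them equal.\<close>

lemma is_unit_el_commuting_factor:
  assumes "is_unit_el (x * y)" "x * y = y * x" shows "is_unit_el x"
proof -
  let ?w = "inv_el (x * y)"
  have *: "x * (y * ?w) = 1" using inv_el(1)[OF assms(1)] by (simp add: mult.assoc)
  have "(?w * y) * x = 1" using inv_el(2)[OF assms(1)] assms(2) by (simp add: mult.assoc)
  then show ?thesis using * by (metis is_unit_elI left_right_inverse_eq)
qed

lemma is_unit_el_scaleC:
  assumes "is_unit_el u" "c \<noteq> 0" shows "is_unit_el (c *\<^sub>C u)"
  by (rule is_unit_elI[of _ "inverse c *\<^sub>C inv_el u"])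
     (use assms in \<open>auto simp: scaleC_simps inv_el\<close>)

text \<open>The exponent starts at one because \<open>norm 1\<close> is not assumed to be at most
  one.\<close>

lemma norm_power_Suc_le: "norm (x ^ Suc n) \<le> norm (x::'a::complex_banach_algebra) ^ Suc n"
proof (induction n)
  case (Suc n)
  have "norm (x ^ Suc (Suc n)) \<le> norm x * norm (x ^ Suc n)"
    by (simp only: power_Suc[of x "Suc n"] norm_mult_ineq)
  also have "\<dots> \<le> norm x * norm x ^ Suc n" using Suc by (intro mult_left_mono) auto
  finally show ?case by simp
qed simp

lemma summable_powers:
  fixes x :: "'a::complex_banach_algebra"
  assumes "norm x < 1" shows "summable (\<lambda>n. norm (x ^ n))"
proof -
  have "summable (\<lambda>n. norm (x ^ Suc n))"
  proof (rule summable_comparison_test)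
    show "\<exists>N. \<forall>n\<ge>N. norm (norm (x ^ Suc n)) \<le> norm x ^ Suc n"
      using norm_power_Suc_le[of x] by auto
    show "summable (\<lambda>n. norm x ^ Suc n)"
      using summable_geometric[of "norm x"] assms by (subst summable_Suc_iff) auto
  qed
  then show ?thesis by (subst (asm) summable_Suc_iff)
qed

lemma neumann_series:
  fixes x :: "'a::complex_banach_algebra"
  assumes "summable (\<lambda>n. norm (x ^ n))"
  shows "(1 - x) * (\<Sum>n. x ^ n) = 1" "(\<Sum>n. x ^ n) * (1 - x) = 1"
proof -
  have s: "summable (\<lambda>n. x ^ n)" using assms by (rule summable_norm_cancel)
  have 1: "(\<Sum>n. x ^ n) = 1 + (\<Sum>n. x ^ Suc n)" using suminf_split_head[OF s] by simp
  have "(\<Sum>n. x ^ Suc n) = x * (\<Sum>n. x ^ n)"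
    using suminf_mult[OF s, of x] by simp
  then show "(1 - x) * (\<Sum>n. x ^ n) = 1" using 1 by (simp add: algebra_simps)
  have "(\<Sum>n. x ^ Suc n) = (\<Sum>n. x ^ n) * x"
    using suminf_mult2[OF s, of x] by (simp add: power_commutes)
  then show "(\<Sum>n. x ^ n) * (1 - x) = 1" using 1 by (simp add: algebra_simps)
qed

lemma is_unit_el_one_minus:
  fixes x :: "'a::complex_banach_algebra"
  assumes "norm x < 1" shows "is_unit_el (1 - x)"
  by (rule is_unit_elI[OF neumann_series[OF summable_powers[OF assms]]])

lemma geometric_factor:
  fixes c :: "'a::complex_banach_algebra"
  shows "(l *\<^sub>C 1 - c) * (\<Sum>j<n. l ^ (n - Suc j) *\<^sub>C c ^ j) = l ^ n *\<^sub>C 1 - c ^ n"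
    and "(\<Sum>j<n. l ^ (n - Suc j) *\<^sub>C c ^ j) * (l *\<^sub>C 1 - c) = l ^ n *\<^sub>C 1 - c ^ n"
proof -
  have *: "(\<Sum>j<Suc n. l ^ (Suc n - Suc j) *\<^sub>C c ^ j) =
     l *\<^sub>C (\<Sum>j<n. l ^ (n - Suc j) *\<^sub>C c ^ j) + c ^ n" for n
  proof -
    have "(\<Sum>j<n. l ^ (Suc n - Suc j) *\<^sub>C c ^ j) = (\<Sum>j<n. l *\<^sub>C (l ^ (n - Suc j) *\<^sub>C c ^ j))"
      by (intro sum.cong refl) (simp add: scaleC_scaleC Suc_diff_Suc flip: power_Suc)
    then show ?thesis by (simp add: scaleC.sum_right scaleC_one)
  qed
  have cc: "c * (\<Sum>j<n. l ^ (n - Suc j) *\<^sub>C c ^ j) = (\<Sum>j<n. l ^ (n - Suc j) *\<^sub>C c ^ j) * c" for n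
    by (simp add: sum_distrib_left sum_distrib_right scaleC_simps power_commutes)
  have a: "(l *\<^sub>C 1 - c) * (\<Sum>j<n. l ^ (n - Suc j) *\<^sub>C c ^ j) = l ^ n *\<^sub>C 1 - c ^ n" for n
  proof (induction n)
    case (Suc n)
    let ?S = "\<Sum>j<n. l ^ (n - Suc j) *\<^sub>C c ^ j"
    have "(l *\<^sub>C 1 - c) * (l *\<^sub>C ?S + c ^ n) = l *\<^sub>C ((l *\<^sub>C 1 - c) * ?S) + (l *\<^sub>C 1 - c) * c ^ n"
      by (simp add: distrib_left scaleC_simps)
    also have "\<dots> = l ^ Suc n *\<^sub>C 1 - c ^ Suc n"
      by (simp only: Suc) (simp add: scaleC_simps algebra_simps)
    finally show ?case by (simp only: *)
  qed (simp add: scaleC_one)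
  then show "(l *\<^sub>C 1 - c) * (\<Sum>j<n. l ^ (n - Suc j) *\<^sub>C c ^ j) = l ^ n *\<^sub>C 1 - c ^ n" .
  show "(\<Sum>j<n. l ^ (n - Suc j) *\<^sub>C c ^ j) * (l *\<^sub>C 1 - c) = l ^ n *\<^sub>C 1 - c ^ n"
    using a[of n] cc[of n] by (simp add: algebra_simps scaleC_simps)
qed

text \<open>\<open>1 - x\<close> divides \<open>1 - x ^ n\<close>, and the cofactor is a polynomial
  in \<open>x\<close>, hence commutes with it. So one small power of \<open>x\<close> makes
  \<open>1 - x\<close> invertible, however large \<open>x\<close> itself is.\<close>

lemma is_unit_el_of_power:
  fixes x :: "'a::complex_banach_algebra"
  assumes "is_unit_el (1 - x ^ n)" shows "is_unit_el (1 - x)"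
proof (rule is_unit_el_commuting_factor)
  show "is_unit_el ((1 - x) * (\<Sum>j<n. 1 ^ (n - Suc j) *\<^sub>C x ^ j))"
    using assms geometric_factor(1)[where l=1 and c=x and n=n] by (simp add: scaleC_one)
  show "(1 - x) * (\<Sum>j<n. 1 ^ (n - Suc j) *\<^sub>C x ^ j) = (\<Sum>j<n. 1 ^ (n - Suc j) *\<^sub>C x ^ j) * (1 - x)"
    using geometric_factor[where l=1 and c=x and n=n] by (simp add: scaleC_one)
qed

section \<open>The resolvent on an annulus\<close>

abbreviation res_el :: "'a::complex_banach_algebra \<Rightarrow> complex \<Rightarrow> 'a" where
  "res_el c l \<equiv> inv_el (l *\<^sub>C 1 - c)"

lemma resolvent_identity:
  assumes "is_unit_el (l *\<^sub>C 1 - c)" "is_unit_el (m *\<^sub>C 1 - c)"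
  shows "res_el c l - res_el c m = (m - l) *\<^sub>C (res_el c l * res_el c m)"
proof -
  let ?R = "res_el c l" and ?S = "res_el c m"
  have "?R * ((m *\<^sub>C 1 - c) - (l *\<^sub>C 1 - c)) * ?S
      = ?R * ((m *\<^sub>C 1 - c) * ?S) - (?R * (l *\<^sub>C 1 - c)) * ?S"
    by (simp only: right_diff_distrib[of ?R "m *\<^sub>C 1 - c"] left_diff_distrib[of _ _ ?S] mult.assoc)
  also have "\<dots> = ?R - ?S" by (simp only: inv_el[OF assms(1)] inv_el[OF assms(2)] mult_1_left mult_1_right)
  finally have "?R * ((m *\<^sub>C 1 - c) - (l *\<^sub>C 1 - c)) * ?S = ?R - ?S" .
  moreover have "(m *\<^sub>C 1 - c) - (l *\<^sub>C 1 - c) = (m - l) *\<^sub>C (1::'a)"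
    by (simp add: scaleC_simps)
  ultimately show ?thesis by (simp add: scaleC_mult_left scaleC_mult_right)
qed

text \<open>The resolvent identity is used twice: close to \<open>m\<close> it bounds
  \<open>norm (res_el c l)\<close> by \<open>2 * ?N\<close>, and with this bound it yields an
  estimate proportional to \<open>cmod (l - m)\<close>.\<close>

lemma continuous_on_resolvent:
  assumes "\<And>l. l \<in> S \<Longrightarrow> is_unit_el (l *\<^sub>C 1 - c)"
  shows "continuous_on S (res_el c)"
  unfolding continuous_on_def
proof
  fix m assume m: "m \<in> S"
  let ?N = "norm (res_el c m) + 1"
  have N: "?N > 0" by (rule add_nonneg_pos) auto
  have "eventually (\<lambda>l. l \<in> S \<and> dist l m < 1 / (2 * ?N)) (at m within S)"
    using N by (auto simp: eventually_at intro!: exI[of _ "1/(2*?N)"])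
  then have ev: "eventually (\<lambda>l. norm (res_el c l - res_el c m) \<le> cmod (l - m) * (2 * ?N * ?N)) (at m within S)"
  proof eventually_elim
    case (elim l)
    then have d: "cmod (l - m) * ?N \<le> 1/2" using N by (simp add: dist_norm field_simps)
    have "norm (res_el c l - res_el c m) \<le> cmod (l - m) * (norm (res_el c l) * norm (res_el c m))"
      using resolvent_identity[OF assms assms, of l m] elim m norm_mult_ineq[of "res_el c l" "res_el c m"]
      by (simp add: norm_scaleC norm_minus_commute mult_left_mono)
    also have "\<dots> \<le> cmod (l - m) * (norm (res_el c l) * ?N)"
      by (intro mult_left_mono) auto
    finally have 1: "norm (res_el c l - res_el c m) \<le> cmod (l - m) * (norm (res_el c l) * ?N)" .
    have "\<dots> = (cmod (l - m) * ?N) * norm (res_el c l)" by (simp add: algebra_simps)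
    also have "\<dots> \<le> 1/2 * norm (res_el c l)" using d by (intro mult_right_mono) auto
    finally have "norm (res_el c l - res_el c m) \<le> 1/2 * norm (res_el c l)" using 1 by linarith
    moreover have "norm (res_el c l) \<le> norm (res_el c l - res_el c m) + norm (res_el c m)"
      using norm_triangle_sub[of "res_el c l" "res_el c m"] by simp
    ultimately have 2: "norm (res_el c l) \<le> 2 * ?N" by simp
    have "cmod (l - m) * (norm (res_el c l) * ?N) \<le> cmod (l - m) * (2 * ?N * ?N)"
      using 2 N by (intro mult_left_mono mult_right_mono) auto
    with 1 show ?case by linarith
  qed
  have "((\<lambda>l. cmod (l - m) * (2 * ?N * ?N)) \<longlongrightarrow> cmod (m - m) * (2 * ?N * ?N)) (at m within S)"
    by (intro tendsto_intros)
  then have "((\<lambda>l. cmod (l - m) * (2 * ?N * ?N)) \<longlongrightarrow> 0) (at m within S)" by simp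
  from Lim_null_comparison[OF ev this]
  show "(res_el c \<longlongrightarrow> res_el c m) (at m within S)" by (simp add: LIM_zero_cancel)
qed

section \<open>Averages over the \<open>n\<close>-th roots of \<open>r ^ n\<close>\<close>

definition root_avg :: "(complex \<Rightarrow> 'a::complex_banach) \<Rightarrow> nat \<Rightarrow> real \<Rightarrow> 'a" where
  "root_avg f n r = (1 / of_nat n) *\<^sub>C (\<Sum>k<n. f (of_real r * cis (2 * pi * real k / real n)))"

text \<open>Discrete orthogonality, the substitute for the vanishing of contour integrals of
  positive powers. Exchanging the roles of \<open>j\<close> and \<open>k\<close> makes the sum
  geometric, with a ratio \<open>?w\<close> that is an \<open>n\<close>-th root of unity other than
  1.\<close>

lemma sum_roots_of_unity_power:
  assumes "0 < j" "j < n"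
  shows "(\<Sum>k<n. cis (2 * pi * real k / real n) ^ j) = 0"
proof -
  let ?w = "cis (2 * pi * real j / real n)"
  have "(\<Sum>k<n. cis (2 * pi * real k / real n) ^ j) = (\<Sum>k<n. ?w ^ k)"
    by (intro sum.cong refl) (unfold Complex.DeMoivre, rule arg_cong[where f=cis], simp)
  also have "\<dots> = (?w ^ n - 1) / (?w - 1)"
  proof (rule geometric_sum)
    have "cis (2 * pi * real j / real n) \<noteq> cis (2 * pi * real 0 / real n)"
    proof
      assume "cis (2 * pi * real j / real n) = cis (2 * pi * real 0 / real n)"
      from inj_onD[OF bij_betw_imp_inj_on[OF Complex.bij_betw_roots_unity[of n]] this] assms
      show False by simp
    qed
    then show "?w \<noteq> 1" by simp
  qed
  also have "?w ^ n = 1" using assms by (unfold Complex.DeMoivre) simp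
  finally show ?thesis by simp
qed

lemma root_avg_power:
  assumes "0 < j" "j < n"
  shows "root_avg (\<lambda>l. l ^ j *\<^sub>C x) n r = 0"
proof -
  have "(\<Sum>k<n. (of_real r * cis (2 * pi * real k / real n)) ^ j *\<^sub>C x) =
     (of_real r ^ j * (\<Sum>k<n. cis (2 * pi * real k / real n) ^ j)) *\<^sub>C x"
    by (simp add: power_mult_distrib sum_distrib_left scaleC.sum_left)
  then show ?thesis using sum_roots_of_unity_power[OF assms] by (simp add: root_avg_def)
qed

lemma root_avg_const: "n > 0 \<Longrightarrow> root_avg (\<lambda>l. x) n r = x"
  by (simp add: root_avg_def complex_vector.sum_constant_scale scaleC_scaleC scaleC_one flip: of_nat_sum)

lemma root_avg_add: "root_avg (\<lambda>l. f l + g l) n r = root_avg f n r + root_avg g n r"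
  by (simp add: root_avg_def sum.distrib scaleC_simps)

lemma root_avg_sum: "root_avg (\<lambda>l. \<Sum>i\<in>A. f i l) n r = (\<Sum>i\<in>A. root_avg (f i) n r)"
  unfolding root_avg_def by (subst sum.swap) (simp add: scaleC.sum_right)

lemma root_avg_mult_left: "root_avg (\<lambda>l. a * f l) n r = (a::'a::complex_banach_algebra) * root_avg f n r"
  by (simp add: root_avg_def sum_distrib_left scaleC_simps)

lemma root_avg_mult_right: "root_avg (\<lambda>l. f l * a) n r = root_avg f n r * (a::'a::complex_banach_algebra)"
  by (simp add: root_avg_def sum_distrib_right scaleC_simps)

lemma root_avg_cong:
  assumes "\<And>l. cmod l = \<bar>r\<bar> \<Longrightarrow> f l = g l" shows "root_avg f n r = root_avg g n r"
  unfolding root_avg_def by (intro arg_cong2[where f=scaleC] sum.cong refl assms) (simp add: norm_mult)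

lemma norm_root_avg_le:
  assumes "n > 0" "\<And>k. k < n \<Longrightarrow> norm (f (of_real r * cis (2 * pi * real k / real n))) \<le> B"
  shows "norm (root_avg f n r) \<le> B"
proof -
  have "norm (\<Sum>k<n. f (of_real r * cis (2 * pi * real k / real n))) \<le> real (card {..<n}) * B"
    by (rule sum_norm_bound) (use assms in auto)
  then show ?thesis using assms by (simp add: root_avg_def norm_scaleC norm_divide divide_le_eq field_simps)
qed

lemma power_scaleC: "(a *\<^sub>C x) ^ n = a ^ n *\<^sub>C (x::'a::complex_banach_algebra) ^ n"
  by (induction n) (simp_all add: scaleC_simps)

lemma power_commutes_with:
  "a * c = c * a \<Longrightarrow> (a::'a::monoid_mult) * c ^ n = c ^ n * a"
  by (induction n) (simp_all, metis mult.assoc)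

lemma power_mult_commuting:
  assumes "(x::'a::monoid_mult) * y = y * x" shows "(x * y) ^ n = x ^ n * y ^ n"
proof (induction n)
  case (Suc n)
  have "(x * y) ^ Suc n = x * (y * x ^ n) * y ^ n" by (simp add: Suc mult.assoc)
  also have "y * x ^ n = x ^ n * y" using assms by (intro power_commutes_with) simp
  finally show ?case by (simp add: mult.assoc)
qed simp

lemma power_idempotent: "p * p = p \<Longrightarrow> n > 0 \<Longrightarrow> (p::'a::monoid_mult) ^ n = p"
proof (induction n)
  case (Suc n) then show ?case by (cases "n = 0") auto
qed simp

lemma root_avg_cong_samples:
  assumes "\<And>k. k < n \<Longrightarrow> f (of_real r * cis (2 * pi * real k / real n)) = g (of_real r * cis (2 * pi * real k / real n))"
  shows "root_avg f n r = root_avg g n r"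
  unfolding root_avg_def by (intro arg_cong2[where f=scaleC] sum.cong refl assms) simp

lemma commutes_res_el:
  assumes "is_unit_el (l *\<^sub>C 1 - c)" "a * c = c * a"
  shows "a * res_el c l = res_el c l * a"
  by (rule inverse_commutes[OF inv_el[OF assms(1)]])
     (simp add: algebra_simps scaleC_simps assms(2))

text \<open>The averages \<open>res_avg c n r\<close> are the Riemann sums of the Cauchy integral that defines the
  spectral idempotent of the part of the spectrum inside the circle of radius \<open>r\<close>; in closed form
  they are \<open>(1 - (c / r)\<^sup>n)\<^sup>-\<^sup>1\<close>, which replaces contour integration below.\<close>

definition res_avg :: "'a::complex_banach_algebra \<Rightarrow> nat \<Rightarrow> real \<Rightarrow> 'a" where
  "res_avg c n r = root_avg (\<lambda>l. l *\<^sub>C res_el c l) n r"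

text \<open>Division with remainder: \<open>l ^ N\<close> times the resolvent is a polynomial in
  \<open>l\<close> plus \<open>c ^ N\<close> times the resolvent. For \<open>N < n\<close> all
  polynomial terms average to zero, which leaves the moments of the resolvent; for
  \<open>N = n\<close> only the term \<open>j = 0\<close> survives, which leads to the closed form
  of \<open>res_avg\<close>.\<close>

lemma root_avg_power_res_el:
  assumes inv: "\<And>l. cmod l = r \<Longrightarrow> is_unit_el (l *\<^sub>C 1 - c)" and r: "r > 0"
  shows "root_avg (\<lambda>l. l ^ Suc N *\<^sub>C res_el c l) n r
    = (\<Sum>j<N. root_avg (\<lambda>l. l ^ (N - j) *\<^sub>C c ^ j) n r) + c ^ N * res_avg c n r"
proof -
  have "l ^ Suc N *\<^sub>C res_el c l = (\<Sum>j<N. l ^ (N - j) *\<^sub>C c ^ j) + c ^ N * (l *\<^sub>C res_el c l)"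
    if "cmod l = \<bar>r\<bar>" for l
  proof -
    have u: "(l *\<^sub>C 1 - c) * res_el c l = 1" using inv_el(1) inv that r by auto
    have "(l ^ N *\<^sub>C 1 - c ^ N) * res_el c l
        = (\<Sum>j<N. l ^ (N - Suc j) *\<^sub>C c ^ j) * ((l *\<^sub>C 1 - c) * res_el c l)"
      by (simp only: geometric_factor(2)[symmetric] mult.assoc)
    also have "\<dots> = (\<Sum>j<N. l ^ (N - Suc j) *\<^sub>C c ^ j)" by (simp only: u mult_1_right)
    finally have "l ^ N *\<^sub>C res_el c l = (\<Sum>j<N. l ^ (N - Suc j) *\<^sub>C c ^ j) + c ^ N * res_el c l"
      by (simp add: left_diff_distrib scaleC_mult_left algebra_simps)
    then have "l *\<^sub>C (l ^ N *\<^sub>C res_el c l)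
        = (\<Sum>j<N. l *\<^sub>C (l ^ (N - Suc j) *\<^sub>C c ^ j)) + c ^ N * (l *\<^sub>C res_el c l)"
      by (simp only: scaleC_add_right scaleC.sum_right scaleC_mult_right)
    moreover have "(\<Sum>j<N. l *\<^sub>C (l ^ (N - Suc j) *\<^sub>C c ^ j)) = (\<Sum>j<N. l ^ (N - j) *\<^sub>C c ^ j)"
      by (intro sum.cong refl) (simp add: scaleC_scaleC Suc_diff_Suc flip: power_Suc)
    ultimately show ?thesis by (simp add: scaleC_scaleC)
  qed
  then have "root_avg (\<lambda>l. l ^ Suc N *\<^sub>C res_el c l) n r
     = root_avg (\<lambda>l. (\<Sum>j<N. l ^ (N - j) *\<^sub>C c ^ j) + c ^ N * (l *\<^sub>C res_el c l)) n r"
    by (rule root_avg_cong)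
  then show ?thesis
    by (simp only: root_avg_add root_avg_sum root_avg_mult_left res_avg_def)
qed

lemma root_avg_power_res_el_less:
  assumes "\<And>l. cmod l = r \<Longrightarrow> is_unit_el (l *\<^sub>C 1 - c)" "r > 0" "N < n"
  shows "root_avg (\<lambda>l. l ^ Suc N *\<^sub>C res_el c l) n r = c ^ N * res_avg c n r"
  using assms(3) by (subst root_avg_power_res_el[OF assms(1,2)]) (auto intro!: sum.neutral root_avg_power)

lemma commutes_res_avg:
  assumes "\<And>l. cmod l = r \<Longrightarrow> is_unit_el (l *\<^sub>C 1 - c)" "r > 0" "a * c = c * a"
  shows "a * res_avg c n r = res_avg c n r * a"
  unfolding res_avg_def root_avg_mult_left[symmetric] root_avg_mult_right[symmetric]
proof (rule root_avg_cong)
  fix l assume "cmod l = \<bar>r\<bar>"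
  then have "a * res_el c l = res_el c l * a" using assms by (intro commutes_res_el) auto
  then show "a * (l *\<^sub>C res_el c l) = l *\<^sub>C res_el c l * a" by (simp add: scaleC_simps)
qed

lemma res_avg_inverse:
  assumes inv: "\<And>l. cmod l = r \<Longrightarrow> is_unit_el (l *\<^sub>C 1 - c)" and r: "r > 0" and n: "n > 0"
  shows "(1 - (inverse (of_real r) *\<^sub>C c) ^ n) * res_avg c n r = 1"
    and "res_avg c n r * (1 - (inverse (of_real r) *\<^sub>C c) ^ n) = 1"
proof -
  let ?R = "complex_of_real r ^ n"
  have samp: "(complex_of_real r * cis (2 * pi * real k / real n)) ^ n = ?R" for k
  proof -
    have "cis (2 * pi * real k / real n) ^ n = cis (2 * pi * real k)"
      using n by (simp add: Complex.DeMoivre)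
    also have "\<dots> = 1" using cis_multiple_2pi[of "real k"] by simp
    finally show ?thesis by (simp add: power_mult_distrib)
  qed
  \<comment> \<open>All sample points have the same \<open>n\<close>-th power, so the expansion with
    \<open>N = n\<close> becomes a linear equation for \<open>res_avg c n r\<close>.\<close>
  have "root_avg (\<lambda>l. l ^ Suc n *\<^sub>C res_el c l) n r = root_avg (\<lambda>l. ?R *\<^sub>C 1 * (l *\<^sub>C res_el c l)) n r"
    by (rule root_avg_cong_samples) (simp only: power_Suc2 samp scaleC_mult_left mult_1_left flip: scaleC_scaleC)
  also have "\<dots> = ?R *\<^sub>C res_avg c n r"
    by (subst root_avg_mult_left) (simp add: res_avg_def scaleC_simps)
  finally have 1: "?R *\<^sub>C res_avg c n r =
     (\<Sum>j<n. root_avg (\<lambda>l. l ^ (n - j) *\<^sub>C c ^ j) n r) + c ^ n * res_avg c n r"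
    using root_avg_power_res_el[OF inv r, of n n] by simp
  have "(\<Sum>j<n. root_avg (\<lambda>l. l ^ (n - j) *\<^sub>C c ^ j) n r)
     = (\<Sum>j\<in>{0}. root_avg (\<lambda>l. l ^ (n - j) *\<^sub>C c ^ j) n r)"
    using n by (intro sum.mono_neutral_right) (auto intro!: root_avg_power)
  also have "\<dots> = root_avg (\<lambda>l. ?R *\<^sub>C 1) n r"
    unfolding sum.insert[OF finite.emptyI, of 0, simplified]
    by simp (rule root_avg_cong_samples, simp add: samp)
  also have "\<dots> = ?R *\<^sub>C 1" using n by (rule root_avg_const)
  finally have "?R *\<^sub>C res_avg c n r = ?R *\<^sub>C 1 + c ^ n * res_avg c n r" using 1 by simp
  then have "inverse ?R *\<^sub>C (?R *\<^sub>C res_avg c n r) = inverse ?R *\<^sub>C (?R *\<^sub>C 1 + c ^ n * res_avg c n r)"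
    by simp
  then have "res_avg c n r = 1 + inverse ?R *\<^sub>C (c ^ n * res_avg c n r)"
    using r by (simp add: scaleC_simps)
  then have "res_avg c n r - inverse ?R *\<^sub>C (c ^ n * res_avg c n r) = 1"
    by (simp only: diff_eq_eq)
  then show *: "(1 - (inverse (of_real r) *\<^sub>C c) ^ n) * res_avg c n r = 1"
    by (simp add: left_diff_distrib power_scaleC scaleC_simps power_inverse)
  have "c ^ n * res_avg c n r = res_avg c n r * c ^ n"
    by (rule commutes_res_avg[OF inv r]) (simp_all add: power_commutes)
  then show "res_avg c n r * (1 - (inverse (of_real r) *\<^sub>C c) ^ n) = 1"
    using * by (simp add: left_diff_distrib right_diff_distrib power_scaleC scaleC_simps)
qed

section \<open>The spectral idempotent of an annulus that is free of spectrum\<close>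

locale resolvent_annulus =
  fixes c :: "'a::complex_banach_algebra" and r1 r2 :: real
  assumes r1: "0 \<le> r1" and r12: "r1 < r2"
    and inv: "\<And>l. r1 < cmod l \<Longrightarrow> cmod l < r2 \<Longrightarrow> is_unit_el (l *\<^sub>C 1 - c)"
begin

lemma circle_inv: "r1 < r \<Longrightarrow> r < r2 \<Longrightarrow> cmod l = r \<Longrightarrow> is_unit_el (l *\<^sub>C 1 - c)"
  using inv by simp

text \<open>One modulus of continuity in polar coordinates serves two purposes: at a fixed radius it
  makes the averages Cauchy in \<open>n\<close>, and at fixed angles it makes their limit continuous
  in the radius.\<close>

lemma uniform_on_polar:
  assumes "r1 < a" "b < r2" "e > 0"
  obtains d where "d > 0"
    "\<And>s s' t t'. \<lbrakk>s \<in> {a..b}; s' \<in> {a..b}; t \<in> {0..1}; t' \<in> {0..1}; \<bar>s - s'\<bar> < d; \<bar>t - t'\<bar> < d\<rbrakk> \<Longrightarrow>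
       norm ((of_real s * cis (2 * pi * t)) *\<^sub>C res_el c (of_real s * cis (2 * pi * t))
          - (of_real s' * cis (2 * pi * t')) *\<^sub>C res_el c (of_real s' * cis (2 * pi * t'))) < e"
proof -
  define g where "g = (\<lambda>(s::real, t). (of_real s * cis (2 * pi * t)) *\<^sub>C res_el c (of_real s * cis (2 * pi * t)))"
  have "continuous_on ({a..b} \<times> {0..1}) g"
    unfolding g_def case_prod_beta
  proof (intro continuous_on_scaleC continuous_intros continuous_on_compose2[OF continuous_on_resolvent])
    show "is_unit_el (l *\<^sub>C 1 - c)" if "l \<in> {l. r1 < cmod l \<and> cmod l < r2}" for l
      using that inv by simp
    show "(\<lambda>x. complex_of_real (fst x) * cis (2 * pi * snd x)) ` ({a..b} \<times> {0..1})
        \<subseteq> {l. r1 < cmod l \<and> cmod l < r2}"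
      using assms r1 by (auto simp: norm_mult)
  qed
  then have "uniformly_continuous_on ({a..b} \<times> {0..1}) g"
    by (intro compact_uniformly_continuous compact_Times) auto
  then obtain d where d: "d > 0" "\<And>x x'. x \<in> {a..b} \<times> {0..1} \<Longrightarrow> x' \<in> {a..b} \<times> {0..1} \<Longrightarrow> dist x' x < d
     \<Longrightarrow> dist (g x') (g x) < e"
    using assms(3) unfolding uniformly_continuous_on_def by metis
  \<comment> \<open>Half of \<open>d\<close> suffices for each coordinate, since the distance in the
    product is at most the sum of the coordinate distances.\<close>
  show thesis
  proof (rule that[of "d / 2"])
    show "d / 2 > 0" using d by simp
    fix s s' t t' :: real
    assume *: "s \<in> {a..b}" "s' \<in> {a..b}" "t \<in> {0..1}" "t' \<in> {0..1}" "\<bar>s - s'\<bar> < d/2" "\<bar>t - t'\<bar> < d/2"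
    have "dist (s, t) (s', t') \<le> \<bar>s - s'\<bar> + \<bar>t - t'\<bar>"
      unfolding dist_Pair_Pair dist_real_def by (rule sqrt_sum_squares_le_sum) auto
    then have "dist (g (s, t)) (g (s', t')) < e" using * by (intro d(2)) auto
    then show "norm ((of_real s * cis (2 * pi * t)) *\<^sub>C res_el c (of_real s * cis (2 * pi * t))
          - (of_real s' * cis (2 * pi * t')) *\<^sub>C res_el c (of_real s' * cis (2 * pi * t'))) < e"
      by (simp add: g_def dist_norm)
  qed
qed

lemma res_avg_diff_le:
  assumes "n > 0"
    "\<And>k. k < n \<Longrightarrow> norm ((of_real s * cis (2 * pi * (real k / real n))) *\<^sub>C res_el c (of_real s * cis (2 * pi * (real k / real n)))
          - (of_real s' * cis (2 * pi * (real k / real n))) *\<^sub>C res_el c (of_real s' * cis (2 * pi * (real k / real n)))) \<le> e"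
  shows "norm (res_avg c n s - res_avg c n s') \<le> e"
proof -
  let ?h = "\<lambda>s k. (of_real s * cis (2 * pi * (real k / real n))) *\<^sub>C res_el c (of_real s * cis (2 * pi * (real k / real n)))"
  have "norm (\<Sum>k<n. ?h s k - ?h s' k) \<le> real (card {..<n}) * e"
    by (rule sum_norm_bound) (use assms in auto)
  moreover have "res_avg c n s - res_avg c n s' = (1 / of_nat n) *\<^sub>C (\<Sum>k<n. ?h s k - ?h s' k)"
    by (simp add: res_avg_def root_avg_def sum_subtractf scaleC_simps)
  ultimately show ?thesis using assms(1)
    by (simp add: norm_scaleC norm_divide divide_le_eq mult.commute)
qed

text \<open>Each coarse sample is repeated \<open>m\<close> times, so that the fine index
  \<open>i\<close> is paired with the coarse index \<open>i div m\<close>; the two angles differ by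
  less than one coarse step. Any two averages can then be compared through the common refinement
  with \<open>n * m\<close> points.\<close>

lemma res_avg_refine_le:
  assumes "n > 0" "m > 0" "r1 < r" "r < r2" "1 / real n < d"
    "\<And>t t'. \<lbrakk>t \<in> {0..1}; t' \<in> {0..1}; \<bar>t - t'\<bar> < d\<rbrakk> \<Longrightarrow>
       norm ((of_real r * cis (2 * pi * t)) *\<^sub>C res_el c (of_real r * cis (2 * pi * t))
          - (of_real r * cis (2 * pi * t')) *\<^sub>C res_el c (of_real r * cis (2 * pi * t'))) \<le> e"
  shows "norm (res_avg c n r - res_avg c (n * m) r) \<le> e"
proof -
  define h where "h t = (of_real r * cis (2 * pi * t)) *\<^sub>C res_el c (of_real r * cis (2 * pi * t))" for t
  have 1: "res_avg c n r = (1 / of_nat n) *\<^sub>C (\<Sum>k<n. h (real k / real n))" for n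
    by (simp add: res_avg_def root_avg_def h_def)
  have "(\<Sum>i<n * m. h (real i / real (n * m))) = (\<Sum>k<n. \<Sum>i=k*m..<k*m+m. h (real i / real (n * m)))"
    by (rule sum.nat_group[symmetric])
  moreover have "(\<Sum>i<n * m. h (real (i div m) / real n)) = (\<Sum>k<n. \<Sum>i=k*m..<k*m+m. h (real (i div m) / real n))"
    by (rule sum.nat_group[symmetric])
  moreover have "(\<Sum>i=k*m..<k*m+m. h (real (i div m) / real n)) = of_nat m *\<^sub>C h (real k / real n)" for k
  proof -
    have "i div m = k" if "i \<in> {k*m..<k*m+m}" for i
      using that assms(2) by (intro div_nat_eqI) (auto simp: mult.commute)
    then have "(\<Sum>i=k*m..<k*m+m. h (real (i div m) / real n)) = (\<Sum>i=k*m..<k*m+m. h (real k / real n))"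
      by (intro sum.cong) auto
    then show ?thesis by (simp add: complex_vector.sum_constant_scale)
  qed
  ultimately have "(\<Sum>k<n. h (real k / real n)) = (1 / of_nat m) *\<^sub>C (\<Sum>i<n * m. h (real (i div m) / real n))"
    using assms(2) by (simp add: scaleC_simps flip: scaleC.sum_right)
  then have "res_avg c n r - res_avg c (n * m) r
     = (1 / of_nat (n * m)) *\<^sub>C (\<Sum>i<n * m. h (real (i div m) / real n) - h (real i / real (n * m)))"
    unfolding 1[of n] 1[of "n * m"] by (simp add: sum_subtractf scaleC_simps)
  moreover have "norm (\<Sum>i<n * m. h (real (i div m) / real n) - h (real i / real (n * m)))
      \<le> real (card {..<n * m}) * e"
  proof (rule sum_norm_bound)
    fix i assume "i \<in> {..<n * m}"
    then have i: "i < n * m" by simp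
    then have id: "i div m < n" by (simp add: less_mult_imp_div_less)
    have e: "real i = real (i div m) * real m + real (i mod m)"
      by (metis mod_mult_div_eq of_nat_add of_nat_mult mult.commute add.commute)
    have abs_lessI: "\<bar>y - x\<bar> < d" if "x - y = z" "z < u" "0 \<le> z" "u < d" for x y z u :: real
      using that by linarith
    have "real i / real (n * m) - real (i div m) / real n = real (i mod m) / (real n * real m)"
      using assms(1,2) by (subst e) (simp add: field_simps)
    moreover have "real (i mod m) / (real n * real m) < 1 / real n"
      using assms(1,2) by (simp add: field_simps)
    ultimately have "\<bar>real (i div m) / real n - real i / real (n * m)\<bar> < d"
      by (rule abs_lessI) (use assms(5) in simp_all)
    moreover have "real (i div m) / real n \<in> {0..1}" using id assms(1) by simp
    moreover have "real i / real (n * m) \<in> {0..1}" using i by (simp add: divide_le_eq flip: of_nat_mult)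
    ultimately show "norm (h (real (i div m) / real n) - h (real i / real (n * m))) \<le> e"
      unfolding h_def by (intro assms(6))
  qed
  ultimately show ?thesis using assms(1,2)
    by (simp add: norm_scaleC norm_divide norm_mult divide_le_eq mult.commute flip: of_nat_mult)
qed

definition spec_idem :: "real \<Rightarrow> 'a" where "spec_idem r = lim (\<lambda>n. res_avg c n r)"

lemma res_avg_tendsto:
  assumes r: "r1 < r" "r < r2"
  shows "(\<lambda>n. res_avg c n r) \<longlonglongrightarrow> spec_idem r"
proof -
  have "Cauchy (\<lambda>n. res_avg c n r)"
  proof (rule metric_CauchyI)
    fix e :: real assume e: "e > 0"
    obtain d where d: "d > 0" "\<And>t t'. \<lbrakk>t \<in> {0..1}; t' \<in> {0..1}; \<bar>t - t'\<bar> < d\<rbrakk> \<Longrightarrow>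
       norm ((of_real r * cis (2 * pi * t)) *\<^sub>C res_el c (of_real r * cis (2 * pi * t))
          - (of_real r * cis (2 * pi * t')) *\<^sub>C res_el c (of_real r * cis (2 * pi * t'))) < e / 3"
    proof (rule uniform_on_polar[of r r "e/3"])
      show "r1 < r" "r < r2" "e / 3 > 0" using r e by auto
      fix d assume *: "d > 0" "\<And>s s' t t'. \<lbrakk>s \<in> {r..r}; s' \<in> {r..r}; t \<in> {0..1}; t' \<in> {0..1}; \<bar>s - s'\<bar> < d; \<bar>t - t'\<bar> < d\<rbrakk> \<Longrightarrow>
       norm ((of_real s * cis (2 * pi * t)) *\<^sub>C res_el c (of_real s * cis (2 * pi * t))
          - (of_real s' * cis (2 * pi * t')) *\<^sub>C res_el c (of_real s' * cis (2 * pi * t'))) < e / 3"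
      show thesis by (rule that[OF *(1)], rule *(2)) (use *(1) in auto)
    qed
    obtain N where N: "N > 0" "1 / real N < d" using d(1) by (metis nat_approx_posE zero_less_Suc)
    have "dist (res_avg c m r) (res_avg c n r) < e" if "m \<ge> N" "n \<ge> N" for m n
    proof -
      have mn: "m > 0" "n > 0" "1 / real m < d" "1 / real n < d"
        using that N by (auto intro: le_less_trans[OF _ N(2)] simp: frac_le)
      have "norm (res_avg c m r - res_avg c (m * n) r) \<le> e/3"
        using mn r d(2) by (intro res_avg_refine_le[of m n r d]) (auto intro: less_imp_le)
      moreover have "norm (res_avg c n r - res_avg c (n * m) r) \<le> e/3"
        using mn r d(2) by (intro res_avg_refine_le[of n m r d]) (auto intro: less_imp_le)
      ultimately have "norm (res_avg c m r - res_avg c n r) \<le> e/3 + e/3"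
        unfolding mult.commute[of n m] norm_minus_commute[of "res_avg c n r"]
        by (rule norm_diff_triangle_le)
      then show ?thesis using e by (simp add: dist_norm)
    qed
    then show "\<exists>M. \<forall>m\<ge>M. \<forall>n\<ge>M. dist (res_avg c m r) (res_avg c n r) < e" by blast
  qed
  then show ?thesis unfolding spec_idem_def
    using Cauchy_convergent_iff convergent_LIMSEQ_iff by blast
qed

lemma spec_idem_commutes:
  assumes "r1 < r" "r < r2" "a * c = c * a"
  shows "a * spec_idem r = spec_idem r * a"
proof -
  have "(\<lambda>n. a * res_avg c n r) \<longlonglongrightarrow> a * spec_idem r"
    by (intro tendsto_intros res_avg_tendsto assms)
  moreover have "a * res_avg c n r = res_avg c n r * a" for n
    by (rule commutes_res_avg) (use assms r1 circle_inv in auto)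
  moreover have "(\<lambda>n. res_avg c n r * a) \<longlonglongrightarrow> spec_idem r * a"
    by (intro tendsto_intros res_avg_tendsto assms)
  ultimately show ?thesis by (simp add: LIMSEQ_unique)
qed

text \<open>The averages are the inverses of \<open>?A\<close> and \<open>?B\<close>, and with
  \<open>?t = (s / r) ^ n\<close> the powers of \<open>c\<close> cancel in
  \<open>?A - ?t ?B = 1 - ?t\<close>. Multiplying by both inverses gives \<open>eq\<close>, and
  \<open>?t\<close> tends to 0. This uses \<open>s < r\<close>, so the case of equal radii needs a
  further limit.\<close>

lemma spec_idem_mult:
  assumes s: "r1 < s" "s < r" "r < r2"
  shows "spec_idem r * spec_idem s = spec_idem s"
proof -
  have pos: "s > 0" "r > 0" using s r1 by auto
  have eq: "(1 - of_real ((s / r) ^ n)) *\<^sub>C (res_avg c n r * res_avg c n s)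
      = res_avg c n s - of_real ((s / r) ^ n) *\<^sub>C res_avg c n r" if n: "n > 0" for n
  proof -
    let ?t = "complex_of_real ((s / r) ^ n)" and ?p = "res_avg c n r" and ?q = "res_avg c n s"
    let ?A = "1 - (inverse (of_real r) *\<^sub>C c) ^ n" and ?B = "1 - (inverse (of_real s) *\<^sub>C c) ^ n"
    have A: "?p * ?A = 1"
      using s pos n by (intro res_avg_inverse(2) circle_inv) auto
    have B: "?B * ?q = 1"
      using s pos n by (intro res_avg_inverse(1) circle_inv) auto
    have "?t * inverse (of_real s) ^ n = inverse (of_real r) ^ n"
      using pos by (simp add: field_simps power_divide)
    then have "(1 - ?t) *\<^sub>C 1 = ?A - ?t *\<^sub>C ?B"
      by (simp add: power_scaleC scaleC_simps)
    then have "?p * ((1 - ?t) *\<^sub>C 1) * ?q = ?p * (?A - ?t *\<^sub>C ?B) * ?q" by simp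
    also have "\<dots> = (?p * ?A) * ?q - ?t *\<^sub>C (?p * (?B * ?q))"
      by (simp only: right_diff_distrib[of ?p ?A] left_diff_distrib[of "?p * ?A"] scaleC_mult_left scaleC_mult_right mult.assoc)
    also have "\<dots> = ?q - ?t *\<^sub>C ?p" by (simp only: A B) simp
    finally show ?thesis by (simp add: scaleC_mult_left scaleC_mult_right)
  qed
  have "(\<lambda>n. (s / r) ^ n) \<longlonglongrightarrow> 0" using s pos by (intro LIMSEQ_realpow_zero) auto
  then have t: "(\<lambda>n. complex_of_real ((s / r) ^ n)) \<longlonglongrightarrow> 0"
    using tendsto_of_real[of "\<lambda>n. (s / r) ^ n" 0] by (simp del: of_real_power)
  have t1: "(\<lambda>n. (1 - of_real ((s / r) ^ n)) *\<^sub>C (res_avg c n r * res_avg c n s))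
      \<longlonglongrightarrow> (1 - 0) *\<^sub>C (spec_idem r * spec_idem s)"
    using s by (intro tendsto_scaleC tendsto_diff tendsto_const t tendsto_mult res_avg_tendsto) auto
  have t2: "(\<lambda>n. res_avg c n s - of_real ((s / r) ^ n) *\<^sub>C res_avg c n r)
      \<longlonglongrightarrow> spec_idem s - 0 *\<^sub>C spec_idem r"
    using s by (intro tendsto_scaleC tendsto_diff tendsto_const t tendsto_mult res_avg_tendsto) auto
  have ev: "eventually (\<lambda>n. (1 - of_real ((s / r) ^ n)) *\<^sub>C (res_avg c n r * res_avg c n s)
      = res_avg c n s - of_real ((s / r) ^ n) *\<^sub>C res_avg c n r) sequentially"
    using eventually_gt_at_top[of 0] by eventually_elim (rule eq)
  have "(1 - 0) *\<^sub>C (spec_idem r * spec_idem s) = spec_idem s - 0 *\<^sub>C spec_idem r"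
    by (rule LIMSEQ_unique[OF t1 t2[unfolded tendsto_cong[OF ev, symmetric]]])
  then show ?thesis by (simp add: scaleC_one)
qed

lemma continuous_on_spec_idem: "continuous_on {r1<..<r2} spec_idem"
  unfolding continuous_on_iff
proof (intro ballI allI impI)
  fix r e :: real assume r: "r \<in> {r1<..<r2}" and e: "e > 0"
  \<comment> \<open>Midpoints towards the two ends, so that a compact band around \<open>r\<close>
    stays inside the annulus.\<close>
  let ?a = "(r1 + r) / 2" and ?b = "(r + r2) / 2"
  obtain d where d: "d > 0"
    "\<And>s s' t t'. \<lbrakk>s \<in> {?a..?b}; s' \<in> {?a..?b}; t \<in> {0..1}; t' \<in> {0..1}; \<bar>s - s'\<bar> < d; \<bar>t - t'\<bar> < d\<rbrakk> \<Longrightarrow>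
       norm ((of_real s * cis (2 * pi * t)) *\<^sub>C res_el c (of_real s * cis (2 * pi * t))
          - (of_real s' * cis (2 * pi * t')) *\<^sub>C res_el c (of_real s' * cis (2 * pi * t'))) < e / 2"
    by (rule uniform_on_polar[of ?a ?b "e/2"]) (use r e in auto)
  have "dist (spec_idem s) (spec_idem r) < e" if s: "s \<in> {r1<..<r2}" "dist s r < min d (min (r - ?a) (?b - r))" for s
  proof -
    have le: "norm (res_avg c n s - res_avg c n r) \<le> e/2" if n: "n > 0" for n
    proof (rule res_avg_diff_le[OF n], rule less_imp_le, rule d(2))
      show "s \<in> {?a..?b}" "r \<in> {?a..?b}" "\<bar>s - r\<bar> < d" using s r by (auto simp: dist_real_def abs_if split: if_splits)
    qed (use n d(1) in \<open>auto simp: divide_le_eq\<close>)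
    have "(\<lambda>n. norm (res_avg c n s - res_avg c n r)) \<longlonglongrightarrow> norm (spec_idem s - spec_idem r)"
      using s r by (intro tendsto_intros res_avg_tendsto) auto
    then have "norm (spec_idem s - spec_idem r) \<le> e/2"
      using le by (intro LIMSEQ_le_const2[of "\<lambda>n. norm (res_avg c n s - res_avg c n r)"]) (auto intro!: exI[of _ 1])
    then show ?thesis using e by (simp add: dist_norm)
  qed
  moreover have "min d (min (r - ?a) (?b - r)) > 0" using r d(1) by auto
  ultimately show "\<exists>d>0. \<forall>x'\<in>{r1<..<r2}. dist x' r < d \<longrightarrow> dist (spec_idem x') (spec_idem r) < e" by blast
qed

text \<open>Let the smaller radius in \<open>spec_idem_mult\<close> tend to \<open>r\<close> from
  the left.\<close>

lemma spec_idem_idem: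
  assumes r: "r1 < r" "r < r2"
  shows "spec_idem r * spec_idem r = spec_idem r"
proof -
  have "isCont spec_idem r"
    using continuous_on_spec_idem r by (simp add: continuous_on_eq_continuous_at)
  then have t: "(spec_idem \<longlongrightarrow> spec_idem r) (at_left r)"
    by (simp add: isCont_def filterlim_at_split)
  have "((\<lambda>s. spec_idem r * spec_idem s) \<longlongrightarrow> spec_idem r * spec_idem r) (at_left r)"
    by (intro tendsto_intros t)
  moreover have "eventually (\<lambda>s. spec_idem r * spec_idem s = spec_idem s) (at_left r)"
    using eventually_at_left_real[OF r(1)] by eventually_elim (use r in \<open>auto intro: spec_idem_mult\<close>)
  ultimately have "(spec_idem \<longlongrightarrow> spec_idem r * spec_idem r) (at_left r)"
    by (simp add: tendsto_cong)
  then show ?thesis using t tendsto_unique trivial_limit_at_left_real by blast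
qed

text \<open>The idempotents of two radii commute and are nested, so their difference is again
  idempotent; an idempotent of norm less than 1 is 0. By continuity \<open>spec_idem\<close> is
  locally constant on a connected interval.\<close>

lemma spec_idem_const:
  assumes r: "r1 < r" "r < r2" and s: "r1 < s" "s < r2"
  shows "spec_idem r = spec_idem s"
proof -
  have eqI: "spec_idem a = spec_idem b"
    if "r1 < a" "a < b" "b < r2" "norm (spec_idem b - spec_idem a) < 1" for a b
  proof -
    let ?x = "spec_idem b - spec_idem a"
    have comm: "spec_idem a * spec_idem b = spec_idem b * spec_idem a"
      using that by (intro spec_idem_commutes spec_idem_commutes[symmetric]) auto
    have "?x * ?x = ?x"
      using that spec_idem_mult[of a b] spec_idem_idem[of a] spec_idem_idem[of b] comm
      by (simp add: algebra_simps)
    then have "norm (?x) \<le> norm (?x) * norm (?x)" by (metis norm_mult_ineq)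
    then have "norm ?x = 0" using that(4)
      by (metis mult_le_cancel_left1 norm_ge_zero not_le order_antisym_conv)
    then show ?thesis by simp
  qed
  show ?thesis
  proof (rule connected_local_const[of "{r1<..<r2}" r s])
    show "\<forall>a\<in>{r1<..<r2}. eventually (\<lambda>b. spec_idem a = spec_idem b) (at a within {r1<..<r2})"
    proof
      fix a assume a: "a \<in> {r1<..<r2}"
      from continuous_on_spec_idem a obtain d where d: "d > 0"
        "\<forall>b\<in>{r1<..<r2}. dist b a < d \<longrightarrow> dist (spec_idem b) (spec_idem a) < 1"
        unfolding continuous_on_iff by (metis zero_less_one)
      have "spec_idem a = spec_idem b" if "b \<in> {r1<..<r2}" "dist b a < d" for b
      proof (cases a b rule: linorder_cases)
        case less then show ?thesis using that d a by (intro eqI) (auto simp: dist_norm)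
      next
        case greater then show ?thesis using that d a
          by (intro eqI[symmetric]) (auto simp: dist_norm norm_minus_commute[of "spec_idem a"])
      qed simp
      then show "eventually (\<lambda>b. spec_idem a = spec_idem b) (at a within {r1<..<r2})"
        using d(1) by (auto simp: eventually_at)
    qed
  qed (use r s in auto)
qed

end

lemma power_mult_idempotent:
  "c * p = p * c \<Longrightarrow> p * p = p \<Longrightarrow> n > 0 \<Longrightarrow> (c * p) ^ n = c ^ n * (p::'a::monoid_mult)"
  by (metis power_mult_commuting power_idempotent)

lemma commutes_one_minus:
  "a * e = e * a \<Longrightarrow> (a::'a::{ring,monoid_mult}) * (1 - e) = (1 - e) * a"
  by (simp add: right_diff_distrib left_diff_distrib)

context resolvent_annulus
begin

text \<open>The error \<open>?e n\<close> of the average on the range of the idempotent tends to 0.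
  From \<open>(1 - ?x n) * ?P n = 1\<close> the wanted sequence satisfies
  \<open>?y n = ?e n - ?y n * ?e n\<close>, so eventually its norm is at most twice that of
  \<open>?e n\<close>.\<close>

lemma powers_spec_idem_tendsto_0:
  assumes r: "r1 < r" "r < r2"
  shows "(\<lambda>n. (inverse (of_real r) *\<^sub>C c) ^ n * spec_idem r) \<longlonglongrightarrow> 0"
proof -
  let ?p = "spec_idem r" and ?P = "\<lambda>n. res_avg c n r" and ?x = "\<lambda>n. (inverse (of_real r) *\<^sub>C c) ^ n"
  let ?e = "\<lambda>n. (?P n - 1) * ?p" and ?y = "\<lambda>n. ?x n * ?p"
  have pos: "r > 0" using r r1 by simp
  have pp: "?p * ?p = ?p" using r by (rule spec_idem_idem)
  have "?e \<longlonglongrightarrow> (?p - 1) * ?p" by (intro tendsto_intros res_avg_tendsto r)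
  then have e0: "?e \<longlonglongrightarrow> 0" by (simp add: left_diff_distrib pp)
  have eq: "?y n = ?e n - ?y n * ?e n" if n: "n > 0" for n
  proof -
    have inv1: "(1 - ?x n) * ?P n = 1" using r pos n by (intro res_avg_inverse circle_inv) auto
    have cP: "?P n * c = c * ?P n"
      using r pos by (intro commutes_res_avg[symmetric] circle_inv) auto
    have Pp: "?P n * ?p = ?p * ?P n"
      using r cP by (intro spec_idem_commutes) auto
    have "?p * (?P n * ?p) = ?P n * ?p" using Pp pp by (metis mult.assoc)
    then have pe: "?p * ?e n = ?e n"
      by (simp add: right_diff_distrib left_diff_distrib pp)
    have "(1 - ?x n) * ?e n = ((1 - ?x n) * ?P n) * ?p - (1 - ?x n) * ?p"
      by (simp only: left_diff_distrib[of "?P n" 1 ?p] right_diff_distrib mult_1_left mult.assoc)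
    also have "\<dots> = ?y n" by (simp only: inv1 mult_1_left) (simp add: left_diff_distrib)
    finally have "?e n - ?x n * ?e n = ?y n" by (simp only: left_diff_distrib[of 1] mult_1_left)
    then show ?thesis using pe by (simp add: mult.assoc)
  qed
  have "eventually (\<lambda>n. norm (?e n) < 1/2) sequentially"
    using e0 by (auto dest!: tendstoD[of _ _ _ "1/2"])
  then have ev: "eventually (\<lambda>n. norm (?y n) \<le> 2 * norm (?e n)) sequentially"
    using eventually_gt_at_top[of 0]
  proof eventually_elim
    case (elim n)
    have "norm (?y n) \<le> norm (?e n) + norm (?y n * ?e n)"
      using arg_cong[OF eq[OF elim(2)], of norm] norm_triangle_ineq4[of "?e n" "?y n * ?e n"] by simp
    also have "norm (?y n * ?e n) \<le> norm (?y n) * (1/2)"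
      by (rule order_trans[OF norm_mult_ineq]) (use elim(1) in \<open>intro mult_left_mono, auto\<close>)
    finally show ?case by simp
  qed
  have "(\<lambda>n. 2 * norm (?e n)) \<longlonglongrightarrow> 2 * norm (0::'a)" by (intro tendsto_intros e0)
  then show ?thesis by (intro Lim_null_comparison[OF ev]) simp
qed

text \<open>Off the idempotent the averages tend to 0, so for some \<open>n\<close> the element
  \<open>e = ?P n * (1 - ?p)\<close> has norm below 1 and \<open>1 - e\<close> is invertible. The
  identity \<open>?x n * ?P n = ?P n - 1\<close> exhibits \<open>e - (1 - ?p)\<close> as a multiple
  \<open>c * h\<close> of \<open>c\<close>; dividing by \<open>1 - e\<close> turns
  \<open>- h\<close> into the inverse of \<open>c\<close> on the complement.\<close>

lemma inverse_off_spec_idem: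
  assumes r: "r1 < r" "r < r2"
  obtains b where "c * b = 1 - spec_idem r" "b * c = 1 - spec_idem r"
    "spec_idem r * b = 0" "b * spec_idem r = 0"
proof -
  let ?p = "spec_idem r" and ?P = "\<lambda>n. res_avg c n r" and ?x = "\<lambda>n. (inverse (of_real r) *\<^sub>C c) ^ n"
  have pos: "r > 0" using r r1 by simp
  have pp: "?p * ?p = ?p" using r by (rule spec_idem_idem)
  have "(\<lambda>n. ?P n * (1 - ?p)) \<longlonglongrightarrow> ?p * (1 - ?p)" by (intro tendsto_intros res_avg_tendsto r)
  then have "(\<lambda>n. ?P n * (1 - ?p)) \<longlonglongrightarrow> 0" by (simp add: right_diff_distrib pp)
  then have "eventually (\<lambda>n. norm (?P n * (1 - ?p)) < 1) sequentially"
    by (auto dest!: tendstoD[of _ _ _ 1])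
  then have "eventually (\<lambda>n. norm (?P n * (1 - ?p)) < 1 \<and> n > 0) sequentially"
    by (intro eventually_conj eventually_gt_at_top)
  then obtain n where n: "norm (?P n * (1 - ?p)) < 1" "n > 0"
    using eventually_happens'[OF sequentially_bot] by blast
  define e where "e = ?P n * (1 - ?p)"
  define w where "w = inv_el (1 - e)"
  have w: "(1 - e) * w = 1" "w * (1 - e) = 1"
    unfolding w_def using inv_el[OF is_unit_el_one_minus[OF n(1)[folded e_def]]] by auto
  have inv1: "(1 - ?x n) * ?P n = 1" using r pos n by (intro res_avg_inverse circle_inv) auto
  have cP: "c * ?P n = ?P n * c"
    using r pos by (intro commutes_res_avg circle_inv) auto
  have pc: "c * ?p = ?p * c" using r by (intro spec_idem_commutes) auto
  have Pp: "?P n * ?p = ?p * ?P n"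
    using r cP by (intro spec_idem_commutes) auto
  have cPp: "c * (?P n * ?p) = ?P n * ?p * c" using cP pc by (metis mult.assoc)
  have "c * e = c * ?P n - c * (?P n * ?p)" by (simp only: e_def right_diff_distrib mult_1_right)
  also have "\<dots> = ?P n * c - ?P n * ?p * c" using cP cPp by argo
  also have "\<dots> = e * c" by (simp only: e_def right_diff_distrib left_diff_distrib mult_1_right)
  finally have ce: "c * e = e * c" .
  have "?p * (?P n * ?p) = ?p * ?P n" using Pp pp by (metis mult.assoc)
  then have pe: "?p * e = 0" "e * ?p = 0"
    by (simp_all add: e_def right_diff_distrib left_diff_distrib mult.assoc pp)
  have cw: "c * w = w * c"
    by (rule inverse_commutes[OF w commutes_one_minus[OF ce]])
  have pw: "?p * w = ?p" "w * ?p = ?p"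
  proof -
    have "?p * ((1 - e) * w) = (?p * (1 - e)) * w" by (simp only: mult.assoc)
    also have "?p * (1 - e) = ?p" by (simp only: right_diff_distrib[of ?p 1] pe) simp
    finally show "?p * w = ?p" by (simp only: w mult_1_right)
    have "(w * (1 - e)) * ?p = w * ((1 - e) * ?p)" by (simp only: mult.assoc)
    also have "(1 - e) * ?p = ?p" by (simp only: left_diff_distrib[of 1] pe) simp
    finally show "w * ?p = ?p" by (simp only: w mult_1_left)
  qed
  \<comment> \<open>This is \<open>?x n * e\<close> with one factor \<open>c\<close> taken out,
    which is possible as \<open>n > 0\<close>.\<close>
  define h where "h = inverse (of_real r) ^ n *\<^sub>C (c ^ (n - 1) * e)"
  have cc: "c * c ^ (n - 1) = c ^ n" using n(2) by (cases n) auto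
  have "c * h = inverse (of_real r) ^ n *\<^sub>C ((c * c ^ (n - 1)) * e)"
    by (simp only: h_def scaleC_mult_right mult.assoc)
  then have "c * h = ?x n * ?P n * (1 - ?p)"
    by (simp only: e_def cc power_scaleC scaleC_mult_left mult.assoc)
  also have "?x n * ?P n = ?P n - 1" using inv1 by (simp add: left_diff_distrib diff_eq_eq eq_diff_eq add.commute)
  finally have ch: "c * h = e - (1 - ?p)" by (simp only: e_def left_diff_distrib[of "?P n"] mult_1_left)
  have hc: "h * c = c * h"
  proof -
    have "c ^ (n - 1) * e * c = c * (c ^ (n - 1) * e)"
      by (metis ce mult.assoc power_commutes)
    then show ?thesis by (simp add: h_def scaleC_simps)
  qed
  have hp: "h * ?p = 0" "?p * h = 0"
  proof -
    show "h * ?p = 0" by (simp add: h_def scaleC_simps mult.assoc pe)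
    have "?p * c ^ (n - 1) = c ^ (n - 1) * ?p" using pc by (intro power_commutes_with) simp
    then have "?p * (c ^ (n - 1) * e) = c ^ (n - 1) * (?p * e)" by (metis mult.assoc)
    then show "?p * h = 0" by (simp add: h_def scaleC_mult_right pe)
  qed
  show thesis
  proof (rule that[of "- (h * w)"])
    have "c * (h * w) = (e - 1) * w + ?p * w"
      using ch by (simp add: left_diff_distrib distrib_right flip: mult.assoc)
    moreover have "(e - 1) * w = - ((1 - e) * w)" by (simp add: left_diff_distrib)
    ultimately show 1: "c * - (h * w) = 1 - ?p" by (simp add: pw w(1))
    have "h * w * c = c * (h * w)" by (metis cw hc mult.assoc)
    then show "- (h * w) * c = 1 - ?p" using 1 by simp
    show "?p * - (h * w) = 0" using hp by (simp flip: mult.assoc)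
    show "- (h * w) * ?p = 0" using hp pw by (simp add: mult.assoc)
  qed
qed

end

section \<open>Quasi-nilpotent elements\<close>

definition quasi_nil :: "'a::complex_banach_algebra \<Rightarrow> bool" where
  "quasi_nil q \<longleftrightarrow> (\<forall>l. l \<noteq> 0 \<longrightarrow> is_unit_el (l *\<^sub>C 1 - q))"

lemma is_unit_el_of_powers_tendsto_0:
  assumes "(\<lambda>n. (inverse l *\<^sub>C q) ^ n) \<longlonglongrightarrow> 0" "l \<noteq> 0"
  shows "is_unit_el (l *\<^sub>C 1 - q)"
proof -
  have "eventually (\<lambda>n. norm ((inverse l *\<^sub>C q) ^ n) < 1) sequentially"
    using assms(1) by (auto dest!: tendstoD[of _ _ _ 1])
  then obtain n where "norm ((inverse l *\<^sub>C q) ^ n) < 1"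
    using eventually_happens'[OF sequentially_bot] by blast
  then have "is_unit_el (1 - inverse l *\<^sub>C q)"
    by (rule is_unit_el_of_power[of _ n, OF is_unit_el_one_minus])
  from is_unit_el_scaleC[OF this assms(2)] show ?thesis
    using assms(2) by (simp add: scaleC_simps)
qed

text \<open>On a circle of radius beyond \<open>norm q\<close> the powers of \<open>q / s\<close>
  tend to 0, so the averages tend to 1. All positive radii carry the same spectral idempotent, hence
  it is 1 on arbitrarily small circles as well. This takes the place of the spectral radius
  formula.\<close>

lemma quasi_nil_res_avg:
  assumes "quasi_nil q" "r > 0"
  shows "(\<lambda>n. res_avg q n r) \<longlonglongrightarrow> 1" "(\<lambda>n. (inverse (of_real r) *\<^sub>C q) ^ n) \<longlonglongrightarrow> 0"
proof -
  \<comment> \<open>Larger than both \<open>r\<close> and \<open>norm q\<close>, so that the annulus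
    from 0 to \<open>s + 1\<close> contains both circles.\<close>
  define s where "s = r + norm q + 1"
  interpret resolvent_annulus q 0 "s + 1"
  proof
    show "0 < s + 1" using assms(2) norm_ge_zero[of q] unfolding s_def by linarith
    fix l assume "0 < cmod l"
    then show "is_unit_el (l *\<^sub>C 1 - q)" using assms(1) by (auto simp: quasi_nil_def)
  qed simp
  have s: "r < s" "s > 0" "s < s + 1" "norm q < s"
    using assms(2) norm_ge_zero[of q] unfolding s_def by linarith+
  let ?x = "inverse (complex_of_real s) *\<^sub>C q"
  have "norm ?x < 1" using s
    by (simp add: norm_scaleC norm_divide inverse_eq_divide)
  then have "(\<lambda>n. norm (?x ^ n)) \<longlonglongrightarrow> 0" by (intro summable_LIMSEQ_zero summable_powers)
  then have x0: "(\<lambda>n. ?x ^ n) \<longlonglongrightarrow> 0" by (simp add: tendsto_norm_zero_iff)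
  have "(\<lambda>n. (1 - ?x ^ n) * res_avg q n s) \<longlonglongrightarrow> (1 - 0) * spec_idem s"
    by (intro tendsto_intros x0 res_avg_tendsto s)
  moreover have "eventually (\<lambda>n. (1 - ?x ^ n) * res_avg q n s = 1) sequentially"
    using eventually_gt_at_top[of 0]
    by eventually_elim (use s in \<open>intro res_avg_inverse circle_inv, auto\<close>)
  ultimately have "(\<lambda>n. 1) \<longlonglongrightarrow> (1 - 0) * spec_idem s" by (rule Lim_transform_eventually)
  then have "spec_idem s = 1" by (simp add: LIMSEQ_const_iff)
  then have "spec_idem r = 1"
    using spec_idem_const[of r s] assms s by auto
  then show "(\<lambda>n. res_avg q n r) \<longlonglongrightarrow> 1" "(\<lambda>n. (inverse (of_real r) *\<^sub>C q) ^ n) \<longlonglongrightarrow> 0"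
    using res_avg_tendsto[of r] powers_spec_idem_tendsto_0[of r] assms(2) s by auto
qed

section \<open>Isolated points of the spectrum\<close>

text \<open>\<open>p\<close> is the spectral idempotent of \<open>c\<close> at 0 and
  \<open>b\<close> its generalized Drazin inverse. The case \<open>p = 0\<close> is included: then
  \<open>c\<close> is invertible with inverse \<open>b\<close>.\<close>

definition spectral_split :: "'a::complex_banach_algebra \<Rightarrow> 'a \<Rightarrow> 'a \<Rightarrow> bool" where
  "spectral_split c p b \<longleftrightarrow> p * p = p \<and> p * c = c * p \<and> c * b = 1 - p \<and> b * c = 1 - p \<and>
     p * b = 0 \<and> b * p = 0 \<and> quasi_nil (c * p)"

lemma isolated_imp_spectral_split:
  assumes R: "R > 0" and inv: "\<And>l. 0 < cmod l \<Longrightarrow> cmod l < R \<Longrightarrow> is_unit_el (l *\<^sub>C 1 - c)"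
  obtains p b where "spectral_split c p b"
proof -
  interpret resolvent_annulus c 0 R by standard (use assms in auto)
  let ?p = "spec_idem (R / 2)"
  have R2: "0 < R / 2" "R / 2 < R" using R by auto
  obtain b where b: "c * b = 1 - ?p" "b * c = 1 - ?p" "?p * b = 0" "b * ?p = 0"
    using inverse_off_spec_idem[OF R2] by blast
  have pp: "?p * ?p = ?p" using R2 by (rule spec_idem_idem)
  have pc: "c * ?p = ?p * c" using R2 by (intro spec_idem_commutes) auto
  have "is_unit_el (l *\<^sub>C 1 - c * ?p)" if "l \<noteq> 0" for l
  proof (rule is_unit_el_of_powers_tendsto_0[OF _ that])
    \<comment> \<open>At most \<open>cmod l\<close>, so that \<open>1 / l\<close> is dominated by
      \<open>1 / ?r\<close>, and less than \<open>R\<close>, so that the idempotent is still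
      \<open>?p\<close>.\<close>
    let ?r = "min (cmod l) (R / 2)"
    have r: "0 < ?r" "?r < R" using that R by auto
    have pr: "spec_idem ?r = ?p" by (rule spec_idem_const[OF r R2])
    have "eventually (\<lambda>n. norm ((inverse l *\<^sub>C (c * ?p)) ^ n)
        \<le> norm ((inverse (of_real ?r) *\<^sub>C c) ^ n * spec_idem ?r)) sequentially"
      using eventually_gt_at_top[of 0]
    proof eventually_elim
      case (elim n)
      have "norm ((inverse l *\<^sub>C (c * ?p)) ^ n) = inverse (cmod l) ^ n * norm (c ^ n * ?p)"
        using power_mult_idempotent[OF pc pp elim]
        by (simp add: power_scaleC norm_scaleC norm_power norm_inverse)
      also have "\<dots> \<le> inverse ?r ^ n * norm (c ^ n * ?p)"
        using r by (intro mult_right_mono power_mono le_imp_inverse_le) auto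
      also have "\<dots> = norm ((inverse (of_real ?r) *\<^sub>C c) ^ n * spec_idem ?r)"
        unfolding pr using r by (simp add: power_scaleC scaleC_mult_left norm_scaleC norm_power norm_inverse)
      finally show ?case .
    qed
    moreover have "(\<lambda>n. norm ((inverse (of_real ?r) *\<^sub>C c) ^ n * spec_idem ?r)) \<longlonglongrightarrow> 0"
      by (rule tendsto_norm_zero[OF powers_spec_idem_tendsto_0[OF r]])
    ultimately show "(\<lambda>n. (inverse l *\<^sub>C (c * ?p)) ^ n) \<longlonglongrightarrow> 0" by (rule Lim_null_comparison)
  qed
  then show thesis using that[of ?p b] b pp pc by (simp add: spectral_split_def quasi_nil_def)
qed

text \<open>With \<open>?v\<close> the inverse of \<open>c\<close>, the constant \<open>p\<close>
  equals \<open>(r ?v) ^ n\<close> times \<open>(c p / r) ^ n\<close> for every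
  \<open>n > 0\<close>. The radius \<open>r\<close> is chosen so small that the first factor tends
  to 0; the second does so by quasi-nilpotence.\<close>

lemma spectral_split_unit_imp_zero:
  assumes "spectral_split c p b" "is_unit_el c" shows "p = 0"
proof -
  let ?q = "c * p" and ?v = "inv_el c"
  have pp: "p * p = p" and pc: "p * c = c * p" and q: "quasi_nil ?q"
    using assms(1) by (auto simp: spectral_split_def)
  have vp: "?v * p = p * ?v"
    by (rule inverse_commutes[OF inv_el[OF assms(2)], symmetric]) (rule pc)
  define r where "r = 1 / (norm ?v + 1)"
  have "norm ?v + 1 > 0" by (rule add_nonneg_pos) auto
  then have r: "r > 0" "norm (complex_of_real r *\<^sub>C ?v) < 1"
    by (auto simp: r_def norm_scaleC norm_divide divide_simps simp del: of_real_add)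
  have "(\<lambda>n. norm ((complex_of_real r *\<^sub>C ?v) ^ n)) \<longlonglongrightarrow> 0"
    by (intro summable_LIMSEQ_zero summable_powers r)
  then have "(\<lambda>n. (complex_of_real r *\<^sub>C ?v) ^ n) \<longlonglongrightarrow> 0" by (simp add: tendsto_norm_zero_iff)
  from tendsto_mult[OF this quasi_nil_res_avg(2)[OF q r(1)]]
  have "(\<lambda>n. (complex_of_real r *\<^sub>C ?v) ^ n * (inverse (of_real r) *\<^sub>C ?q) ^ n) \<longlonglongrightarrow> 0" by simp
  moreover have "eventually (\<lambda>n. (complex_of_real r *\<^sub>C ?v) ^ n * (inverse (of_real r) *\<^sub>C ?q) ^ n = p) sequentially"
    using eventually_gt_at_top[of 0]
  proof eventually_elim
    case (elim n)
    have "(complex_of_real r *\<^sub>C ?v) ^ n * (inverse (of_real r) *\<^sub>C ?q) ^ n = ?v ^ n * c ^ n * p"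
      using r power_mult_idempotent[OF pc[symmetric] pp elim]
      by (simp add: power_scaleC scaleC_simps mult.assoc field_simps)
    also have "?v ^ n * c ^ n = 1"
      using inv_el[OF assms(2)] by (metis power_mult_commuting power_one)
    finally show ?case by simp
  qed
  ultimately have "(\<lambda>n. p) \<longlonglongrightarrow> 0" by (rule Lim_transform_eventually)
  then show ?thesis by (simp add: LIMSEQ_const_iff)
qed

text \<open>On the range of \<open>p\<close> the resolvent is that of \<open>c * p\<close>. On the
  complement \<open>b\<close> inverts \<open>c\<close>, so \<open>l - c\<close> is inverted there by
  \<open>- b\<close> times the Neumann series of \<open>l b\<close>, which is the holomorphic
  part.\<close>

lemma spectral_split_resolvent:
  assumes "spectral_split c p b" "l \<noteq> 0" "cmod l * norm b < 1"
  shows "is_unit_el (l *\<^sub>C 1 - c)"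
    "res_el c l = res_el (c * p) l * p - b * (\<Sum>n. (l *\<^sub>C b) ^ n)"
    "summable (\<lambda>n. norm ((l *\<^sub>C b) ^ n))"
proof -
  let ?q = "c * p" and ?S = "\<Sum>n. (l *\<^sub>C b) ^ n"
  have pp: "p * p = p" and pc: "p * c = c * p" and q: "quasi_nil ?q"
    and b: "c * b = 1 - p" "b * c = 1 - p" "p * b = 0" "b * p = 0"
    using assms(1) by (auto simp: spectral_split_def)
  show s: "summable (\<lambda>n. norm ((l *\<^sub>C b) ^ n))"
    using assms(3) by (intro summable_powers) (simp add: norm_scaleC)
  have S: "(1 - l *\<^sub>C b) * ?S = 1" "?S * (1 - l *\<^sub>C b) = 1" by (rule neumann_series[OF s])+
  let ?R = "res_el ?q l"
  have uq: "is_unit_el (l *\<^sub>C 1 - ?q)" using q assms(2) by (simp add: quasi_nil_def)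
  have R: "(l *\<^sub>C 1 - ?q) * ?R = 1" "?R * (l *\<^sub>C 1 - ?q) = 1" using inv_el[OF uq] by auto
  have Rp: "p * ?R = ?R * p"
    by (rule commutes_res_el[OF uq]) (metis pc mult.assoc)
  have Rc: "c * ?R = ?R * c"
    by (rule commutes_res_el[OF uq]) (metis pc mult.assoc)
  have cS: "c * ?S = ?S * c"
    by (rule inverse_commutes[OF S]) (simp add: algebra_simps scaleC_simps b)
  have bS: "b * ?S = ?S * b"
    by (rule inverse_commutes[OF S]) (simp add: algebra_simps scaleC_simps b)
  have pS: "p * ?S = p"
  proof -
    have "p * ((1 - l *\<^sub>C b) * ?S) = p * ?S"
      by (simp add: b right_diff_distrib left_diff_distrib scaleC_simps flip: mult.assoc)
    then show ?thesis by (simp add: S)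
  qed
  let ?X = "?R * p - b * ?S"
  have 1: "(l *\<^sub>C 1 - c) * (?R * p) = p"
  proof -
    have "(l *\<^sub>C 1 - c) * (p * ?R) = ((l *\<^sub>C 1 - c) * p) * ?R" by (simp only: mult.assoc)
    also have "(l *\<^sub>C 1 - c) * p = p * (l *\<^sub>C 1 - ?q)"
      using pc pp
      by (simp add: left_diff_distrib right_diff_distrib scaleC_simps) (metis mult.assoc)
    also have "\<dots> * ?R = p" by (simp add: mult.assoc R)
    finally show ?thesis by (simp add: Rp)
  qed
  have 2: "(l *\<^sub>C 1 - c) * (b * ?S) = p - 1"
  proof -
    have "(l *\<^sub>C 1 - c) * (b * ?S) = ((l *\<^sub>C 1 - c) * b) * ?S" by (simp only: mult.assoc)
    also have "(l *\<^sub>C 1 - c) * b = p - (1 - l *\<^sub>C b)"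
      by (simp add: left_diff_distrib scaleC_simps b)
    also have "\<dots> * ?S = p - 1" by (simp add: left_diff_distrib[of p] pS S)
    finally show ?thesis .
  qed
  have X: "(l *\<^sub>C 1 - c) * ?X = 1" by (simp add: right_diff_distrib[of _ "?R * p"] 1 2)
  have "c * (?R * p) = ?R * p * c" using Rc pc by (metis mult.assoc)
  moreover have "c * (b * ?S) = b * ?S * c" using cS b by (metis mult.assoc)
  ultimately have "c * ?X = ?X * c" by (simp add: right_diff_distrib left_diff_distrib)
  then have X': "?X * (l *\<^sub>C 1 - c) = 1"
    using X by (simp add: right_diff_distrib[of ?X] left_diff_distrib[of _ c ?X] scaleC_simps)
  show "is_unit_el (l *\<^sub>C 1 - c)" using X X' by (rule is_unit_elI)
  show "res_el c l = ?X" using X X' by (rule inv_el_eqI)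
qed

section \<open>Poles of the resolvent\<close>

text \<open>Multiplication by \<open>l ^ N\<close> turns the expansion into a power series. Its
  convergence at the single point \<open>s\<close> bounds the terms there by some \<open>M\<close>,
  and for \<open>cmod l < s / 2\<close> they are majorized by \<open>M * (1/2) ^ k\<close>, with sum
  \<open>M * 2\<close>.\<close>

lemma laurent_bounded_near_pole:
  fixes a :: "int \<Rightarrow> 'a::complex_banach" and f :: "complex \<Rightarrow> 'a"
  assumes r: "r > 0"
    and f: "\<And>l. 0 < cmod l \<Longrightarrow> cmod l < r \<Longrightarrow> ((\<lambda>n. (l powi n) *\<^sub>C a n) has_sum f l) UNIV"
    and a: "\<And>n. n < - int N \<Longrightarrow> a n = 0"
  obtains C d where "d > 0" "\<And>l. 0 < cmod l \<Longrightarrow> cmod l < d \<Longrightarrow> norm (l ^ N *\<^sub>C f l) \<le> C"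
proof -
  define A where "A k = a (int k - int N)" for k
  have sums: "(\<lambda>k. l ^ k *\<^sub>C A k) sums (l ^ N *\<^sub>C f l)" if l: "0 < cmod l" "cmod l < r" for l
  proof -
    have "((\<lambda>n. (l powi n) *\<^sub>C a n) has_sum f l) {- int N..}"
      using f[OF l] by (rule has_sum_cong_neutral[THEN iffD1, rotated -1]) (auto simp: a)
    moreover have "bij_betw (\<lambda>k. int k - int N) UNIV {- int N..}"
      by (rule bij_betwI[of _ _ _ "\<lambda>n. nat (n + int N)"]) auto
    ultimately have "((\<lambda>k. (l powi (int k - int N)) *\<^sub>C A k) has_sum f l) UNIV"
      unfolding A_def by (subst has_sum_reindex_bij_betw)
    then have "(\<lambda>k. (l powi (int k - int N)) *\<^sub>C A k) sums f l" by (rule has_sum_imp_sums)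
    then have "(\<lambda>k. l ^ N *\<^sub>C ((l powi (int k - int N)) *\<^sub>C A k)) sums (l ^ N *\<^sub>C f l)"
      by (rule bounded_linear.sums[OF scaleC.bounded_linear_right])
    moreover have "l ^ N * (l powi (int k - int N)) = l ^ k" for k
      using l by (simp add: power_int_diff)
    ultimately show ?thesis by (simp add: scaleC_scaleC)
  qed
  define s where "s = r / 2"
  have s: "0 < s" "s < r" using r by (auto simp: s_def)
  have "summable (\<lambda>k. complex_of_real s ^ k *\<^sub>C A k)"
    using sums[of "complex_of_real s"] s by (auto simp: summable_def)
  then have "Bseq (\<lambda>k. complex_of_real s ^ k *\<^sub>C A k)"
    by (intro convergent_imp_Bseq) (auto simp: convergent_def dest: summable_LIMSEQ_zero)
  then obtain M where M: "M > 0" "\<And>k. norm (complex_of_real s ^ k *\<^sub>C A k) \<le> M"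
    by (auto elim: BseqE)
  show thesis
  proof (rule that[of "s / 2" "M * 2"])
    show "s / 2 > 0" using s by simp
    fix l assume l: "0 < cmod l" "cmod l < s / 2"
    have le: "norm (l ^ k *\<^sub>C A k) \<le> M * (1/2) ^ k" for k
    proof -
      have "norm (l ^ k *\<^sub>C A k) = cmod l ^ k * norm (A k)" by (simp add: norm_scaleC norm_power)
      also have "\<dots> \<le> (s / 2) ^ k * norm (A k)"
        using l by (intro mult_right_mono power_mono) auto
      also have "\<dots> = (1/2) ^ k * norm (complex_of_real s ^ k *\<^sub>C A k)"
        using s by (simp add: norm_scaleC norm_power power_divide)
      also have "\<dots> \<le> (1/2) ^ k * M" using M by (intro mult_left_mono) auto
      finally show ?thesis by (simp add: mult.commute)
    qed
    have g: "(\<lambda>k. M * (1/2) ^ k) sums (M * 2)"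
      using sums_mult[OF geometric_sums[of "1/2::real"], of M] by simp
    have sn: "summable (\<lambda>k. norm (l ^ k *\<^sub>C A k))"
      by (rule summable_comparison_test[OF _ sums_summable[OF g]]) (use le in auto)
    have "norm (l ^ N *\<^sub>C f l) = norm (\<Sum>k. l ^ k *\<^sub>C A k)"
      using sums_unique[OF sums[of l]] l s by simp
    also have "\<dots> \<le> (\<Sum>k. norm (l ^ k *\<^sub>C A k))" by (rule summable_norm[OF sn])
    also have "\<dots> \<le> (\<Sum>k. M * (1/2) ^ k)" by (rule suminf_le[OF le sn sums_summable[OF g]])
    also have "\<dots> = M * 2" using g by (rule sums_unique[symmetric])
    finally show "norm (l ^ N *\<^sub>C f l) \<le> M * 2" .
  qed
qed

text \<open>Near 0 the product \<open>l ^ N\<close> times the resolvent is bounded, so the averages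
  of \<open>l ^ Suc N\<close> times the resolvent over a circle of radius \<open>s\<close> are of
  order \<open>s\<close>. After multiplication by \<open>p\<close> they equal
  \<open>?q ^ N * res_avg ?q n s * p\<close>, which tends to \<open>?q ^ N * p\<close> as
  \<open>n\<close> grows, whatever \<open>s\<close> is. Letting \<open>s\<close> tend to 0 gives
  \<open>?q ^ N * p = 0\<close>.\<close>

lemma spectral_split_laurent_imp_nilpotent:
  assumes split: "spectral_split c p b" and r: "r > 0"
    and f: "\<And>l. 0 < cmod l \<Longrightarrow> cmod l < r \<Longrightarrow> ((\<lambda>n. (l powi n) *\<^sub>C a n) has_sum res_el c l) UNIV"
    and fin: "finite {n. n < 0 \<and> a n \<noteq> 0}"
  shows "\<exists>n\<ge>1. (c * p) ^ n = 0"
proof -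
  let ?q = "c * p"
  have pp: "p * p = p" and pc: "p * c = c * p" and q: "quasi_nil ?q"
    using split by (auto simp: spectral_split_def)
  obtain m where "\<forall>n\<in>{n. n < 0 \<and> a n \<noteq> 0}. m \<le> n"
    using finite_has_minimal2 fin by (meson bdd_below.unfold bdd_below_finite)
  have "a n = 0" if "n < - int (nat (- m))" for n
  proof (rule ccontr)
    assume "a n \<noteq> 0"
    moreover have "n < 0" using that by linarith
    ultimately have "m \<le> n" using \<open>\<forall>n\<in>{n. n < 0 \<and> a n \<noteq> 0}. m \<le> n\<close> by simp
    then show False using that by linarith
  qed
  then obtain N where N: "\<And>n. n < - int N \<Longrightarrow> a n = 0" by blast
  obtain C d where d: "d > 0" and C: "\<And>l. 0 < cmod l \<Longrightarrow> cmod l < d \<Longrightarrow> norm (l ^ N *\<^sub>C res_el c l) \<le> C"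
    using laurent_bounded_near_pole[OF r f N] by blast
  \<comment> \<open>The second bound gives \<open>cmod l * norm b < 1\<close>, the range in which
    the resolvent formula holds.\<close>
  define e where "e = min d (1 / (norm b + 1))"
  have b1: "norm b + 1 > 0" by (rule add_nonneg_pos) auto
  then have e: "e > 0" using d by (simp add: e_def)
  have bound: "norm (?q ^ N * p) \<le> s * (C * norm p)" if s: "0 < s" "s < e" for s
  proof -
    have cs: "norm (l ^ Suc N *\<^sub>C res_el ?q l * p) \<le> s * (C * norm p)" if l: "cmod l = s" for l
    proof -
      have l0: "l \<noteq> 0" using l s by auto
      have "s * norm b < 1"
      proof -
        have "s * (norm b + 1) < 1" using s b1 by (simp add: e_def less_divide_eq)
        then show ?thesis using s by (simp add: distrib_left)
      qed
      then have u: "res_el c l = res_el ?q l * p - b * (\<Sum>n. (l *\<^sub>C b) ^ n)"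
          "summable (\<lambda>n. norm ((l *\<^sub>C b) ^ n))"
        using spectral_split_resolvent[OF split l0] l by auto
      \<comment> \<open>Multiplication by \<open>p\<close> on the right kills the holomorphic part,
        once \<open>b\<close> is moved next to \<open>p\<close>.\<close>
      have bS: "b * (\<Sum>n. (l *\<^sub>C b) ^ n) * p = 0"
      proof -
        have "b * (\<Sum>n. (l *\<^sub>C b) ^ n) = (\<Sum>n. (l *\<^sub>C b) ^ n) * b"
          by (rule inverse_commutes[OF neumann_series[OF u(2)]]) (simp add: algebra_simps scaleC_simps)
        then show ?thesis using split by (simp add: spectral_split_def mult.assoc)
      qed
      have "res_el ?q l * p = res_el c l * p"
        by (simp only: u(1) left_diff_distrib[of "res_el ?q l * p"] bS) (simp add: mult.assoc pp)
      then have "norm (l ^ Suc N *\<^sub>C res_el ?q l * p) = cmod l * norm ((l ^ N *\<^sub>C res_el c l) * p)"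
        by (simp add: scaleC_mult_left norm_scaleC norm_mult)
      also have "\<dots> \<le> cmod l * (norm (l ^ N *\<^sub>C res_el c l) * norm p)"
        by (intro mult_left_mono norm_mult_ineq) auto
      also have "\<dots> \<le> cmod l * (C * norm p)"
        using l s by (intro mult_left_mono mult_right_mono C) (auto simp: e_def)
      finally show ?thesis using l by simp
    qed
    have le: "norm (?q ^ N * res_avg ?q n s * p) \<le> s * (C * norm p)" if n: "n > N" for n
    proof -
      have "?q ^ N * res_avg ?q n s = root_avg (\<lambda>l. l ^ Suc N *\<^sub>C res_el ?q l) n s"
        by (rule root_avg_power_res_el_less[symmetric]) (use q s n in \<open>auto simp: quasi_nil_def\<close>)
      then have "?q ^ N * res_avg ?q n s * p = root_avg (\<lambda>l. l ^ Suc N *\<^sub>C res_el ?q l * p) n s"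
        by (simp only: root_avg_mult_right)
      also have "norm \<dots> \<le> s * (C * norm p)"
        using n s by (intro norm_root_avg_le cs) (auto simp: norm_mult)
      finally show ?thesis .
    qed
    have "(\<lambda>n. norm (?q ^ N * res_avg ?q n s * p)) \<longlonglongrightarrow> norm (?q ^ N * 1 * p)"
      by (intro tendsto_intros quasi_nil_res_avg q s)
    then show ?thesis
      by (intro LIMSEQ_le_const2[of "\<lambda>n. norm (?q ^ N * res_avg ?q n s * p)"])
         (auto intro!: exI[of _ "Suc N"] le)
  qed
  have lim: "((\<lambda>s. s * (C * norm p)) \<longlongrightarrow> 0 * (C * norm p)) (at_right 0)" by (intro tendsto_intros)
  have "eventually (\<lambda>s. norm (?q ^ N * p) \<le> s * (C * norm p)) (at_right 0)"
    using eventually_at_right_real[OF e] by eventually_elim (auto intro: bound)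
  from tendsto_lowerbound[OF lim this] have "norm (?q ^ N * p) \<le> 0" by simp
  then have "?q ^ N * p = 0" by simp
  \<comment> \<open>One more factor \<open>?q\<close> absorbs \<open>p\<close>, and it also makes
    the exponent at least 1.\<close>
  moreover have "p * ?q = ?q" by (metis mult.assoc pc pp)
  ultimately have "?q ^ Suc N = 0" by (metis mult.assoc mult_zero_left power_Suc2)
  then show ?thesis by (intro exI[of _ "Suc N"]) simp
qed

text \<open>For \<open>q = c * p\<close> these are the coefficients of the geometric series of
  \<open>q / l\<close>, restricted to the range of \<open>p\<close>, and of the Neumann series in
  \<open>l b\<close>. The factor \<open>p\<close> matters only at \<open>n = -1\<close>, where the
  power of \<open>q\<close> is 1.\<close>

definition laurent_coeff :: "'a::complex_banach_algebra \<Rightarrow> 'a \<Rightarrow> 'a \<Rightarrow> int \<Rightarrow> 'a" where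
  "laurent_coeff q p b n = (if n < 0 then q ^ nat (- n - 1) * p else - (b ^ nat (n + 1)))"

lemma nilpotent_imp_spectral_split_laurent:
  assumes split: "spectral_split c p b" and n: "(c * p) ^ N = 0"
    and l: "l \<noteq> 0" "cmod l * norm b < 1"
  shows "((\<lambda>n. (l powi n) *\<^sub>C laurent_coeff (c * p) p b n) has_sum res_el c l) UNIV"
proof -
  let ?q = "c * p" and ?a = "laurent_coeff (c * p) p b"
  have uq: "is_unit_el (l *\<^sub>C 1 - ?q)" using split l(1) by (auto simp: spectral_split_def quasi_nil_def)
  note res = spectral_split_resolvent[OF split l]
  have lN: "l ^ N \<noteq> 0" using l by simp
  \<comment> \<open>As \<open>?q ^ N = 0\<close>, the geometric sum inverts \<open>l - ?q\<close> up
    to the scalar \<open>l ^ N\<close>, so the singular part is finite.\<close>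
  have "(\<Sum>j<N. l ^ (N - Suc j) *\<^sub>C ?q ^ j) = l ^ N *\<^sub>C res_el ?q l"
  proof -
    have "(l *\<^sub>C 1 - ?q) * (\<Sum>j<N. l ^ (N - Suc j) *\<^sub>C ?q ^ j) = l ^ N *\<^sub>C 1"
      using geometric_factor(1)[of l ?q N] n by simp
    then have "res_el ?q l * ((l *\<^sub>C 1 - ?q) * (\<Sum>j<N. l ^ (N - Suc j) *\<^sub>C ?q ^ j)) = l ^ N *\<^sub>C res_el ?q l"
      by (simp add: scaleC_mult_right)
    then show ?thesis by (simp only: inv_el[OF uq] mult_1_left flip: mult.assoc)
  qed
  then have "res_el ?q l * p = inverse (l ^ N) *\<^sub>C (\<Sum>j<N. l ^ (N - Suc j) *\<^sub>C ?q ^ j) * p"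
    using lN by (simp add: scaleC_simps)
  also have "\<dots> = (\<Sum>j<N. (l powi (- int j - 1)) *\<^sub>C ?a (- int j - 1))"
    unfolding scaleC.sum_right sum_distrib_right
  proof (rule sum.cong[OF refl])
    fix j assume j: "j \<in> {..<N}"
    have "inverse (l ^ N) * l ^ (N - Suc j) = l powi (- int j - 1)"
    proof -
      have "l powi (- int j - 1) = l powi (int (N - Suc j) - int N)" using j by (intro arg_cong[of _ _ "power_int l"]) auto
      also have "\<dots> = l ^ (N - Suc j) / l ^ N" using l by (subst power_int_diff) auto
      finally show ?thesis by (simp add: field_simps)
    qed
    then show "inverse (l ^ N) *\<^sub>C l ^ (N - Suc j) *\<^sub>C ?q ^ j * p = (l powi (- int j - 1)) *\<^sub>C ?a (- int j - 1)"
      by (simp add: scaleC_simps laurent_coeff_def)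
  qed
  also have "\<dots> = (\<Sum>n\<in>{- int N..<0}. (l powi n) *\<^sub>C ?a n)"
    by (rule sum.reindex_bij_witness[of _ "\<lambda>n. nat (- n - 1)" "\<lambda>j. - int j - 1"]) auto
  finally have neg: "((\<lambda>n. (l powi n) *\<^sub>C ?a n) has_sum (res_el ?q l * p)) {- int N..<0}"
    by (simp add: has_sum_finite)
  have "((\<lambda>n. (l *\<^sub>C b) ^ n) has_sum (\<Sum>n. (l *\<^sub>C b) ^ n)) UNIV"
    by (rule norm_summable_imp_has_sum[OF res(3)]) (rule summable_sums[OF summable_norm_cancel[OF res(3)]])
  then have "((\<lambda>n. - b * (l *\<^sub>C b) ^ n) has_sum (- b * (\<Sum>n. (l *\<^sub>C b) ^ n))) UNIV"
    by (rule has_sum_bounded_linear[OF bounded_linear_mult_right])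
  also have "(\<lambda>n. - b * (l *\<^sub>C b) ^ n) = (\<lambda>n. (l powi int n) *\<^sub>C ?a (int n))"
    by (rule ext) (simp add: laurent_coeff_def power_scaleC scaleC_mult_right nat_add_distrib scaleC.minus_right)
  finally have "((\<lambda>n. (l powi n) *\<^sub>C ?a n) has_sum (- b * (\<Sum>n. (l *\<^sub>C b) ^ n))) {0..}"
    by (subst (asm) has_sum_reindex_bij_betw[of int UNIV "{0..}" "\<lambda>n. (l powi n) *\<^sub>C ?a n"])
       (rule bij_betwI[of _ _ _ nat], auto)
  moreover have "{- int N..<0} \<inter> {0..} = {}" by auto
  ultimately have "((\<lambda>n. (l powi n) *\<^sub>C ?a n) has_sum
      (res_el ?q l * p + - b * (\<Sum>n. (l *\<^sub>C b) ^ n))) ({- int N..<0} \<union> {0..})"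
    by (intro has_sum_Un_disjoint[OF neg])
  then
  have "((\<lambda>n. (l powi n) *\<^sub>C ?a n) has_sum res_el c l) ({- int N..<0} \<union> {0..})"
    by (simp add: res(2))
  moreover have "?a n = 0" if "n < - int N" for n
  proof -
    have "nat (- n - 1) = N + (nat (- n - 1) - N)" using that by linarith
    then have "?q ^ nat (- n - 1) = 0" using assms(2) by (metis mult_zero_left power_add)
    then show ?thesis using that by (simp add: laurent_coeff_def)
  qed
  ultimately show ?thesis
    by (elim has_sum_cong_neutral[THEN iffD1, rotated -1]) auto
qed

lemma laurent_coeff_singular_part:
  assumes "p \<noteq> 0" "q ^ N = 0"
  shows "{n. n < 0 \<and> laurent_coeff q p b n \<noteq> 0} \<noteq> {}" "finite {n. n < 0 \<and> laurent_coeff q p b n \<noteq> 0}"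
proof -
  have "laurent_coeff q p b (-1) \<noteq> 0" using assms(1) by (simp add: laurent_coeff_def)
  then show "{n. n < 0 \<and> laurent_coeff q p b n \<noteq> 0} \<noteq> {}" by (auto intro!: exI[of _ "-1"])
  have "n \<ge> - int N" if "n < 0" "laurent_coeff q p b n \<noteq> 0" for n
  proof (rule ccontr)
    assume "\<not> n \<ge> - int N"
    then have "nat (- n - 1) = N + (nat (- n - 1) - N)" by linarith
    then have "q ^ nat (- n - 1) = 0" using assms(2) by (metis mult_zero_left power_add)
    then show False using that by (simp add: laurent_coeff_def)
  qed
  then have "{n. n < 0 \<and> laurent_coeff q p b n \<noteq> 0} \<subseteq> {- int N..<0}" by auto
  then show "finite {n. n < 0 \<and> laurent_coeff q p b n \<noteq> 0}" by (rule finite_subset) simp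
qed

section \<open>Riesz theory of compact operators\<close>

lemma bounded_ops_UNIV_iff:
  "S \<in> bounded_ops UNIV \<longleftrightarrow> bounded_linear S \<and> (\<forall>c x. S (c *\<^sub>C x) = c *\<^sub>C S x)"
proof
  assume S: "S \<in> bounded_ops UNIV"
  then obtain C where "\<And>x. norm (S x) \<le> norm x * C"
    by (auto simp: bounded_ops_iff mult.commute)
  then show "bounded_linear S \<and> (\<forall>c x. S (c *\<^sub>C x) = c *\<^sub>C S x)"
    using S by (auto simp: bounded_ops_iff scaleR_scaleC intro!: bounded_linear_intro)
next
  assume S: "bounded_linear S \<and> (\<forall>c x. S (c *\<^sub>C x) = c *\<^sub>C S x)"
  then obtain C where "\<And>x. norm (S x) \<le> norm x * C"
    using bounded_linear.bounded by blast
  then show "S \<in> bounded_ops UNIV"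
    using S by (auto simp: bounded_ops_iff linear_simps mult.commute intro!: exI[of _ C])
qed

lemma compact_ops_imp_bounded_ops: "K \<in> compact_ops Y \<Longrightarrow> K \<in> bounded_ops Y"
  by (simp add: compact_ops_def)

lemma bounded_ops_diff [simp]: "S \<in> bounded_ops UNIV \<Longrightarrow> S (x - y) = S x - S y"
  by (simp add: bounded_ops_UNIV_iff linear_simps)

lemma bounded_ops_linear_simps:
  assumes "S \<in> bounded_ops UNIV"
  shows "S (x + y) = S x + S y" "S 0 = 0" "S (- x) = - S x" "S (c *\<^sub>C x) = c *\<^sub>C S x"
  using assms by (auto simp: bounded_ops_UNIV_iff linear_simps)

lemma compact_ops_convergent_subseq:
  assumes K: "K \<in> compact_ops UNIV" and x: "\<And>n. norm (x n) \<le> B"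
  obtains r l where "strict_mono (r :: nat \<Rightarrow> nat)" "(\<lambda>n. K (x (r n))) \<longlonglongrightarrow> l"
proof -
  define b where "b = \<bar>B\<bar> + 1"
  have b: "b > 0" "\<And>n. norm (x n) \<le> b" using x by (auto simp: b_def intro: order_trans[of _ B])
  obtain D where D: "compact D" "\<And>x. norm x \<le> 1 \<Longrightarrow> K x \<in> D"
    using compact_opsE[OF K] by auto
  have "K (inverse b *\<^sub>R x n) \<in> D" for n
    using b(1) b(2)[of n] by (intro D) (simp add: divide_simps mult.commute)
  then obtain l r where lr: "strict_mono (r :: nat \<Rightarrow> nat)" "(\<lambda>n. K (inverse b *\<^sub>R x (r n))) \<longlonglongrightarrow> l"
    using D(1)[unfolded compact_def, rule_format, of "\<lambda>n. K (inverse b *\<^sub>R x n)"] by (auto simp: o_def)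
  have lin: "bounded_linear K" using compact_ops_imp_bounded_ops[OF K] by (simp add: bounded_ops_UNIV_iff)
  have "(\<lambda>n. b *\<^sub>R K (inverse b *\<^sub>R x (r n))) \<longlonglongrightarrow> b *\<^sub>R l"
    by (intro tendsto_intros lr)
  then have "(\<lambda>n. K (x (r n))) \<longlonglongrightarrow> b *\<^sub>R l"
    using b(1) by (simp add: linear_simps[OF lin])
  with lr(1) show thesis by (rule that)
qed

text \<open>The constant is the distance from \<open>b\<close> to \<open>V\<close>. Controlling the
  coefficient \<open>t\<close> by the vector \<open>v + t b\<close> is what keeps a closed subspace
  closed when a vector is adjoined, and what makes coefficient functionals bounded.\<close>

lemma norm_add_scaleC_ge:
  assumes V: "csubspace V" "closed V" and b: "b \<notin> V"
  obtains d where "d > 0" "\<And>v t. v \<in> V \<Longrightarrow> d * cmod t \<le> norm (v + t *\<^sub>C b)"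
proof
  have ne: "V \<noteq> {}" using complex_vector.subspace_0[OF V(1)] by auto
  show "infdist b V > 0" using infdist_pos_not_in_closed[OF V(2) ne b] .
  fix v t assume v: "v \<in> V"
  show "infdist b V * cmod t \<le> norm (v + t *\<^sub>C b)"
  proof (cases "t = 0")
    case False
    have "- (inverse t *\<^sub>C v) \<in> V"
      using V(1) v by (simp add: complex_vector.subspace_neg complex_vector.subspace_scale)
    then have "infdist b V \<le> dist b (- (inverse t *\<^sub>C v))" by (rule infdist_le)
    also have "\<dots> = norm (inverse t *\<^sub>C (v + t *\<^sub>C b))"
      using False by (simp add: dist_norm scaleC_add_right scaleC_scaleC scaleC_one add.commute)
    also have "\<dots> = norm (v + t *\<^sub>C b) / cmod t" by (simp add: norm_scaleC norm_inverse divide_inverse)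
    finally show ?thesis using False by (simp add: field_simps)
  qed simp
qed

lemma closed_subspace_add_span1:
  assumes V: "csubspace V" "closed V"
  shows "closed {x. \<exists>t. x - t *\<^sub>C b \<in> V}"
proof (cases "b \<in> V")
  case True
  have "{x. \<exists>t. x - t *\<^sub>C b \<in> V} = V"
  proof (intro equalityI subsetI)
    fix x assume "x \<in> {x. \<exists>t. x - t *\<^sub>C b \<in> V}"
    then obtain t where "x - t *\<^sub>C b \<in> V" by auto
    then have "x - t *\<^sub>C b + t *\<^sub>C b \<in> V"
      using V(1) True by (intro complex_vector.subspace_add complex_vector.subspace_scale)
    then show "x \<in> V" by simp
  qed (auto intro!: exI[of _ 0])
  then show ?thesis using V by simp
next
  case False
  obtain d where d: "d > 0" "\<And>v t. v \<in> V \<Longrightarrow> d * cmod t \<le> norm (v + t *\<^sub>C b)"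
    using norm_add_scaleC_ge[OF V False] by blast
  show ?thesis unfolding closed_sequential_limits
  proof (intro allI impI)
    fix x l assume x: "(\<forall>n. x n \<in> {x. \<exists>t. x - t *\<^sub>C b \<in> V}) \<and> x \<longlonglongrightarrow> l"
    then obtain t where t: "\<And>n. x n - t n *\<^sub>C b \<in> V" by (auto simp: choice_iff)
    have "d * cmod (t m - t n) \<le> norm (x m - x n)" for m n
    proof -
      have "(x m - t m *\<^sub>C b) - (x n - t n *\<^sub>C b) \<in> V"
        by (rule complex_vector.subspace_diff[OF V(1) t t])
      from d(2)[OF this, of "t m - t n"] show ?thesis by (simp add: scaleC.diff_left algebra_simps)
    qed
    then have le: "dist (t m) (t n) \<le> dist (x m) (x n) / d" for m n
      using d(1) by (simp add: dist_norm field_simps)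
    have "Cauchy x" using x LIMSEQ_imp_Cauchy by blast
    have "Cauchy t"
    proof (rule metric_CauchyI)
      fix e :: real assume "e > 0"
      then have "e * d > 0" using d(1) by simp
      then obtain M where "\<forall>m\<ge>M. \<forall>n\<ge>M. dist (x m) (x n) < e * d"
        using \<open>Cauchy x\<close> unfolding Cauchy_def by blast
      then show "\<exists>M. \<forall>m\<ge>M. \<forall>n\<ge>M. dist (t m) (t n) < e"
        using d(1) by (intro exI[of _ M] allI impI le_less_trans[OF le]) (simp add: divide_less_eq)
    qed
    then obtain s where s: "t \<longlonglongrightarrow> s" using Cauchy_convergent_iff convergent_def by blast
    have "(\<lambda>n. x n - t n *\<^sub>C b) \<longlonglongrightarrow> l - s *\<^sub>C b"
      using x s by (intro tendsto_diff tendsto_scaleC tendsto_const) auto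
    then have "l - s *\<^sub>C b \<in> V" by (rule closed_sequentially[OF V(2) t])
    then show "l \<in> {x. \<exists>t. x - t *\<^sub>C b \<in> V}" by blast
  qed
qed

section \<open>Sums of a subspace and the span of finitely many vectors\<close>

definition add_span :: "'a::complex_banach set \<Rightarrow> 'a set \<Rightarrow> 'a set" where
  "add_span V B = {x. \<exists>s\<in>cspan B. x - s \<in> V}"

lemma add_span_empty [simp]: "add_span V {} = V"
  by (simp add: add_span_def complex_vector.span_empty)

lemma add_span_insert: "add_span V (insert b B) = {x. \<exists>t. x - t *\<^sub>C b \<in> add_span V B}"
proof (intro equalityI subsetI)
  fix x assume "x \<in> add_span V (insert b B)"
  then obtain s where s: "s \<in> cspan (insert b B)" "x - s \<in> V" by (auto simp: add_span_def)
  then obtain k where "s - k *\<^sub>C b \<in> cspan B" using complex_vector.span_breakdown_eq by blast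
  then show "x \<in> {x. \<exists>t. x - t *\<^sub>C b \<in> add_span V B}"
    using s(2) by (auto simp: add_span_def intro!: exI[of _ k] bexI[of _ "s - k *\<^sub>C b"])
next
  fix x assume "x \<in> {x. \<exists>t. x - t *\<^sub>C b \<in> add_span V B}"
  then obtain t s where s: "s \<in> cspan B" "x - t *\<^sub>C b - s \<in> V" by (auto simp: add_span_def)
  have "s + t *\<^sub>C b \<in> cspan (insert b B)"
    using s(1) by (subst complex_vector.span_breakdown_eq) (auto intro!: exI[of _ t])
  then show "x \<in> add_span V (insert b B)"
    using s(2) by (auto simp: add_span_def algebra_simps intro!: bexI[of _ "s + t *\<^sub>C b"])
qed

lemma csubspace_add_span:
  assumes "csubspace V" shows "csubspace (add_span V B)"
proof (rule complex_vector.subspaceI)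
  show "0 \<in> add_span V B"
    using complex_vector.span_zero complex_vector.subspace_0[OF assms] by (force simp: add_span_def)
next
  fix x y assume "x \<in> add_span V B" "y \<in> add_span V B"
  then obtain s t where st: "s \<in> cspan B" "x - s \<in> V" "t \<in> cspan B" "y - t \<in> V"
    by (auto simp: add_span_def)
  then have "x + y - (s + t) \<in> V"
    using complex_vector.subspace_add[OF assms, of "x - s" "y - t"] by (simp add: algebra_simps)
  then show "x + y \<in> add_span V B" using st complex_vector.span_add by (auto simp: add_span_def)
next
  fix c x assume "x \<in> add_span V B"
  then obtain s where st: "s \<in> cspan B" "x - s \<in> V" by (auto simp: add_span_def)
  then have "c *\<^sub>C x - c *\<^sub>C s \<in> V"
    using complex_vector.subspace_scale[OF assms, of "x - s" c] by (simp add: scaleC.diff_right)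
  then show "c *\<^sub>C x \<in> add_span V B" using st complex_vector.span_scale by (auto simp: add_span_def)
qed

lemma closed_add_span:
  assumes "csubspace V" "closed V" "finite B" shows "closed (add_span V B)"
  using assms(3)
  by induction (simp_all add: assms add_span_insert closed_subspace_add_span1 csubspace_add_span)

lemma add_span_superset:
  assumes "csubspace V" shows "V \<subseteq> add_span V B" "B \<subseteq> add_span V B"
proof -
  have 0: "0 \<in> V" using assms by (rule complex_vector.subspace_0)
  show "V \<subseteq> add_span V B"
    using complex_vector.span_zero[of B] by (auto simp: add_span_def intro!: bexI[of _ 0])
  show "B \<subseteq> add_span V B"
    using complex_vector.span_base[of _ B] 0 by (auto simp: add_span_def intro!: bexI)
qed

lemma add_span_mono: "B \<subseteq> C \<Longrightarrow> add_span V B \<subseteq> add_span V C"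
  using complex_vector.span_mono[of B C] by (auto simp: add_span_def)

lemma add_span_subset: "csubspace U \<Longrightarrow> V \<subseteq> U \<Longrightarrow> B \<subseteq> U \<Longrightarrow> add_span V B \<subseteq> U"
proof
  fix x assume U: "csubspace U" "V \<subseteq> U" "B \<subseteq> U" and "x \<in> add_span V B"
  then obtain s where s: "s \<in> cspan B" "x - s \<in> V" by (auto simp: add_span_def)
  have "s \<in> U" using s(1) U complex_vector.span_minimal by blast
  then have "x - s + s \<in> U" using U s by (intro complex_vector.subspace_add) auto
  then show "x \<in> U" by simp
qed

lemma csubspace_0: "csubspace {0}"
  by (rule complex_vector.subspace_single_0)

lemma add_span_0: "add_span {0} B = cspan B"
  by (auto simp: add_span_def)

lemma closed_cspan: "finite B \<Longrightarrow> closed (cspan B)"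
  using closed_add_span[of "{0}" B] csubspace_0 by (simp add: add_span_0)

section \<open>Riesz's lemma and the compactness argument\<close>

lemma riesz_lemma:
  assumes W: "csubspace W" "closed W" and U: "csubspace U" "W \<subseteq> U" "W \<noteq> U"
  obtains y where "y \<in> U" "norm y \<le> 1" "\<And>w. w \<in> W \<Longrightarrow> norm (y - w) \<ge> 1/2"
proof -
  obtain u where u: "u \<in> U" "u \<notin> W" using U by blast
  have ne: "W \<noteq> {}" using complex_vector.subspace_0[OF W(1)] by auto
  let ?d = "infdist u W"
  have d: "?d > 0" using infdist_pos_not_in_closed[OF W(2) ne u(2)] .
  \<comment> \<open>A point of \<open>W\<close> that attains the distance of \<open>u\<close> up to
    a factor 2; normalizing \<open>u - w0\<close> turns this factor into the bound 1/2.\<close>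
  have "\<exists>w\<in>W. dist u w < 2 * ?d"
  proof (rule ccontr)
    assume "\<not> ?thesis"
    then have "2 * ?d \<le> (INF w\<in>W. dist u w)" by (intro cINF_greatest[OF ne]) (auto simp: not_less)
    then have "2 * ?d \<le> ?d" by (simp add: infdist_notempty[OF ne])
    then show False using d by simp
  qed
  then obtain w0 where w0: "w0 \<in> W" "dist u w0 < 2 * ?d" by blast
  let ?n = "norm (u - w0)"
  have n: "?n > 0" using u w0 by auto
  let ?y = "inverse ?n *\<^sub>R (u - w0)"
  show thesis
  proof (rule that)
    show "?y \<in> U" using U u w0
      by (simp add: scaleR_scaleC complex_vector.subspace_scale complex_vector.subspace_diff subsetD)
    show "norm ?y \<le> 1" using n by simp
    fix w assume w: "w \<in> W"
    have "w0 + ?n *\<^sub>R w \<in> W" using W w w0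
      by (simp add: scaleR_scaleC complex_vector.subspace_scale complex_vector.subspace_add)
    then have "?d \<le> norm (u - (w0 + ?n *\<^sub>R w))" using infdist_le[of _ W u] by (simp add: dist_norm)
    also have "u - (w0 + ?n *\<^sub>R w) = ?n *\<^sub>R (?y - w)"
      using n by (simp add: scaleR_diff_right algebra_simps)
    finally have "?d \<le> ?n * norm (?y - w)" by simp
    moreover have "?n < 2 * ?d" using w0 by (simp add: dist_norm)
    ultimately have "?n < 2 * (?n * norm (?y - w))" by linarith
    then show "norm (?y - w) \<ge> 1/2" using n by simp
  qed
qed

text \<open>The Riesz compactness argument: no compact operator acts as a multiple, bounded away from
  zero, of the identity on infinitely many successive quotients.\<close>

lemma compact_no_infinite_chain:
  assumes K: "K \<in> compact_ops UNIV" and e: "e > 0" "\<And>n. e \<le> cmod (L n)"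
    and W: "\<And>n::nat. csubspace (W n)" "\<And>n. closed (W n)"
    and U: "\<And>n. csubspace (U n)" "\<And>n. W n \<subseteq> U n" "\<And>n. W n \<noteq> U n"
    and KU: "\<And>n x. x \<in> U n \<Longrightarrow> K x - L n *\<^sub>C x \<in> W n"
    and sep: "\<And>m n. m < n \<Longrightarrow> (\<forall>x\<in>U m. K x \<in> W n) \<or> (\<forall>x\<in>U n. K x \<in> W m)"
  shows False
proof -
  have "\<exists>y. y \<in> U n \<and> norm y \<le> 1 \<and> (\<forall>w\<in>W n. norm (y - w) \<ge> 1/2)" for n
    using riesz_lemma[OF W(1,2) U] by metis
  then obtain y where y: "\<And>n. y n \<in> U n" "\<And>n. norm (y n) \<le> 1"
    "\<And>n w. w \<in> W n \<Longrightarrow> norm (y n - w) \<ge> 1/2" by metis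
  \<comment> \<open>The difference of the images is \<open>L n *\<^sub>C y n\<close> plus a vector
    of \<open>W n\<close>, and \<open>y n\<close> has distance at least 1/2 from
    \<open>W n\<close>.\<close>
  have far: "norm (K (y n) - K (y m)) \<ge> e / 2" if Km: "K (y m) \<in> W n" for m n
  proof -
    let ?w = "K (y n) - L n *\<^sub>C y n - K (y m)"
    have w: "?w \<in> W n" by (intro complex_vector.subspace_diff W KU y Km)
    have L: "L n \<noteq> 0" using e(1) e(2)[of n] by auto
    have "- (inverse (L n) *\<^sub>C ?w) \<in> W n"
      by (intro complex_vector.subspace_neg complex_vector.subspace_scale W w)
    then have "1/2 \<le> norm (y n - - (inverse (L n) *\<^sub>C ?w))" by (rule y(3))
    then have "e * (1/2) \<le> cmod (L n) * norm (y n - - (inverse (L n) *\<^sub>C ?w))"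
      using e by (intro mult_mono) (auto intro: order_trans[OF less_imp_le])
    also have "\<dots> = norm (L n *\<^sub>C (y n + inverse (L n) *\<^sub>C ?w))" by (simp add: norm_scaleC)
    also have "L n *\<^sub>C (y n + inverse (L n) *\<^sub>C ?w) = L n *\<^sub>C y n + ?w"
      using L by (simp only: scaleC_add_right scaleC_scaleC right_inverse[OF L] scaleC_one)
    also have "\<dots> = K (y n) - K (y m)" by simp
    finally show ?thesis by simp
  qed
  \<comment> \<open>The first alternative of \<open>sep\<close> serves increasing chains, the second
    decreasing ones.\<close>
  have far': "norm (K (y n) - K (y m)) \<ge> e / 2" if "m \<noteq> n" for m n
  proof -
    have "K (y m) \<in> W n \<or> K (y n) \<in> W m"
      using that sep[of m n] sep[of n m] y(1)[of m] y(1)[of n] by (cases m n rule: linorder_cases) auto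
    then show ?thesis
    proof
      assume "K (y n) \<in> W m"
      from far[OF this] show ?thesis by (subst norm_minus_commute)
    qed (rule far)
  qed
  obtain r l where r: "strict_mono (r :: nat \<Rightarrow> nat)" "(\<lambda>n. K (y (r n))) \<longlonglongrightarrow> l"
    by (rule compact_ops_convergent_subseq[OF K y(2)])
  have "e / 2 > 0" using e(1) by simp
  from metric_CauchyD[OF LIMSEQ_imp_Cauchy[OF r(2)] this]
  obtain M where M: "\<forall>m\<ge>M. \<forall>n\<ge>M. dist (K (y (r m))) (K (y (r n))) < e / 2"
    by blast
  have "r (Suc M) \<noteq> r M" using strict_monoD[OF r(1), of M "Suc M"] by simp
  then have "e / 2 \<le> dist (K (y (r (Suc M)))) (K (y (r M)))" using far' by (simp add: dist_norm)
  moreover have "dist (K (y (r (Suc M)))) (K (y (r M))) < e / 2" using M by simp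
  ultimately show False by simp
qed

lemma infinite_add_span_chain:
  assumes "\<not> (\<exists>B. finite B \<and> B \<subseteq> V \<and> V \<subseteq> add_span V0 B)"
  obtains B where "\<And>n::nat. finite (B n)" "\<And>n. B n \<subseteq> V" "\<And>m n. m \<le> n \<Longrightarrow> B m \<subseteq> B n"
    "\<And>n. \<exists>x\<in>B (Suc n). x \<notin> add_span V0 (B n)"
proof -
  define B where "B = rec_nat {} (\<lambda>_ B. insert (SOME x. x \<in> V \<and> x \<notin> add_span V0 B) B)"
  have B0: "B 0 = {}" and BS: "B (Suc n) = insert (SOME x. x \<in> V \<and> x \<notin> add_span V0 (B n)) (B n)" for n
    by (simp_all add: B_def)
  have sm: "(SOME x. x \<in> V \<and> x \<notin> add_span V0 C) \<in> V \<and> (SOME x. x \<in> V \<and> x \<notin> add_span V0 C) \<notin> add_span V0 C"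
    if "finite C" "C \<subseteq> V" for C
    by (rule someI_ex[of "\<lambda>x. x \<in> V \<and> x \<notin> add_span V0 C"]) (use assms that in blast)
  have BV: "finite (B n) \<and> B n \<subseteq> V" for n
    by (induction n) (use sm in \<open>auto simp: B0 BS\<close>)
  show thesis
  proof (rule that[of B])
    show "m \<le> n \<Longrightarrow> B m \<subseteq> B n" for m n by (rule lift_Suc_mono_le[of B]) (auto simp: BS)
    show "\<exists>x\<in>B (Suc n). x \<notin> add_span V0 (B n)" for n
      using sm[of "B n"] BV[of n] by (auto simp: BS)
  qed (use BV in auto)
qed

text \<open>\<open>K\<close> induces the identity on the quotient of \<open>V\<close> by
  \<open>V0\<close>, so an infinite-dimensional quotient would give a forbidden chain. With
  \<open>V0 = {0}\<close> this makes kernels finite-dimensional; with \<open>V0\<close> the range of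
  \<open>x - K x\<close> it makes cokernels finite-dimensional and larger ranges closed.\<close>

lemma compact_ops_finite_quotient:
  assumes K: "K \<in> compact_ops UNIV" and V0: "csubspace V0" "closed V0" "V0 \<subseteq> V" and V: "csubspace V"
    and KV: "\<And>x. x \<in> V \<Longrightarrow> K x - x \<in> V0"
  shows "\<exists>B. finite B \<and> B \<subseteq> V \<and> V = add_span V0 B"
proof (rule ccontr)
  assume "\<not> ?thesis"
  then have no: "\<not> (\<exists>B. finite B \<and> B \<subseteq> V \<and> V \<subseteq> add_span V0 B)"
    using add_span_subset[OF V V0(3)] by blast
  obtain B where B: "\<And>n::nat. finite (B n)" "\<And>n. B n \<subseteq> V" "\<And>m n. m \<le> n \<Longrightarrow> B m \<subseteq> B n"
    "\<And>n. \<exists>x\<in>B (Suc n). x \<notin> add_span V0 (B n)"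
    by (rule infinite_add_span_chain[OF no]) blast
  have KU: "K x - x \<in> add_span V0 (B n)" if "x \<in> V" for x n
    using KV[OF that] by (rule subsetD[OF add_span_superset(1)[OF V0(1)]])
  have sub: "add_span V0 (B n) \<subseteq> V" for n by (rule add_span_subset[OF V V0(3) B(2)])
  show False
  proof (rule compact_no_infinite_chain[OF K zero_less_one, where L="\<lambda>_. 1"
      and U="\<lambda>n. add_span V0 (B (Suc n))" and W="\<lambda>n. add_span V0 (B n)"])
    show "add_span V0 (B n) \<noteq> add_span V0 (B (Suc n))" for n
      using B(4)[of n] add_span_superset(2)[OF V0(1), of "B (Suc n)"] by blast
    show "K x - 1 *\<^sub>C x \<in> add_span V0 (B n)" if "x \<in> add_span V0 (B (Suc n))" for n x
      using KU[of x n] sub that by (auto simp: scaleC_one)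
    show "(\<forall>x\<in>add_span V0 (B (Suc m)). K x \<in> add_span V0 (B n)) \<or> (\<forall>x\<in>add_span V0 (B (Suc n)). K x \<in> add_span V0 (B m))"
      if "m < n" for m n
    proof (intro disjI1 ballI)
      fix x assume x: "x \<in> add_span V0 (B (Suc m))"
      then have "x \<in> add_span V0 (B n)" using add_span_mono[OF B(3)[of "Suc m" n]] that by auto
      moreover have "K x - x \<in> add_span V0 (B n)" using x sub KU by blast
      ultimately have "(K x - x) + x \<in> add_span V0 (B n)"
        by (intro complex_vector.subspace_add csubspace_add_span V0)
      then show "K x \<in> add_span V0 (B n)" by simp
    qed
  qed (auto intro!: csubspace_add_span closed_add_span V0 B add_span_mono)
qed

section \<open>Kernel, range and eigenvalues for a compact operator\<close>

lemma finite_dimensional_fixed_space: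
  assumes K: "K \<in> compact_ops UNIV"
  shows "finite_dimensional {x. K x = x}"
proof -
  have lin: "K \<in> bounded_ops UNIV" using K by (rule compact_ops_imp_bounded_ops)
  have "csubspace {x. K x = x}"
    by (rule complex_vector.subspaceI) (auto simp: bounded_ops_linear_simps[OF lin])
  then have "\<exists>B. finite B \<and> B \<subseteq> {x. K x = x} \<and> {x. K x = x} = add_span {0} B"
    using bounded_ops_linear_simps[OF lin]
    by (intro compact_ops_finite_quotient[OF K] csubspace_0) auto
  then show ?thesis by (simp add: finite_dimensional_def add_span_0)
qed

text \<open>Otherwise there are unit vectors \<open>x n\<close> in \<open>M\<close> with
  \<open>x n - K (x n)\<close> tending to 0. Along a subsequence the images converge, hence so do
  the vectors, and their limit is a fixed unit vector in \<open>M\<close>.\<close>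

lemma one_minus_compact_bounded_below:
  assumes K: "K \<in> compact_ops UNIV" and M: "closed M" "csubspace M"
    and inj: "\<And>x. x \<in> M \<Longrightarrow> K x = x \<Longrightarrow> x = 0"
  shows "\<exists>d>0. \<forall>x\<in>M. d * norm x \<le> norm (x - K x)"
proof (rule ccontr)
  have lin: "K \<in> bounded_ops UNIV" using K by (rule compact_ops_imp_bounded_ops)
  then have blin: "bounded_linear K" by (simp add: bounded_ops_UNIV_iff)
  assume "\<not> ?thesis"
  then have no: "\<exists>x\<in>M. norm (x - K x) < d * norm x" if "d > 0" for d
    using that by (meson not_le)
  have "\<exists>x\<in>M. norm x = 1 \<and> norm (x - K x) < inverse (real (Suc n))" for n
  proof -
    obtain x where x: "x \<in> M" "norm (x - K x) < inverse (real (Suc n)) * norm x"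
      using no[of "inverse (real (Suc n))"] by auto
    have "norm x > 0" using x(2) by (metis mult_zero_right norm_ge_zero not_le zero_less_norm_iff norm_zero)
    let ?y = "inverse (norm x) *\<^sub>R x"
    have "?y \<in> M" using M x by (simp add: scaleR_scaleC complex_vector.subspace_scale)
    moreover have "?y - K ?y = inverse (norm x) *\<^sub>R (x - K x)"
      by (simp add: linear_simps[OF blin] scaleR_diff_right)
    then have "norm (?y - K ?y) < inverse (real (Suc n))"
      using x(2) \<open>norm x > 0\<close> by (simp add: divide_simps mult.commute)
    ultimately show ?thesis using \<open>norm x > 0\<close> by (intro bexI[of _ ?y]) auto
  qed
  then obtain x where x: "\<And>n. x n \<in> M" "\<And>n. norm (x n) = 1"
     "\<And>n. norm (x n - K (x n)) < inverse (real (Suc n))" by metis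
  obtain r l where r: "strict_mono (r :: nat \<Rightarrow> nat)" "(\<lambda>n. K (x (r n))) \<longlonglongrightarrow> l"
    by (rule compact_ops_convergent_subseq[OF K, of x 1]) (simp add: x(2))
  have "(\<lambda>n. x n - K (x n)) \<longlonglongrightarrow> 0"
    by (rule Lim_null_comparison[OF always_eventually LIMSEQ_inverse_real_of_nat])
       (use x(3) in \<open>auto intro: less_imp_le simp del: of_nat_Suc\<close>)
  then have 0: "(\<lambda>n. x (r n) - K (x (r n))) \<longlonglongrightarrow> 0"
    using LIMSEQ_subseq_LIMSEQ[OF _ r(1)] by (auto simp: o_def)
  then have l: "(\<lambda>n. x (r n)) \<longlonglongrightarrow> l" using tendsto_add[OF 0 r(2)] by simp
  then have "(\<lambda>n. K (x (r n))) \<longlonglongrightarrow> K l" by (rule bounded_linear.tendsto[OF blin])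
  from LIMSEQ_unique[OF this r(2)] have "K l = l" .
  moreover have "l \<in> M" by (rule closed_sequentially[OF M(1) x(1) l])
  ultimately have "l = 0" using inj by blast
  moreover have "norm l = 1" using tendsto_norm[OF l] x(2) by (simp add: LIMSEQ_const_iff)
  ultimately show False by simp
qed

lemma closed_image_bounded_below:
  assumes S: "S \<in> bounded_ops UNIV" and M: "closed M" "csubspace M"
    and d: "d > 0" "\<And>x. x \<in> M \<Longrightarrow> d * norm x \<le> norm (S x)"
  shows "closed (S ` M)"
  unfolding closed_sequential_limits
proof (intro allI impI)
  fix y l assume y: "(\<forall>n. y n \<in> S ` M) \<and> y \<longlonglongrightarrow> l"
  have "\<forall>n. \<exists>x. x \<in> M \<and> y n = S x"
  proof
    fix n have "y n \<in> S ` M" using y by simp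
    then show "\<exists>x. x \<in> M \<and> y n = S x" by auto
  qed
  from choice[OF this] obtain x where x: "\<And>n. x n \<in> M" "\<And>n. y n = S (x n)" by auto
  have le: "dist (x m) (x n) \<le> dist (y m) (y n) / d" for m n
    using d(2)[OF complex_vector.subspace_diff[OF M(2) x(1) x(1)], of m n] d(1) S
    by (simp add: x(2) dist_norm field_simps)
  have "Cauchy y" using y LIMSEQ_imp_Cauchy by blast
  have "Cauchy x"
  proof (rule metric_CauchyI)
    fix e :: real assume "e > 0"
    then have "e * d > 0" using d(1) by simp
    then obtain N where "\<forall>m\<ge>N. \<forall>n\<ge>N. dist (y m) (y n) < e * d"
      using \<open>Cauchy y\<close> unfolding Cauchy_def by blast
    then show "\<exists>N. \<forall>m\<ge>N. \<forall>n\<ge>N. dist (x m) (x n) < e"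
      using d(1) by (intro exI[of _ N] allI impI le_less_trans[OF le]) (simp add: divide_less_eq)
  qed
  then obtain z where z: "x \<longlonglongrightarrow> z" using Cauchy_convergent_iff convergent_def by blast
  have "y = (\<lambda>n. S (x n))" using x(2) by auto
  then have "(\<lambda>n. S (x n)) \<longlonglongrightarrow> l" using y by simp
  moreover have "(\<lambda>n. S (x n)) \<longlonglongrightarrow> S z"
    using S by (intro bounded_linear.tendsto[OF _ z]) (simp add: bounded_ops_UNIV_iff)
  ultimately have "S z = l" by (intro LIMSEQ_unique)
  moreover have "z \<in> M" by (rule closed_sequentially[OF M(1) x(1) z])
  ultimately show "l \<in> S ` M" by blast
qed

lemma one_minus_bounded_ops:
  assumes "K \<in> bounded_ops UNIV" shows "(\<lambda>x. x - K x) \<in> bounded_ops UNIV"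
  using assms by (auto simp: bounded_ops_UNIV_iff scaleC.diff_right intro!: bounded_linear_intros)

lemma csubspace_image:
  assumes S: "S \<in> bounded_ops UNIV" and V: "csubspace V"
  shows "csubspace (S ` V)"
proof (rule complex_vector.subspaceI)
  show "0 \<in> S ` V"
    using complex_vector.subspace_0[OF V] bounded_ops_linear_simps(2)[OF S] by force
  fix x y assume "x \<in> S ` V" "y \<in> S ` V"
  then obtain u v where "x = S u" "y = S v" "u \<in> V" "v \<in> V" by blast
  then show "x + y \<in> S ` V"
    using complex_vector.subspace_add[OF V] bounded_ops_linear_simps(1)[OF S, of u v]
    by (intro image_eqI[of _ _ "u + v"]) auto
next
  fix c x assume "x \<in> S ` V"
  then obtain u where "x = S u" "u \<in> V" by blast
  then show "c *\<^sub>C x \<in> S ` V"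
    using complex_vector.subspace_scale[OF V] bounded_ops_linear_simps(4)[OF S, of c u]
    by (intro image_eqI[of _ _ "c *\<^sub>C u"]) auto
qed

text \<open>If \<open>?A\<close> were injective but not onto, the ranges \<open>R n\<close> of its
  powers would decrease strictly. They are closed because \<open>?A\<close> is bounded below, and
  \<open>K\<close> acts as the identity on the quotient of \<open>R n\<close> by
  \<open>R (Suc n)\<close>, which the compactness argument excludes. The lower bound of
  \<open>?A\<close> also bounds its inverse.\<close>

lemma fredholm_alternative:
  assumes K: "K \<in> compact_ops UNIV" and inj: "\<And>x. K x = x \<Longrightarrow> x = 0"
  obtains S where "S \<in> bounded_ops UNIV" "\<And>x. S (x - K x) = x" "\<And>x. S x - K (S x) = x"
proof -
  have lin: "K \<in> bounded_ops UNIV" using K by (rule compact_ops_imp_bounded_ops)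
  let ?A = "\<lambda>x. x - K x"
  have A: "?A \<in> bounded_ops UNIV" using lin by (rule one_minus_bounded_ops)
  obtain d where d: "d > 0" "\<And>x. d * norm x \<le> norm (?A x)"
    using one_minus_compact_bounded_below[OF K closed_UNIV complex_vector.subspace_UNIV] inj by auto
  have injA: "inj ?A"
  proof (rule injI)
    fix x y assume "?A x = ?A y"
    then have "K (x - y) = x - y" using lin by (simp add: algebra_simps)
    then show "x = y" using inj by fastforce
  qed
  have AK: "?A (K x) = K (?A x)" for x using lin by simp
  define R where "R n = (?A ^^ n) ` UNIV" for n :: nat
  have RS: "R (Suc n) = ?A ` R n" for n by (simp add: R_def image_comp)
  have Rsub: "csubspace (R n)" for n
  proof (induction n)
    case 0 then show ?case by (simp add: R_def complex_vector.subspace_UNIV)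
  next
    case (Suc n)
    show ?case unfolding RS by (rule csubspace_image[OF A Suc])
  qed
  have Rclosed: "closed (R n)" for n
  proof (induction n)
    case 0 then show ?case by (simp add: R_def)
  next
    case (Suc n) show ?case unfolding RS
      by (rule closed_image_bounded_below[OF A Suc Rsub d(1)]) (rule d(2))
  qed
  have Rdec1: "R (Suc n) \<subseteq> R n" for n
  proof (induction n)
    case (Suc n) then show ?case unfolding RS[of "Suc n"] RS[of n] by (rule image_mono)
  qed (simp add: R_def)
  have Rdec: "R n \<subseteq> R m" if "m \<le> n" for m n
    using that by (induction rule: dec_induct) (use Rdec1 in auto)
  have KR: "K x \<in> R n" if "x \<in> R n" for x n
    using that
  proof (induction n arbitrary: x)
    case (Suc n)
    then obtain y where y: "y \<in> R n" "x = ?A y" unfolding RS by blast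
    then have "K x = ?A (K y)" using AK by simp
    then show ?case unfolding RS using Suc.IH[OF y(1)] by blast
  qed (simp add: R_def)
  have surj: "surj ?A"
  proof (rule ccontr)
    assume ns: "\<not> surj ?A"
    have ne: "R (Suc n) \<noteq> R n" for n
    proof (induction n)
      case 0 then show ?case using ns by (simp add: R_def)
    next
      case (Suc n) then show ?case unfolding RS[of "Suc n"] RS[of n] by (simp add: inj_image_eq_iff[OF injA] RS)
    qed
    show False
    proof (rule compact_no_infinite_chain[OF K zero_less_one, where L="\<lambda>_. 1" and U=R and W="\<lambda>n. R (Suc n)"])
      show "K x - 1 *\<^sub>C x \<in> R (Suc n)" if "x \<in> R n" for n x
      proof -
        have "?A x \<in> R (Suc n)" using that RS by blast
        from complex_vector.subspace_neg[OF Rsub this] show ?thesis by (simp add: scaleC_one)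
      qed
      show "(\<forall>x\<in>R m. K x \<in> R (Suc n)) \<or> (\<forall>x\<in>R n. K x \<in> R (Suc m))" if "m < n" for m n
        using that KR Rdec[of "Suc m" n] by (intro disjI2) auto
    qed (use Rsub Rclosed Rdec1 ne in auto)
  qed
  define S where "S = inv_into UNIV ?A"
  have AS: "?A (S x) = x" for x unfolding S_def using surj by (rule surj_f_inv_f)
  have SA: "S (?A x) = x" for x unfolding S_def using injA by (rule inv_f_f)
  have "S \<in> bounded_ops UNIV"
    unfolding bounded_ops_iff
  proof (intro conjI ballI allI exI[of _ "inverse d"])
    show "S (x + y) = S x + S y" for x y
      using SA[of "S x + S y"] by (simp only: bounded_ops_linear_simps(1)[OF A] AS)
    show "S (c *\<^sub>C x) = c *\<^sub>C S x" for c x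
      using SA[of "c *\<^sub>C S x"] by (simp only: bounded_ops_linear_simps(4)[OF A] AS)
    show "norm (S x) \<le> inverse d * norm x" for x
      using d(2)[of "S x"] d(1) AS[of x] by (simp add: field_simps)
  qed auto
  then show thesis using AS SA by (intro that) auto
qed

text \<open>Eigenvectors for distinct eigenvalues span a strictly increasing chain, and on its
  \<open>n\<close>-th successive quotient \<open>K\<close> acts as multiplication by
  \<open>L n\<close>, which stays away from 0.\<close>

lemma finite_eigenvalues_compact:
  assumes K: "K \<in> compact_ops UNIV" and e: "e > 0"
  shows "finite {l. e \<le> cmod l \<and> (\<exists>x. x \<noteq> 0 \<and> K x = l *\<^sub>C x)}" (is "finite ?E")
proof (rule ccontr)
  have lin: "K \<in> bounded_ops UNIV" using K by (rule compact_ops_imp_bounded_ops)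
  note Ks = bounded_ops_linear_simps[OF lin]
  assume "infinite ?E"
  from infinite_countable_subset[OF this]
  obtain L :: "nat \<Rightarrow> complex" where L: "inj L" "range L \<subseteq> ?E" by auto
  then have "\<forall>n. \<exists>x. x \<noteq> 0 \<and> K x = L n *\<^sub>C x" by auto
  from choice[OF this] obtain x where x: "\<And>n. x n \<noteq> 0" "\<And>n. K (x n) = L n *\<^sub>C x n" by auto
  have Le: "e \<le> cmod (L n)" for n using L by auto
  \<comment> \<open>\<open>D n\<close> is the product of the \<open>K - L i\<close> for \<open>i < n\<close>; it annihilates \<open>x 0, \<dots>, x (n - 1)\<close> but not \<open>x n\<close>.\<close>
  define D where "D = rec_nat (\<lambda>x. x) (\<lambda>n f x. K (f x) - L n *\<^sub>C f x)"
  have D0: "D 0 y = y" and DS: "D (Suc n) y = K (D n y) - L n *\<^sub>C D n y" for n y by (simp_all add: D_def)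
  have Dadd: "D n (y + z) = D n y + D n z" for n y z
    by (induction n) (simp_all add: D0 DS Ks scaleC_add_right)
  have Dscale: "D n (c *\<^sub>C y) = c *\<^sub>C D n y" for n c y
    by (induction n) (simp_all add: D0 DS Ks scaleC_scaleC scaleC.diff_right mult.commute)
  have Dx: "D n (x j) = (\<Prod>i<n. L j - L i) *\<^sub>C x j" for n j
    by (induction n) (simp_all add: D0 DS Ks scaleC_one x(2) scaleC_scaleC mult_ac flip: scaleC.diff_left,
        simp add: algebra_simps)
  define V where "V n = cspan (x ` {..<n})" for n
  have DV: "D n y = 0" if "y \<in> V n" for n y
    using that unfolding V_def
  proof (induction rule: complex_vector.span_induct_alt)
    case base show ?case using Dscale[of n 0 0] by simp
  next
    case (step c y z)
    then show ?case by (auto simp: Dadd Dscale Dx)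
  qed
  have xV: "x n \<notin> V n" for n
  proof
    assume "x n \<in> V n"
    then have "(\<Prod>i<n. L n - L i) *\<^sub>C x n = 0" using DV Dx by metis
    then show False using x(1) L(1) by (auto dest: injD)
  qed
  have xV': "x n \<in> V (Suc n)" for n unfolding V_def by (rule complex_vector.span_base) simp
  have KV: "K y \<in> V n" if "y \<in> V n" for n y
    using that unfolding V_def
  proof (induction rule: complex_vector.span_induct_alt)
    case base show ?case by (simp add: Ks complex_vector.span_zero)
  next
    case (step c y z)
    then have "(c * L i) *\<^sub>C x i + K z \<in> cspan (x ` {..<n})" if "i < n" for i
      using that by (intro complex_vector.span_add[OF complex_vector.span_scale[OF complex_vector.span_base]]) auto
    then show ?case using step by (auto simp: Ks x scaleC_scaleC)
  qed
  have Vmono: "V m \<subseteq> V n" if "m \<le> n" for m n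
    unfolding V_def using that by (intro complex_vector.span_mono) auto
  show False
  proof (rule compact_no_infinite_chain[OF K e Le, where U="\<lambda>n. V (Suc n)" and W=V])
    show "csubspace (V n)" "csubspace (V (Suc n))" "closed (V n)" for n
      by (auto simp: V_def intro: closed_cspan complex_vector.subspace_span)
    show "V n \<noteq> V (Suc n)" for n using xV xV' by metis
    show "K y - L n *\<^sub>C y \<in> V n" if "y \<in> V (Suc n)" for n y
    proof -
      have "y \<in> cspan (insert (x n) (x ` {..<n}))" using that by (simp add: V_def lessThan_Suc)
      then obtain k where k: "y - k *\<^sub>C x n \<in> V n" unfolding V_def using complex_vector.span_breakdown_eq by blast
      have "K (y - k *\<^sub>C x n) - L n *\<^sub>C (y - k *\<^sub>C x n) \<in> V n"
        using KV[OF k] k unfolding V_def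
        by (rule complex_vector.span_diff[OF _ complex_vector.span_scale])
      also have "K (y - k *\<^sub>C x n) - L n *\<^sub>C (y - k *\<^sub>C x n) = K y - L n *\<^sub>C y"
        using lin by (simp add: Ks x(2) scaleC.diff_right scaleC_scaleC mult.commute)
      finally show ?thesis .
    qed
    show "(\<forall>y\<in>V (Suc m). K y \<in> V n) \<or> (\<forall>y\<in>V (Suc n). K y \<in> V m)" if "m < n" for m n
      using that KV Vmono[of "Suc m" n] by (intro disjI1) auto
  qed (use Vmono in auto)
qed

section \<open>Bounded functionals and complemented subspaces\<close>

definition sublinear :: "('a::real_vector \<Rightarrow> real) \<Rightarrow> bool" where
  "sublinear q \<longleftrightarrow> (\<forall>x y. q (x + y) \<le> q x + q y) \<and> (\<forall>c>0. \<forall>x. q (c *\<^sub>R x) \<le> c * q x)"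

text \<open>The definition asks only for \<open>\<le>\<close>, a condition that passes to infima;
  the opposite inequality is the same one for \<open>inverse c\<close>.\<close>

lemma sublinear_scale:
  assumes "sublinear q" "c > 0" shows "q (c *\<^sub>R x) = c * q x"
proof (rule antisym)
  show "q (c *\<^sub>R x) \<le> c * q x" using assms by (simp add: sublinear_def)
  have "q (inverse c *\<^sub>R (c *\<^sub>R x)) \<le> inverse c * q (c *\<^sub>R x)"
    using assms unfolding sublinear_def by (metis positive_imp_inverse_positive)
  then have "q x \<le> inverse c * q (c *\<^sub>R x)" using assms(2) by simp
  then show "c * q x \<le> q (c *\<^sub>R x)" using assms(2) by (simp add: field_simps)
qed

lemma sublinear_0: "sublinear q \<Longrightarrow> q 0 = 0"
  using sublinear_scale[of q 2 0] by simp

lemma sublinear_add: "sublinear q \<Longrightarrow> q (x + y) \<le> q x + q y"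
  by (simp add: sublinear_def)

lemma sublinear_minus: "sublinear q \<Longrightarrow> - q (- x) \<le> q x"
  using sublinear_add[of q x "- x"] sublinear_0[of q] by simp

text \<open>Lowering a sublinear functional in the direction \<open>z\<close>: a minimal sublinear functional is
  fixed by this operation, hence odd, hence linear.\<close>

definition sublinear_lower :: "('a::real_vector \<Rightarrow> real) \<Rightarrow> 'a \<Rightarrow> 'a \<Rightarrow> real" where
  "sublinear_lower q z x = (INF t\<in>{0..}. q (x + t *\<^sub>R z) - t * q z)"

lemma sublinear_lower_bdd:
  assumes q: "sublinear q" shows "bdd_below ((\<lambda>t. q (x + t *\<^sub>R z) - t * q z) ` {0..})"
proof (rule bdd_belowI2)
  fix t :: real assume t: "t \<in> {0..}"
  have "t * q z = q (t *\<^sub>R z)"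
    using sublinear_scale[OF q, of t z] sublinear_0[OF q] t by (cases "t = 0") auto
  also have "\<dots> \<le> q (x + t *\<^sub>R z) + q (- x)"
    using sublinear_add[OF q, of "x + t *\<^sub>R z" "- x"] by simp
  finally show "- q (- x) \<le> q (x + t *\<^sub>R z) - t * q z" by simp
qed

lemma sublinear_lower_le:
  assumes "sublinear q" "t \<ge> 0" shows "sublinear_lower q z x \<le> q (x + t *\<^sub>R z) - t * q z"
  unfolding sublinear_lower_def by (rule cINF_lower[OF sublinear_lower_bdd]) (use assms in auto)

lemma sublinear_lower_greatest:
  assumes "\<And>t. t \<ge> 0 \<Longrightarrow> m \<le> q (x + t *\<^sub>R z) - t * q z" shows "m \<le> sublinear_lower q z x"
  unfolding sublinear_lower_def by (rule cINF_greatest) (use assms in auto)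

lemma sublinear_sublinear_lower:
  assumes q: "sublinear q" shows "sublinear (sublinear_lower q z)"
  unfolding sublinear_def
proof (intro conjI allI impI)
  fix x y
  have "sublinear_lower q z (x + y) - (q (x + s *\<^sub>R z) - s * q z) \<le> q (y + t *\<^sub>R z) - t * q z"
    if "s \<ge> 0" "t \<ge> 0" for s t
  proof -
    have "sublinear_lower q z (x + y) \<le> q ((x + y) + (s + t) *\<^sub>R z) - (s + t) * q z"
      using that by (intro sublinear_lower_le q) auto
    also have "(x + y) + (s + t) *\<^sub>R z = (x + s *\<^sub>R z) + (y + t *\<^sub>R z)"
      by (simp add: scaleR_left_distrib)
    also have "q \<dots> \<le> q (x + s *\<^sub>R z) + q (y + t *\<^sub>R z)" by (rule sublinear_add[OF q])
    finally show ?thesis by (simp add: distrib_right)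
  qed
  then have "sublinear_lower q z (x + y) - (q (x + s *\<^sub>R z) - s * q z) \<le> sublinear_lower q z y" if "s \<ge> 0" for s
    using that by (intro sublinear_lower_greatest) auto
  then have "sublinear_lower q z (x + y) - sublinear_lower q z y \<le> q (x + s *\<^sub>R z) - s * q z" if "s \<ge> 0" for s
    using that by (simp add: algebra_simps)
  then have "sublinear_lower q z (x + y) - sublinear_lower q z y \<le> sublinear_lower q z x"
    by (intro sublinear_lower_greatest) auto
  then show "sublinear_lower q z (x + y) \<le> sublinear_lower q z x + sublinear_lower q z y" by simp
next
  fix c :: real and x assume c: "c > 0"
  have "inverse c * sublinear_lower q z (c *\<^sub>R x) \<le> q (x + t *\<^sub>R z) - t * q z" if t: "t \<ge> 0" for t
  proof -
    have "sublinear_lower q z (c *\<^sub>R x) \<le> q (c *\<^sub>R x + (c * t) *\<^sub>R z) - (c * t) * q z"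
      using t c by (intro sublinear_lower_le q) auto
    also have "c *\<^sub>R x + (c * t) *\<^sub>R z = c *\<^sub>R (x + t *\<^sub>R z)" by (simp add: scaleR_right_distrib)
    also have "q \<dots> = c * q (x + t *\<^sub>R z)" by (rule sublinear_scale[OF q c])
    finally show ?thesis using c by (simp add: field_simps)
  qed
  then have "inverse c * sublinear_lower q z (c *\<^sub>R x) \<le> sublinear_lower q z x"
    by (rule sublinear_lower_greatest)
  then show "sublinear_lower q z (c *\<^sub>R x) \<le> c * sublinear_lower q z x" using c by (simp add: field_simps)
qed

text \<open>Subadditivity of an infimum fails for general families. In a chain, two members used at
  \<open>x\<close> and at \<open>y\<close> can be replaced by the smaller of the two at both points.
  The infima are finite because \<open>- p (- x)\<close> is a common lower bound.\<close>

lemma sublinear_INF_chain: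
  assumes C: "C \<noteq> {}" "\<And>q. q \<in> C \<Longrightarrow> sublinear q \<and> (\<forall>x. q x \<le> p x)"
    and chain: "\<And>q q'. q \<in> C \<Longrightarrow> q' \<in> C \<Longrightarrow> (\<forall>x. q x \<le> q' x) \<or> (\<forall>x. q' x \<le> q x)"
  shows "sublinear (\<lambda>x. INF q\<in>C. q x)" "\<And>q x. q \<in> C \<Longrightarrow> (INF q\<in>C. q x) \<le> q x"
proof -
  have bdd: "bdd_below ((\<lambda>q. q x) ` C)" for x
  proof (rule bdd_belowI2)
    fix q assume "q \<in> C"
    then show "- p (- x) \<le> q x" using C(2)[of q] sublinear_minus[of q x] by (smt (verit))
  qed
  show lower: "(INF q\<in>C. q x) \<le> q x" if "q \<in> C" for q x by (rule cINF_lower[OF bdd that])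
  show "sublinear (\<lambda>x. INF q\<in>C. q x)" unfolding sublinear_def
  proof (intro conjI allI impI)
    fix x y
    have le: "(INF q\<in>C. q (x + y)) - q x \<le> q' y" if q: "q \<in> C" "q' \<in> C" for q q'
    proof -
      obtain r where r: "r \<in> C" "r x \<le> q x" "r y \<le> q' y"
        using chain[OF q] q by fastforce
      then have "(INF q\<in>C. q (x + y)) \<le> r x + r y"
        using lower[OF r(1), of "x + y"] sublinear_add[of r x y] C(2) by fastforce
      then show ?thesis using r by linarith
    qed
    have "(INF q\<in>C. q (x + y)) - q x \<le> (INF q\<in>C. q y)" if "q \<in> C" for q
      using le[OF that] by (intro cINF_greatest C(1))
    then have "(INF q\<in>C. q (x + y)) - (INF q\<in>C. q y) \<le> q x" if "q \<in> C" for q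
      using that by (simp add: algebra_simps)
    then have "(INF q\<in>C. q (x + y)) - (INF q\<in>C. q y) \<le> (INF q\<in>C. q x)"
      by (intro cINF_greatest C(1))
    then show "(INF q\<in>C. q (x + y)) \<le> (INF q\<in>C. q x) + (INF q\<in>C. q y)" by simp
  next
    fix c :: real and x assume c: "c > 0"
    have "inverse c * (INF q\<in>C. q (c *\<^sub>R x)) \<le> q x" if q: "q \<in> C" for q
      using lower[OF q, of "c *\<^sub>R x"] sublinear_scale[of q c x] C(2)[OF q] c by (simp add: field_simps)
    then have "inverse c * (INF q\<in>C. q (c *\<^sub>R x)) \<le> (INF q\<in>C. q x)"
      by (intro cINF_greatest C(1))
    then show "(INF q\<in>C. q (c *\<^sub>R x)) \<le> c * (INF q\<in>C. q x)" using c by (simp add: field_simps)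
  qed
qed

lemma linear_below_sublinear:
  fixes p :: "'a::real_vector \<Rightarrow> real"
  assumes p: "sublinear p"
  obtains f where "linear f" "\<And>x. f x \<le> p x"
proof -
  let ?A = "{q. sublinear q \<and> (\<forall>x. q x \<le> p x)}"
  let ?P = "\<lambda>q q' :: 'a \<Rightarrow> real. \<forall>x. q' x \<le> q x"
  have "\<exists>m\<in>?A. \<forall>a\<in>?A. ?P m a \<longrightarrow> a = m"
  proof (rule predicate_Zorn)
    show "partial_order_on ?A (relation_of ?P ?A)"
      by (rule partial_order_on_relation_ofI) (auto intro: order_trans, blast intro: antisym)
    fix C assume C: "C \<in> Chains (relation_of ?P ?A)"
    show "\<exists>u\<in>?A. \<forall>a\<in>C. ?P a u"
    proof (cases "C = {}")
      case True then show ?thesis using p by auto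
    next
      case False
      have CA: "sublinear q \<and> (\<forall>x. q x \<le> p x)" if "q \<in> C" for q
        using C that unfolding Chains_def relation_of_def by auto
      have ch: "(\<forall>x. q x \<le> q' x) \<or> (\<forall>x. q' x \<le> q x)" if "q \<in> C" "q' \<in> C" for q q'
      proof -
        have "(q, q') \<in> relation_of ?P ?A \<or> (q', q) \<in> relation_of ?P ?A"
          using C that unfolding Chains_def by blast
        then show ?thesis unfolding relation_of_def by blast
      qed
      have I: "sublinear (\<lambda>x. INF q\<in>C. q x)"
        by (rule sublinear_INF_chain(1)[OF False CA ch])
      have I2: "(INF q\<in>C. q x) \<le> q x" if "q \<in> C" for q x
        by (rule sublinear_INF_chain(2)[OF False CA ch that])
      obtain q where q: "q \<in> C" using False by auto
      have "(INF q\<in>C. q x) \<le> p x" for x using I2[OF q, of x] CA[OF q] order_trans by blast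
      then show ?thesis using I I2 by (intro bexI[of _ "\<lambda>x. INF q\<in>C. q x"]) auto
    qed
  qed
  then obtain m where m: "sublinear m" "\<And>x. m x \<le> p x"
    and min: "\<And>q. sublinear q \<Longrightarrow> (\<And>x. q x \<le> p x) \<Longrightarrow> (\<And>x. q x \<le> m x) \<Longrightarrow> q = m"
    by auto
  have odd: "m (- y) = - m y" for y
  proof (rule antisym)
    have le: "sublinear_lower m y x \<le> m x" for x
      using sublinear_lower_le[OF m(1), of 0 y x] by simp
    have "sublinear_lower m y = m"
      by (rule min[OF sublinear_sublinear_lower[OF m(1)]]) (use le m(2) in \<open>auto intro: order_trans\<close>)
    then show "m (- y) \<le> - m y"
      using sublinear_lower_le[OF m(1), of 1 y "- y"] sublinear_0[OF m(1)] by simp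
    show "- m y \<le> m (- y)" using sublinear_minus[OF m(1), of "- y"] by simp
  qed
  have "linear m"
  proof (rule linearI)
    fix x y
    show "m (x + y) = m x + m y"
      using sublinear_add[OF m(1), of x y] sublinear_add[OF m(1), of "x + y" "- y"] odd[of y] by simp
  next
    fix c x
    show "m (c *\<^sub>R x) = c *\<^sub>R m x"
    proof (cases c "0::real" rule: linorder_cases)
      case less
      then have "m (- c *\<^sub>R x) = - c * m x" by (intro sublinear_scale m) auto
      then show ?thesis using odd[of "c *\<^sub>R x"] by simp
    qed (use sublinear_0[OF m(1)] sublinear_scale[OF m(1)] in auto)
  qed
  then show thesis using m(2) by (rule that)
qed

text \<open>Lowering the norm in the direction \<open>z\<close> before taking a linear minorant
  \<open>f\<close> forces \<open>f z \<ge> norm z\<close>, hence \<open>f z \<noteq> 0\<close>. The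
  complex functional is the usual \<open>f x - i f (i x)\<close>, divided by its value at
  \<open>z\<close>.\<close>

lemma bounded_functional_exists:
  fixes z :: "'a::complex_banach"
  assumes "z \<noteq> 0"
  obtains g :: "'a \<Rightarrow> complex" where "bounded_linear g" "\<And>c x. g (c *\<^sub>C x) = c * g x" "g z = 1"
proof -
  have nsub: "sublinear (norm :: 'a \<Rightarrow> real)" by (auto simp: sublinear_def norm_triangle_ineq)
  obtain f where f: "linear f" and le: "\<And>x. f x \<le> sublinear_lower norm z x"
    using linear_below_sublinear[OF sublinear_sublinear_lower[OF nsub]] by auto
  have fn: "f x \<le> norm x" for x
    using le[of x] sublinear_lower_le[OF nsub, of 0 z x] by simp
  have fz: "norm z \<le> f z"
    using le[of "- z"] sublinear_lower_le[OF nsub, of 1 z "- z"] linear_neg[OF f, of z] by simp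
  have fabs: "\<bar>f x\<bar> \<le> norm x" for x using fn[of x] fn[of "- x"] linear_neg[OF f, of x] by simp
  define h where "h x = Complex (f x) (- f (\<i> *\<^sub>C x))" for x
  note fl = linear_add[OF f] linear_scale[OF f] linear_neg[OF f]
  have hadd: "h (x + y) = h x + h y" for x y
    by (simp add: h_def fl scaleC_add_right complex_eq_iff)
  have hR: "h (r *\<^sub>R x) = of_real r * h x" for r x
  proof -
    have "\<i> *\<^sub>C (r *\<^sub>R x) = r *\<^sub>R (\<i> *\<^sub>C x)" by (simp add: scaleR_scaleC scaleC_scaleC mult.commute)
    then show ?thesis by (simp add: h_def fl complex_eq_iff)
  qed
  have hi: "h (\<i> *\<^sub>C x) = \<i> * h x" for x
  proof -
    have "\<i> *\<^sub>C \<i> *\<^sub>C x = - x"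
      using complex_vector.scale_minus_left[of 1 x] by (simp add: scaleC_scaleC scaleC_one)
    then show ?thesis by (simp add: h_def fl complex_eq_iff)
  qed
  have hC: "h (c *\<^sub>C x) = c * h x" for c x
  proof -
    have "c *\<^sub>C x = Re c *\<^sub>R x + Im c *\<^sub>R (\<i> *\<^sub>C x)"
      by (simp add: scaleR_scaleC scaleC_scaleC flip: scaleC_add_left)
         (simp add: complex_eq mult.commute)
    then have "h (c *\<^sub>C x) = (of_real (Re c) + \<i> * of_real (Im c)) * h x"
      by (simp only: hadd hR hi) (simp add: algebra_simps)
    then show ?thesis by (simp only: complex_eq[symmetric])
  qed
  have hb: "bounded_linear h"
  proof (rule bounded_linear_intro[where K=2])
    show "h (x + y) = h x + h y" for x y by (rule hadd)
    show "h (r *\<^sub>R x) = r *\<^sub>R h x" for r x by (simp add: hR scaleR_conv_of_real)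
    show "norm (h x) \<le> norm x * 2" for x
    proof -
      have "norm (h x) \<le> \<bar>f x\<bar> + \<bar>f (\<i> *\<^sub>C x)\<bar>" using cmod_le[of "h x"] by (simp add: h_def)
      also have "\<dots> \<le> norm x + norm (\<i> *\<^sub>C x)" by (intro add_mono fabs)
      finally show ?thesis by (simp add: norm_scaleC)
    qed
  qed
  have "f z > 0" using fz assms by (meson less_le_trans zero_less_norm_iff)
  then have hz: "h z \<noteq> 0" by (auto simp: h_def complex_eq_iff)
  show thesis
  proof (rule that[of "\<lambda>x. h x / h z"])
    show "bounded_linear (\<lambda>x. h x / h z)"
      using bounded_linear_compose[OF bounded_linear_divide[of "h z"] hb] by simp
  qed (use hC hz in auto)
qed

section \<open>Closure properties of compact operators and projections of finite rank\<close>

lemma compact_ops_UNIV_add: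
  assumes "K \<in> compact_ops UNIV" "L \<in> compact_ops UNIV" shows "(\<lambda>x. K x + L x) \<in> compact_ops UNIV"
proof -
  have "ideal (compact_ops UNIV) (op_algebra (UNIV::'a set))" by (rule ideal_compact_ops) auto
  from additive_subgroup.a_closed[OF ideal.axioms(1)[OF this] assms] show ?thesis
    by (simp add: restrict_UNIV)
qed

lemma compact_ops_UNIV_compose:
  assumes K: "K \<in> compact_ops UNIV" and S: "S \<in> bounded_ops UNIV"
  shows "(\<lambda>x. S (K x)) \<in> compact_ops UNIV" "(\<lambda>x. K (S x)) \<in> compact_ops UNIV"
proof -
  interpret ideal "compact_ops UNIV" "op_algebra (UNIV::'a set)" by (rule ideal_compact_ops) auto
  show "(\<lambda>x. S (K x)) \<in> compact_ops UNIV" "(\<lambda>x. K (S x)) \<in> compact_ops UNIV"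
    using I_l_closed[OF K, of S] I_r_closed[OF K, of S] S by (simp_all add: compose_def restrict_UNIV)
qed

lemma compact_ops_UNIV_scale:
  assumes "K \<in> compact_ops UNIV" shows "(\<lambda>x. c *\<^sub>C K x) \<in> compact_ops UNIV"
  using compact_ops_smult[OF _ _ assms, of c] by (simp add: restrict_UNIV complex_vector.subspace_UNIV)

lemma compact_ops_UNIV_diff:
  assumes "K \<in> compact_ops UNIV" "L \<in> compact_ops UNIV" shows "(\<lambda>x. K x - L x) \<in> compact_ops UNIV"
  using compact_ops_UNIV_add[OF assms(1) compact_ops_UNIV_scale[OF assms(2), of "-1"]]
  by (simp add: scaleC_one)

lemma compact_ops_UNIV_minus: "K \<in> compact_ops UNIV \<Longrightarrow> (\<lambda>x. - K x) \<in> compact_ops UNIV"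
  using compact_ops_UNIV_scale[of K "-1"] by (simp add: scaleC_one)

lemma rank_one_compact:
  assumes g: "bounded_linear g" "\<And>c x. g (c *\<^sub>C x) = c * g x"
  shows "(\<lambda>x. g x *\<^sub>C b) \<in> compact_ops UNIV"
proof -
  obtain M where M: "\<And>x. norm (g x) \<le> norm x * M" "M > 0" using bounded_linear.pos_bounded[OF g(1)] by auto
  show ?thesis
  proof (rule compact_opsI[where D = "(\<lambda>t. t *\<^sub>C b) ` cball 0 M"])
    have "bounded_linear (\<lambda>x. g x *\<^sub>C b)"
      by (rule bounded_linear_compose[OF scaleC.bounded_linear_left g(1)])
    then show "(\<lambda>x. g x *\<^sub>C b) \<in> bounded_ops UNIV"
      using g(2) by (simp add: bounded_ops_UNIV_iff scaleC_scaleC)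
    show "compact ((\<lambda>t. t *\<^sub>C b) ` cball 0 M)"
      by (intro compact_continuous_image continuous_on_scaleC continuous_intros compact_cball)
    fix x :: 'a assume "norm x \<le> 1"
    then have "norm (g x) \<le> 1 * M" using M by (intro order_trans[OF M(1)] mult_right_mono) auto
    then show "g x *\<^sub>C b \<in> (\<lambda>t. t *\<^sub>C b) ` cball 0 M" by (intro imageI) simp
  qed
qed

lemma compact_ops_zero: "(\<lambda>x. 0) \<in> compact_ops UNIV"
  by (rule compact_opsI[where D="{0}"]) (auto simp: bounded_ops_UNIV_iff)

text \<open>To adjoin \<open>b\<close>, take the part \<open>b - Q b\<close> that the old projection
  misses and a functional \<open>g\<close> equal to 1 on it. Composed with \<open>x - Q x\<close>,
  the functional vanishes on the old span, so adding the rank one term does not disturb the old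
  projection there.\<close>

lemma finite_dimensional_compact_projection:
  assumes "finite B"
  obtains Q where "Q \<in> compact_ops UNIV" "\<And>x. Q x \<in> cspan B" "\<And>x. x \<in> cspan B \<Longrightarrow> Q x = x"
  using assms
proof (induction B arbitrary: thesis rule: finite_induct)
  case empty
  show ?case by (rule empty[OF compact_ops_zero]) (auto simp: complex_vector.span_empty)
next
  case (insert b B)
  obtain Q where Q: "Q \<in> compact_ops UNIV" "\<And>x. Q x \<in> cspan B" "\<And>x. x \<in> cspan B \<Longrightarrow> Q x = x"
    by (rule insert.IH, rule that)
  have lin: "Q \<in> bounded_ops UNIV" using Q(1) by (rule compact_ops_imp_bounded_ops)
  show ?case
  proof (cases "b \<in> cspan B")
    case True
    then have "cspan (insert b B) = cspan B" by (rule complex_vector.span_redundant)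
    then show ?thesis using insert.prems Q by simp
  next
    case False
    let ?b = "b - Q b"
    have "?b \<noteq> 0" using False Q(2)[of b] by auto
    then obtain g where g: "bounded_linear g" "\<And>c x. g (c *\<^sub>C x) = c * g x" "g ?b = 1"
      by (rule bounded_functional_exists) blast
    let ?h = "\<lambda>x. g (x - Q x)"
    have h: "bounded_linear ?h" "\<And>c x. ?h (c *\<^sub>C x) = c * ?h x"
      using bounded_linear_compose[OF g(1), of "\<lambda>x. x - Q x"] one_minus_bounded_ops[OF lin] g(2)
      by (auto simp: bounded_ops_UNIV_iff)
    have bspan: "?b \<in> cspan (insert b B)"
      using Q(2)[of b] by (subst complex_vector.span_breakdown_eq) (auto intro!: exI[of _ 1] complex_vector.span_neg simp: scaleC_one)
    have sub: "cspan B \<subseteq> cspan (insert b B)" by (rule complex_vector.span_mono) auto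
    show ?thesis
    proof (rule insert.prems)
      show "(\<lambda>x. Q x + ?h x *\<^sub>C ?b) \<in> compact_ops UNIV"
        by (rule compact_ops_UNIV_add[OF Q(1) rank_one_compact[OF h]])
      show "Q x + ?h x *\<^sub>C ?b \<in> cspan (insert b B)" for x
        using Q(2) sub bspan by (intro complex_vector.span_add[OF _ complex_vector.span_scale]) auto
      fix x assume "x \<in> cspan (insert b B)"
      then obtain k where k: "x - k *\<^sub>C b \<in> cspan B" using complex_vector.span_breakdown_eq by blast
      then have Qx: "Q x = x - k *\<^sub>C b + k *\<^sub>C Q b"
        using Q(3)[OF k] lin by (simp add: bounded_ops_linear_simps algebra_simps)
      then have "x - Q x = k *\<^sub>C ?b" by (simp add: scaleC.diff_right)
      then have "?h x = k" by (simp only: g(2) g(3) mult_1_right)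
      then show "Q x + ?h x *\<^sub>C ?b = x" by (simp add: Qx scaleC.diff_right)
    qed
  qed
qed

text \<open>The operator below is a projection along a closed subspace of finite codimension only up to
  a redundancy in \<open>B\<close>, which is harmless.\<close>

lemma finite_codimensional_compact_complement:
  assumes "finite B" "csubspace R" "closed R" "add_span R B = UNIV"
  obtains E where "E \<in> compact_ops UNIV" "\<And>x. x - E x \<in> R"
  using assms
proof (induction B arbitrary: R thesis rule: finite_induct)
  case empty
  then show ?case using compact_ops_zero by auto
next
  case (insert b B)
  let ?R = "add_span R {b}"
  have R: "csubspace ?R" "closed ?R" using insert.prems by (auto intro: csubspace_add_span closed_add_span)
  have "add_span ?R B = UNIV"
  proof -
    have "add_span R (insert b B) \<subseteq> add_span ?R B"
      using add_span_superset[OF R(1), of B] add_span_superset[OF insert.prems(2), of "{b}"]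
      by (intro add_span_subset csubspace_add_span R) auto
    then show ?thesis using insert.prems by auto
  qed
  from insert.IH[OF _ R this]
  obtain E where E: "E \<in> compact_ops UNIV" "\<And>x. x - E x \<in> ?R" by auto
  have lin: "E \<in> bounded_ops UNIV" using E(1) by (rule compact_ops_imp_bounded_ops)
  note E1 = one_minus_bounded_ops[OF lin]
  show ?case
  proof (cases "b \<in> R")
    case True
    have "?R \<subseteq> R" by (rule add_span_subset) (use insert.prems True in auto)
    then show ?thesis using E insert.prems by blast
  next
    case False
    have "\<exists>t. y - t *\<^sub>C b \<in> R" if "y \<in> ?R" for y using that by (simp add: add_span_insert)
    then have "\<forall>x. \<exists>t. (x - E x) - t *\<^sub>C b \<in> R" using E(2) by blast
    from choice[OF this] obtain g where g: "\<And>x. (x - E x) - g x *\<^sub>C b \<in> R" by auto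
    obtain d where d: "d > 0" "\<And>v t. v \<in> R \<Longrightarrow> d * cmod t \<le> norm (v + t *\<^sub>C b)"
      using norm_add_scaleC_ge[OF insert.prems(2,3) False] by blast
    \<comment> \<open>The coefficient of \<open>b\<close> modulo \<open>R\<close> is unique because
      \<open>b\<close> lies outside \<open>R\<close>; this makes the chosen function
      \<open>g\<close> linear, and \<open>d\<close> makes it bounded.\<close>
    have uniq: "g x = t" if "(x - E x) - t *\<^sub>C b \<in> R" for x t
    proof -
      have "((x - E x) - t *\<^sub>C b) - ((x - E x) - g x *\<^sub>C b) \<in> R"
        by (rule complex_vector.subspace_diff[OF insert.prems(2) that g])
      then have "(g x - t) *\<^sub>C b \<in> R" by (simp add: scaleC.diff_left)
      from complex_vector.subspace_neg[OF insert.prems(2) this] d(2)[of "- ((g x - t) *\<^sub>C b)" "g x - t"]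
      have "d * cmod (g x - t) \<le> 0" by simp
      then show ?thesis using d(1) by (simp add: mult_le_0_iff)
    qed
    have gadd: "g (x + y) = g x + g y" for x y
    proof (rule uniq)
      show "x + y - E (x + y) - (g x + g y) *\<^sub>C b \<in> R"
        using complex_vector.subspace_add[OF insert.prems(2) g[of x] g[of y]] lin
        by (simp add: bounded_ops_linear_simps scaleC_add_left algebra_simps)
    qed
    have gC: "g (c *\<^sub>C x) = c * g x" for c x
    proof (rule uniq)
      show "c *\<^sub>C x - E (c *\<^sub>C x) - (c * g x) *\<^sub>C b \<in> R"
        using complex_vector.subspace_scale[OF insert.prems(2) g[of x], of c] lin
        by (simp add: bounded_ops_linear_simps scaleC_scaleC scaleC.diff_right)
    qed
    obtain M where M: "\<And>x. norm (x - E x) \<le> norm x * M"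
      using E1 bounded_linear.bounded[of "\<lambda>x. x - E x"] by (auto simp: bounded_ops_UNIV_iff)
    have gb: "bounded_linear g"
    proof (rule bounded_linear_intro[where K = "M / d"])
      show "g (r *\<^sub>R x) = r *\<^sub>R g x" for r x by (simp add: scaleR_scaleC gC scaleR_conv_of_real)
      show "norm (g x) \<le> norm x * (M / d)" for x
      proof -
        have "d * cmod (g x) \<le> norm ((x - E x) - g x *\<^sub>C b + g x *\<^sub>C b)" by (rule d(2)[OF g])
        also have "\<dots> \<le> norm x * M" using M by simp
        finally show ?thesis using d(1) by (simp add: field_simps)
      qed
    qed (rule gadd)
    show ?thesis
    proof (rule insert.prems(1))
      show "(\<lambda>x. E x + g x *\<^sub>C b) \<in> compact_ops UNIV"
        by (rule compact_ops_UNIV_add[OF E(1) rank_one_compact[OF gb gC]])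
      show "x - (E x + g x *\<^sub>C b) \<in> R" for x using g[of x] by (simp add: algebra_simps)
    qed
  qed
qed

section \<open>Fredholm operators\<close>

text \<open>Successive correction: the error stays in the range of \<open>T\<close> and is halved at
  each step, so the corrections form an absolutely convergent series of norm at most
  \<open>2 * M * norm y\<close>.\<close>

lemma approximate_preimages_imp_preimages:
  assumes T: "T \<in> bounded_ops UNIV" and M: "M \<ge> 0"
    and approx: "\<And>y. y \<in> range T \<Longrightarrow> \<exists>x. norm x \<le> M * norm y \<and> norm (y - T x) \<le> norm y / 2"
    and y: "y \<in> range T"
  shows "\<exists>x. T x = y \<and> norm x \<le> 2 * M * norm y"
proof -
  have blin: "bounded_linear T" using T by (simp add: bounded_ops_UNIV_iff)
  have "\<forall>y\<in>range T. \<exists>x. norm x \<le> M * norm y \<and> norm (y - T x) \<le> norm y / 2" using approx by blast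
  from bchoice[OF this] obtain h where h: "\<And>y. y \<in> range T \<Longrightarrow> norm (h y) \<le> M * norm y"
    "\<And>y. y \<in> range T \<Longrightarrow> norm (y - T (h y)) \<le> norm y / 2" by blast
  define Y where "Y = rec_nat y (\<lambda>_ z. z - T (h z))"
  have Y0: "Y 0 = y" and YS: "Y (Suc k) = Y k - T (h (Y k))" for k by (simp_all add: Y_def)
  have YR: "Y k \<in> range T" for k
  proof (induction k)
    case (Suc k)
    then obtain u where "Y k = T u" by blast
    then have "Y (Suc k) = T (u - h (Y k))" using T by (simp add: YS)
    then show ?case by blast
  qed (simp add: Y0 y)
  have Yn: "norm (Y k) \<le> norm y * (1/2) ^ k" for k
  proof (induction k)
    case (Suc k)
    have "norm (Y (Suc k)) \<le> norm (Y k) / 2" unfolding YS by (rule h(2)[OF YR])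
    then show ?case using Suc by simp
  qed (simp add: Y0)
  have hn: "norm (h (Y k)) \<le> M * norm y * (1/2) ^ k" for k
    using order_trans[OF h(1)[OF YR] mult_left_mono[OF Yn M]] by (simp add: mult.assoc)
  have g: "(\<lambda>k. M * norm y * (1/2) ^ k) sums (M * norm y * 2)"
    using sums_mult[OF geometric_sums[of "1/2::real"], of "M * norm y"] by simp
  have sn: "summable (\<lambda>k. norm (h (Y k)))"
    by (rule summable_comparison_test[OF _ sums_summable[OF g]]) (use hn in auto)
  have "(\<lambda>k. T (h (Y k))) sums T (\<Sum>k. h (Y k))"
    by (rule bounded_linear.sums[OF blin summable_sums[OF summable_norm_cancel[OF sn]]])
  moreover have "(\<lambda>k. T (h (Y k))) sums y"
  proof -
    have "(\<lambda>k. norm y * (1/2) ^ k) \<longlonglongrightarrow> norm y * 0" by (intro tendsto_intros) auto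
    then have lim: "(\<lambda>k. norm y * (1/2) ^ k) \<longlonglongrightarrow> 0" by simp
    have "Y \<longlonglongrightarrow> 0" by (rule Lim_null_comparison[OF always_eventually lim]) (use Yn in auto)
    from telescope_sums'[OF this] show ?thesis by (simp add: YS Y0)
  qed
  ultimately have "T (\<Sum>k. h (Y k)) = y" by (rule sums_unique2)
  moreover have "norm (\<Sum>k. h (Y k)) \<le> 2 * M * norm y"
  proof -
    have "norm (\<Sum>k. h (Y k)) \<le> (\<Sum>k. norm (h (Y k)))" by (rule summable_norm[OF sn])
    also have "\<dots> \<le> (\<Sum>k. M * norm y * (1/2) ^ k)" by (rule suminf_le[OF hn sn sums_summable[OF g]])
    also have "\<dots> = 2 * M * norm y" using sums_unique[OF g] by simp
    finally show ?thesis .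
  qed
  ultimately show ?thesis by blast
qed

text \<open>The open mapping theorem for \<open>T\<close> onto its range. The range is closed, hence
  a Baire space, so the closure of the image of some ball contains a relative ball around a point
  \<open>y0\<close>. Subtracting approximate preimages of \<open>y0\<close> from those of
  \<open>y0 + y\<close> handles small \<open>y\<close>, and scaling handles the rest.\<close>

lemma closed_range_bounded_preimages:
  assumes T: "T \<in> bounded_ops UNIV" and closed: "closed (range T)"
  obtains C where "C \<ge> 0" "\<And>y. y \<in> range T \<Longrightarrow> \<exists>x. T x = y \<and> norm x \<le> C * norm y"
proof -
  let ?R = "range T"
  note Ts = bounded_ops_linear_simps[OF T]
  have blin: "bounded_linear T" using T by (simp add: bounded_ops_UNIV_iff)
  define C where "C n = closure (T ` cball 0 (real n))" for n
  have CR: "C n \<subseteq> ?R" for n unfolding C_def by (rule closure_minimal[OF _ closed]) auto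
  have UC: "\<Union>(range C) = ?R"
  proof (intro equalityI subsetI)
    fix y assume "y \<in> ?R"
    then obtain x where x: "y = T x" by blast
    obtain n :: nat where "norm x \<le> real n" using real_arch_simple by blast
    then have "y \<in> C n" unfolding C_def x by (intro subsetD[OF closure_subset] imageI) simp
    then show "y \<in> \<Union>(range C)" by blast
  qed (use CR in blast)
  have "\<exists>n. top_of_set ?R interior_of C n \<noteq> {}"
  proof (rule ccontr)
    assume no: "\<nexists>n. top_of_set ?R interior_of C n \<noteq> {}"
    have "top_of_set ?R interior_of \<Union>(range C) = {}"
    proof (rule Baire_category_alt)
      show "completely_metrizable_space (top_of_set ?R) \<or>
          locally_compact_space (top_of_set ?R) \<and> regular_space (top_of_set ?R)"
        using completely_metrizable_space_closedin[OF completely_metrizable_space_euclidean, of ?R] closed by auto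
      show "closedin (top_of_set ?R) S \<and> top_of_set ?R interior_of S = {}" if S': "S \<in> range C" for S
      proof -
        obtain n where S: "S = C n" using S' by blast
        have "closedin (top_of_set ?R) (C n)" using CR[of n] by (intro closed_subset) (auto simp: C_def)
        then show ?thesis using no S by blast
      qed
    qed auto
    moreover have "top_of_set ?R interior_of ?R = ?R"
      by (metis interior_of_topspace topspace_euclidean_subtopology)
    ultimately show False by (simp add: UC)
  qed
  then obtain n where "top_of_set ?R interior_of C n \<noteq> {}" by (elim exE)
  then obtain y0 where "y0 \<in> top_of_set ?R interior_of C n" by (auto simp only: ex_in_conv[symmetric])
  then obtain W where W: "openin (top_of_set ?R) W" "y0 \<in> W" "W \<subseteq> C n"
    unfolding interior_of_def mem_Collect_eq by (elim exE conjE)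
  have WR: "W \<subseteq> ?R" and WB: "\<forall>x\<in>W. \<exists>e>0. ball x e \<inter> ?R \<subseteq> W"
    using W(1) unfolding openin_contains_ball by simp_all
  from bspec[OF WB W(2)] obtain e where e0: "e > 0" "ball y0 e \<inter> ?R \<subseteq> W" by (elim exE conjE)
  have e: "e > 0" "ball y0 e \<inter> ?R \<subseteq> C n" using e0(1) subset_trans[OF e0(2) W(3)] by simp_all
  have y0R: "y0 \<in> ?R" using W(2) WR by (rule subsetD[rotated])
  have near: "\<exists>a. norm a \<le> real n \<and> norm (T a - w) < d" if w: "w \<in> C n" "d > 0" for w d
  proof -
    obtain v where "v \<in> T ` cball 0 (real n)" "dist v w < d"
      using w unfolding C_def closure_approachable by blast
    then show ?thesis by (auto simp: dist_norm)
  qed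
  have small: "\<exists>x. norm x \<le> 2 * real n \<and> norm (y - T x) < d" if y: "y \<in> ?R" "norm y < e" and d: "d > 0" for y d
  proof -
    have "y0 + y \<in> ?R"
      using csubspace_image[OF T complex_vector.subspace_UNIV] y0R y(1) by (rule complex_vector.subspace_add)
    moreover have "y0 + y \<in> ball y0 e" using y(2) by (simp add: dist_norm)
    ultimately have "y0 + y \<in> C n" using e(2) by blast
    then obtain a where a: "norm a \<le> real n" "norm (T a - (y0 + y)) < d / 2" using near[of _ "d/2"] d by auto
    have "y0 \<in> C n" using e y0R by auto
    then obtain b where b: "norm b \<le> real n" "norm (T b - y0) < d / 2" using near[of _ "d/2"] d by auto
    have "norm (a - b) \<le> 2 * real n" using norm_triangle_ineq4[of a b] a b by simp
    moreover have "norm (y - T (a - b)) < d"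
    proof -
      have "y - T (a - b) = (T b - y0) - (T a - (y0 + y))" using T by (simp add: algebra_simps)
      then have "norm (y - T (a - b)) \<le> norm (T b - y0) + norm (T a - (y0 + y))"
        by (simp only: norm_triangle_ineq4)
      then show ?thesis using a(2) b(2) by linarith
    qed
    ultimately show ?thesis by blast
  qed
  \<comment> \<open>A vector scaled to norm \<open>e / 2\<close> is approximated to within
    \<open>e / 4\<close> by the image of a vector of norm at most \<open>2 n\<close>; scaling back
    gives the factor \<open>4 n / e\<close> and an error of half the norm.\<close>
  define M where "M = 4 * real n / e"
  have M0: "M \<ge> 0" using e by (simp add: M_def)
  have "\<exists>x. norm x \<le> M * norm y \<and> norm (y - T x) \<le> norm y / 2" if y: "y \<in> ?R" for y
  proof (cases "y = 0")
    case True then show ?thesis by (intro exI[of _ 0]) (simp add: Ts)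
  next
    case False
    define s where "s = e / (2 * norm y)"
    have s: "s > 0" "s * norm y = e / 2" using False e by (auto simp: s_def)
    have "s *\<^sub>R y \<in> ?R" unfolding scaleR_scaleC
      using csubspace_image[OF T complex_vector.subspace_UNIV] y by (rule complex_vector.subspace_scale)
    moreover have "norm (s *\<^sub>R y) < e" using s e by simp
    ultimately obtain x where x: "norm x \<le> 2 * real n" "norm (s *\<^sub>R y - T x) < e / 4"
      using small[of "s *\<^sub>R y" "e / 4"] e by auto
    show ?thesis
    proof (intro exI[of _ "inverse s *\<^sub>R x"] conjI)
      have "norm (inverse s *\<^sub>R x) = inverse s * norm x" using s by simp
      also have "\<dots> \<le> inverse s * (2 * real n)" using x s by (intro mult_left_mono) auto
      also have "\<dots> = M * norm y" using False e by (simp add: s_def M_def field_simps)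
      finally show "norm (inverse s *\<^sub>R x) \<le> M * norm y" .
      have "y - T (inverse s *\<^sub>R x) = inverse s *\<^sub>R (s *\<^sub>R y - T x)"
        using s by (simp add: linear_simps[OF blin] scaleR_diff_right)
      then have "norm (y - T (inverse s *\<^sub>R x)) = inverse s * norm (s *\<^sub>R y - T x)" using s by simp
      also have "\<dots> \<le> inverse s * (e / 4)" using x s by (intro mult_left_mono) auto
      also have "\<dots> = norm y / 2" using False e by (simp add: s_def field_simps)
      finally show "norm (y - T (inverse s *\<^sub>R x)) \<le> norm y / 2" .
    qed
  qed
  then show thesis
    by (intro that[of "2 * M"] approximate_preimages_imp_preimages[OF T M0]) (use M0 in auto)
qed

section \<open>Compactness by finite nets\<close>

lemma compact_ops_finite_net:
  assumes K: "K \<in> compact_ops UNIV" and e: "e > 0"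
  obtains F where "finite F" "F \<subseteq> cball 0 1" "\<And>x. norm x \<le> 1 \<Longrightarrow> \<exists>y\<in>F. norm (K x - K y) < e"
proof -
  have "compact (closure (K ` cball 0 1))" using K by (simp add: compact_ops_def)
  moreover have "closure (K ` cball 0 1) \<subseteq> (\<Union>y\<in>cball 0 1. ball (K y) e)"
    using e by (auto simp: closure_approachable)
  ultimately obtain F where F: "F \<subseteq> cball 0 1" "finite F" "closure (K ` cball 0 1) \<subseteq> (\<Union>y\<in>F. ball (K y) e)"
    by (elim compactE_image) auto
  show thesis
  proof (rule that[OF F(2,1)])
    fix x :: 'a assume "norm x \<le> 1"
    then have "K x \<in> closure (K ` cball 0 1)" by (intro subsetD[OF closure_subset] imageI) simp
    then have "K x \<in> (\<Union>y\<in>F. ball (K y) e)" using F(3) by blast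
    then show "\<exists>y\<in>F. norm (K x - K y) < e" by (auto simp: dist_norm norm_minus_commute)
  qed
qed

lemma compact_opsI_finite_net:
  assumes S: "S \<in> bounded_ops UNIV"
    and net: "\<And>e. e > 0 \<Longrightarrow> \<exists>F. finite F \<and> (\<forall>x. norm x \<le> 1 \<longrightarrow> (\<exists>y\<in>F. norm (S x - y) < e))"
  shows "S \<in> compact_ops UNIV"
proof -
  have "compact (closure (S ` cball 0 1))"
    unfolding compact_eq_totally_bounded
  proof (intro conjI allI impI)
    show "complete (closure (S ` cball 0 1))" by (simp add: complete_eq_closed)
    fix e :: real assume e: "e > 0"
    then obtain F where F: "finite F" "\<And>x. norm x \<le> 1 \<Longrightarrow> \<exists>y\<in>F. norm (S x - y) < e / 2"
      using net[of "e / 2"] by auto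
    have "closure (S ` cball 0 1) \<subseteq> (\<Union>y\<in>F. cball y (e / 2))"
      using F by (intro closure_minimal closed_UN) (force simp: dist_norm norm_minus_commute intro: less_imp_le)+
    also have "\<dots> \<subseteq> (\<Union>y\<in>F. ball y e)" using e by auto
    finally show "\<exists>k. finite k \<and> closure (S ` cball 0 1) \<subseteq> (\<Union>x\<in>k. ball x e)" using F(1) by blast
  qed
  then show ?thesis using S by (simp add: compact_ops_def)
qed

text \<open>Applied to differences, the bound shows that points whose images under \<open>L\<close>
  are close have close images under \<open>S\<close>, so a net for \<open>L\<close> yields one for
  \<open>S\<close>.\<close>

lemma compact_ops_dominated:
  assumes S: "S \<in> bounded_ops UNIV" and L: "L \<in> compact_ops UNIV" and le: "\<And>x. norm (S x) \<le> C * norm (L x)"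
  shows "S \<in> compact_ops UNIV"
proof (rule compact_opsI_finite_net[OF S])
  fix e :: real assume e: "e > 0"
  let ?C = "\<bar>C\<bar> + 1"
  have "e / ?C > 0" using e by (simp add: add_nonneg_pos)
  then obtain F where F: "finite F" "\<And>x. norm x \<le> 1 \<Longrightarrow> \<exists>y\<in>F. norm (L x - L y) < e / ?C"
    by (rule compact_ops_finite_net[OF L]) blast
  have "norm (S x - S y) < e" if "norm (L x - L y) < e / ?C" for x y
  proof -
    have "norm (S x - S y) \<le> C * norm (L x - L y)"
      using le[of "x - y"] S compact_ops_imp_bounded_ops[OF L] by simp
    also have "\<dots> \<le> ?C * norm (L x - L y)" by (intro mult_right_mono) auto
    also have "\<dots> < e" using that by (simp add: field_simps add_nonneg_pos)
    finally show ?thesis .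
  qed
  then show "\<exists>F. finite F \<and> (\<forall>x. norm x \<le> 1 \<longrightarrow> (\<exists>y\<in>F. norm (S x - y) < e))"
    using F by (intro exI[of _ "S ` F"]) fastforce
qed

lemma bounded_ops_UNIV_add:
  "S \<in> bounded_ops UNIV \<Longrightarrow> T \<in> bounded_ops UNIV \<Longrightarrow> (\<lambda>x. S x + T x) \<in> bounded_ops UNIV"
  by (auto simp: bounded_ops_UNIV_iff scaleC_add_right intro: bounded_linear_add)

lemma bounded_ops_UNIV_diff:
  "S \<in> bounded_ops UNIV \<Longrightarrow> T \<in> bounded_ops UNIV \<Longrightarrow> (\<lambda>x. S x - T x) \<in> bounded_ops UNIV"
  by (auto simp: bounded_ops_UNIV_iff scaleC.diff_right intro: bounded_linear_sub)

lemma bounded_ops_UNIV_compose: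
  "S \<in> bounded_ops UNIV \<Longrightarrow> T \<in> bounded_ops UNIV \<Longrightarrow> (\<lambda>x. S (T x)) \<in> bounded_ops UNIV"
  by (auto simp: bounded_ops_UNIV_iff intro: bounded_linear_compose)

lemma bounded_ops_UNIV_ident: "(\<lambda>x. x) \<in> bounded_ops UNIV"
  by (simp add: bounded_ops_UNIV_iff)

lemma bounded_ops_UNIV_bound:
  assumes "S \<in> bounded_ops UNIV" shows "\<exists>C. C > 0 \<and> (\<forall>x. norm (S x) \<le> C * norm x)"
proof -
  obtain C where "norm (S x) \<le> norm x * C" "C > 0" for x
    using assms bounded_linear.pos_bounded[of S] by (auto simp: bounded_ops_UNIV_iff)
  then show ?thesis by (intro exI[of _ C]) (simp add: mult.commute)
qed

text \<open>Half of Atkinson's theorem. \<open>Q\<close> projects onto the kernel of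
  \<open>T\<close>, and subtracting \<open>E\<close> moves every vector into the range;
  \<open>S y\<close> is the unique preimage of \<open>y - E y\<close> that \<open>Q\<close>
  annihilates. Uniqueness makes \<open>S\<close> linear, and bounded preimages make it
  bounded.\<close>

lemma fredholm_imp_invertible_mod_compact:
  assumes T: "T \<in> fredholm_ops UNIV"
  obtains S where "S \<in> bounded_ops UNIV" "(\<lambda>x. S (T x) - x) \<in> compact_ops UNIV"
    "(\<lambda>x. T (S x) - x) \<in> compact_ops UNIV"
proof -
  have Tb: "T \<in> bounded_ops UNIV" and cl: "closed (range T)" and fin: "finite_dimensional {x. T x = 0}"
    using T by (auto simp: fredholm_ops_def)
  obtain B where B: "finite B" "\<forall>y. \<exists>x. y - T x \<in> cspan B" using T by (auto simp: fredholm_ops_def)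
  note Ts = bounded_ops_linear_simps[OF Tb]
  obtain B0 where B0: "finite B0" "{x. T x = 0} = cspan B0" using fin by (auto simp: finite_dimensional_def)
  obtain Q where Q: "Q \<in> compact_ops UNIV" "\<And>x. Q x \<in> cspan B0" "\<And>x. x \<in> cspan B0 \<Longrightarrow> Q x = x"
    by (rule finite_dimensional_compact_projection[OF B0(1)], rule that)
  have Qb: "Q \<in> bounded_ops UNIV" using Q(1) by (rule compact_ops_imp_bounded_ops)
  note Qs = bounded_ops_linear_simps[OF Qb]
  have TQ: "T (Q x) = 0" for x using Q(2)[of x] B0(2) by auto
  have QQ: "Q (Q x) = Q x" for x by (rule Q(3)[OF Q(2)])
  have Rsub: "csubspace (range T)" by (rule csubspace_image[OF Tb complex_vector.subspace_UNIV])
  have "add_span (range T) B = UNIV"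
  proof -
    have "y \<in> add_span (range T) B" for y
    proof -
      obtain x where "y - T x \<in> cspan B" using B(2) by blast
      then show ?thesis by (auto simp: add_span_def intro!: bexI[of _ "y - T x"])
    qed
    then show ?thesis by blast
  qed
  from finite_codimensional_compact_complement[OF B(1) Rsub cl this]
  obtain E where E: "E \<in> compact_ops UNIV" "\<And>x. x - E x \<in> range T" by auto
  have Eb: "E \<in> bounded_ops UNIV" using E(1) by (rule compact_ops_imp_bounded_ops)
  note Es = bounded_ops_linear_simps[OF Eb]
  obtain C where C: "C \<ge> 0" "\<And>y. y \<in> range T \<Longrightarrow> \<exists>x. T x = y \<and> norm x \<le> C * norm y"
    by (rule closed_range_bounded_preimages[OF Tb cl], rule that)
  from bounded_ops_UNIV_bound[OF Qb] obtain q where q0: "q > 0 \<and> (\<forall>x. norm (Q x) \<le> q * norm x)" ..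
  have q: "q > 0" "norm (Q x) \<le> q * norm x" for x using q0 by blast+
  have unique: "x = x'" if "T x = T x'" "Q x = Q x'" for x x'
  proof -
    have "T (x - x') = 0" using that(1) by (simp add: bounded_ops_diff[OF Tb])
    then have "x - x' \<in> cspan B0" unfolding B0(2)[symmetric] by simp
    then have "Q (x - x') = x - x'" by (rule Q(3))
    then show ?thesis using that(2) by (simp add: bounded_ops_diff[OF Qb])
  qed
  \<comment> \<open>On the kernel of \<open>Q\<close> the operator \<open>T\<close> is injective, so
    the preimage \<open>u\<close> of bounded norm becomes \<open>x\<close> itself after subtraction
    of \<open>Q u\<close>.\<close>
  have bound: "norm x \<le> (1 + q) * C * norm (T x)" if "Q x = 0" for x
  proof -
    obtain u where u: "T u = T x" "norm u \<le> C * norm (T x)" using C(2)[of "T x"] by blast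
    have "x = u - Q u" by (rule unique) (use u that QQ TQ Tb Qb in \<open>auto simp: Qs Ts\<close>)
    then have "norm x \<le> norm u + norm (Q u)" using norm_triangle_ineq4 by metis
    also have "\<dots> \<le> (1 + q) * norm u" using q(2)[of u] by (simp add: distrib_right)
    also have "\<dots> \<le> (1 + q) * (C * norm (T x))" using u(2) q(1) by (intro mult_left_mono) auto
    finally show ?thesis by (simp add: mult.assoc)
  qed
  have "\<forall>y. \<exists>x. T x = y - E y \<and> Q x = 0"
  proof
    fix y
    obtain x where "T x = y - E y" using E(2)[of y] by (metis imageE)
    then show "\<exists>x. T x = y - E y \<and> Q x = 0"
      using Tb Qb by (intro exI[of _ "x - Q x"]) (simp add: TQ QQ)
  qed
  from choice[OF this] obtain S where S: "\<And>y. T (S y) = y - E y" "\<And>y. Q (S y) = 0" by auto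
  have Sb: "S \<in> bounded_ops UNIV"
  proof -
    have E1: "(\<lambda>x. x - E x) \<in> bounded_ops UNIV" by (rule one_minus_bounded_ops[OF Eb])
    from bounded_ops_UNIV_bound[OF E1] obtain d where d0: "d > 0 \<and> (\<forall>x. norm (x - E x) \<le> d * norm x)" ..
    have d: "d > 0" "norm (x - E x) \<le> d * norm x" for x using d0 by blast+
    show ?thesis unfolding bounded_ops_iff
    proof (intro conjI ballI allI exI[of _ "(1 + q) * C * d"])
      show "S (x + y) = S x + S y" for x y
        by (rule unique) (simp_all add: Ts Qs S Es)
      show "S (c *\<^sub>C x) = c *\<^sub>C S x" for c x
        by (rule unique) (simp_all add: Ts Qs S Es scaleC.diff_right)
      show "norm (S x) \<le> (1 + q) * C * d * norm x" for x
      proof -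
        have "norm (S x) \<le> (1 + q) * C * norm (x - E x)" using bound[OF S(2)[of x]] by (simp add: S)
        also have "\<dots> \<le> (1 + q) * C * (d * norm x)" using d q C by (intro mult_left_mono) auto
        finally show ?thesis by (simp add: mult.assoc)
      qed
    qed auto
  qed
  have TS: "(\<lambda>x. T (S x) - x) \<in> compact_ops UNIV"
    using compact_ops_UNIV_minus[OF E(1)] by (simp add: S)
  \<comment> \<open>\<open>E\<close> need not vanish on the range of \<open>T\<close>, so
    \<open>?u\<close> need not be 0; but \<open>Q\<close> annihilates it and \<open>T\<close> maps
    it to \<open>- E (T x)\<close>, so it is dominated by a compact operator.\<close>
  let ?u = "\<lambda>x. (S (T x) - x) + Q x"
  have "?u \<in> compact_ops UNIV"
  proof (rule compact_ops_dominated)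
    show "?u \<in> bounded_ops UNIV"
      by (rule bounded_ops_UNIV_add[OF bounded_ops_UNIV_diff[OF bounded_ops_UNIV_compose[OF Sb Tb] bounded_ops_UNIV_ident] Qb])
    show "(\<lambda>x. E (T x)) \<in> compact_ops UNIV" by (rule compact_ops_UNIV_compose[OF E(1) Tb])
    show "norm (?u x) \<le> (1 + q) * C * norm (E (T x))" for x
    proof -
      have "Q (?u x) = 0" using Qb by (simp add: Qs S QQ)
      moreover have "T (?u x) = - E (T x)" using Tb by (simp add: Ts S TQ)
      ultimately show ?thesis using bound[of "?u x"] by simp
    qed
  qed
  from compact_ops_UNIV_diff[OF this Q(1)]
  have ST: "(\<lambda>x. S (T x) - x) \<in> compact_ops UNIV" by simp
  show thesis by (rule that[OF Sb ST TS])
qed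

text \<open>The other half of Atkinson's theorem. On the kernel of \<open>T\<close> the compact
  operator \<open>x - S (T x)\<close> is the identity. With \<open>K x = x - T (S x)\<close> the
  range \<open>R0\<close> of \<open>x - K x\<close> lies in the range of \<open>T\<close>, is closed
  and has finite codimension; hence the range of \<open>T\<close> is \<open>R0\<close> plus the span
  of finitely many vectors.\<close>

lemma invertible_mod_compact_imp_fredholm:
  assumes T: "T \<in> bounded_ops UNIV" and S: "S \<in> bounded_ops UNIV"
    and K1: "(\<lambda>x. S (T x) - x) \<in> compact_ops UNIV" and K2: "(\<lambda>x. T (S x) - x) \<in> compact_ops UNIV"
  shows "T \<in> fredholm_ops UNIV"
proof -
  note Ts = bounded_ops_linear_simps[OF T] and Ss = bounded_ops_linear_simps[OF S]
  have ker: "finite_dimensional {x. T x = 0}"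
  proof -
    have "csubspace {x. T x = 0}" by (rule complex_vector.subspaceI) (auto simp: Ts)
    then have "\<exists>B. finite B \<and> B \<subseteq> {x. T x = 0} \<and> {x. T x = 0} = add_span {0} B"
      by (intro compact_ops_finite_quotient[OF compact_ops_UNIV_minus[OF K1]] csubspace_0)
         (auto simp: Ts Ss)
    then show ?thesis by (simp add: finite_dimensional_def add_span_0)
  qed
  define K where "K x = x - T (S x)" for x
  have K: "K \<in> compact_ops UNIV" using compact_ops_UNIV_minus[OF K2] by (simp add: K_def[abs_def])
  have Kb: "K \<in> bounded_ops UNIV" using K by (rule compact_ops_imp_bounded_ops)
  note Ks = bounded_ops_linear_simps[OF Kb]
  have A: "(\<lambda>x. x - K x) \<in> bounded_ops UNIV" by (rule one_minus_bounded_ops[OF Kb])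
  define R0 where "R0 = range (\<lambda>x. x - K x)"
  have R0sub: "csubspace R0" unfolding R0_def by (rule csubspace_image[OF A complex_vector.subspace_UNIV])
  have R0T: "R0 \<subseteq> range T" by (auto simp: R0_def K_def)
  have R0closed: "closed R0"
  proof -
    \<comment> \<open>The operator \<open>x - K x\<close> is bounded below only after its kernel is
      split off; \<open>?M\<close> is a closed complement with the same image.\<close>
    obtain B0 where B0: "finite B0" "{x. K x = x} = cspan B0"
      using finite_dimensional_fixed_space[OF K] by (auto simp: finite_dimensional_def)
    obtain Q where Q: "Q \<in> compact_ops UNIV" "\<And>x. Q x \<in> cspan B0" "\<And>x. x \<in> cspan B0 \<Longrightarrow> Q x = x"
      by (rule finite_dimensional_compact_projection[OF B0(1)], rule that)
    have Qb: "Q \<in> bounded_ops UNIV" using Q(1) by (rule compact_ops_imp_bounded_ops)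
    note Qs = bounded_ops_linear_simps[OF Qb]
    let ?M = "{x. Q x = 0}"
    have Msub: "csubspace ?M" by (rule complex_vector.subspaceI) (auto simp: Qs)
    have "continuous_on UNIV Q" using Qb by (intro bounded_ops_continuous_on) auto
    then have Mcl: "closed ?M" by (intro closed_Collect_eq continuous_on_const)
    have "\<exists>d>0. \<forall>x\<in>?M. d * norm x \<le> norm (x - K x)"
    proof (rule one_minus_compact_bounded_below[OF K Mcl Msub])
      fix x assume "x \<in> ?M" "K x = x"
      then show "x = 0" using Q(3)[of x] B0(2) by auto
    qed
    then obtain d where "d > 0" "\<And>x. x \<in> ?M \<Longrightarrow> d * norm x \<le> norm (x - K x)" by blast
    then have "closed ((\<lambda>x. x - K x) ` ?M)" by (rule closed_image_bounded_below[OF A Mcl Msub])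
    moreover have "(\<lambda>x. x - K x) ` ?M = R0"
    proof (intro equalityI subsetI)
      fix y assume "y \<in> R0"
      then obtain x where x: "y = x - K x" by (auto simp: R0_def)
      have "K (Q x) = Q x" using Q(2)[of x] B0(2) by auto
      then have "y = (x - Q x) - K (x - Q x)" using Kb by (simp add: x)
      moreover have "x - Q x \<in> ?M" using Qb Q(3)[OF Q(2)] by simp
      ultimately show "y \<in> (\<lambda>x. x - K x) ` ?M" by blast
    qed (auto simp: R0_def)
    ultimately show ?thesis by simp
  qed
  have KR0: "K x - x \<in> R0" for x
  proof -
    have "(- x) - K (- x) \<in> R0" unfolding R0_def by (rule rangeI)
    then show ?thesis by (simp add: Ks)
  qed
  have Tsub: "csubspace (range T)" by (rule csubspace_image[OF T complex_vector.subspace_UNIV])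
  have cl: "closed (range T)"
  proof -
    obtain B where B: "finite B" "range T = add_span R0 B"
      using compact_ops_finite_quotient[OF K R0sub R0closed R0T Tsub KR0] by auto
    show ?thesis unfolding B(2) by (rule closed_add_span[OF R0sub R0closed B(1)])
  qed
  have coker: "\<exists>B. finite B \<and> (\<forall>y. \<exists>x. y - T x \<in> cspan B)"
  proof -
    obtain B where B: "finite B" "UNIV = add_span R0 B"
      using compact_ops_finite_quotient[OF K R0sub R0closed subset_UNIV complex_vector.subspace_UNIV KR0] by auto
    have "\<exists>x. y - T x \<in> cspan B" for y
    proof -
      have "y \<in> add_span R0 B" using B(2) by auto
      then obtain s where s: "s \<in> cspan B" "y - s \<in> R0" by (auto simp: add_span_def)
      then obtain x where "y - s = T x" using R0T by blast
      then have "y - T x = s" by (simp add: algebra_simps)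
      then show ?thesis using s(1) by auto
    qed
    then show ?thesis using B(1) by auto
  qed
  show ?thesis using T cl ker coker by (simp add: fredholm_ops_def)
qed

section \<open>The Banach algebra of bounded operators as a type\<close>

typedef (overloaded) 'a bop = "bounded_ops (UNIV :: 'a::complex_banach set)"
  morphisms apply_bop Bop
  using bounded_ops_UNIV_ident by blast

setup_lifting type_definition_bop

lemma bounded_ops_onorm:
  assumes "S \<in> bounded_ops UNIV" shows "norm (S x) \<le> onorm S * norm x"
  using assms by (intro onorm) (simp add: bounded_ops_UNIV_iff)

lemma bounded_ops_scaleC: "S \<in> bounded_ops UNIV \<Longrightarrow> (\<lambda>x. c *\<^sub>C S x) \<in> bounded_ops UNIV"
  by (auto simp: bounded_ops_UNIV_iff scaleC_scaleC mult.commute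
      intro: bounded_linear_compose[OF scaleC.bounded_linear_right])

lemma bounded_ops_scaleR: "S \<in> bounded_ops UNIV \<Longrightarrow> (\<lambda>x. r *\<^sub>R S x) \<in> bounded_ops UNIV"
  unfolding scaleR_scaleC by (rule bounded_ops_scaleC)

lemma bounded_ops_uminus: "S \<in> bounded_ops UNIV \<Longrightarrow> (\<lambda>x. - S x) \<in> bounded_ops UNIV"
  by (auto simp: bounded_ops_UNIV_iff scaleC.minus_right intro: bounded_linear_minus)

lemma bounded_ops_const_zero: "(\<lambda>x. 0) \<in> bounded_ops UNIV"
  by (simp add: bounded_ops_UNIV_iff)

instantiation bop :: (complex_banach) real_normed_algebra
begin

lift_definition zero_bop :: "'a bop" is "\<lambda>x. 0" by (rule bounded_ops_const_zero)
lift_definition plus_bop :: "'a bop \<Rightarrow> 'a bop \<Rightarrow> 'a bop" is "\<lambda>S T x. S x + T x" by (rule bounded_ops_UNIV_add)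
lift_definition minus_bop :: "'a bop \<Rightarrow> 'a bop \<Rightarrow> 'a bop" is "\<lambda>S T x. S x - T x" by (rule bounded_ops_UNIV_diff)
lift_definition uminus_bop :: "'a bop \<Rightarrow> 'a bop" is "\<lambda>S x. - S x" by (rule bounded_ops_uminus)
lift_definition times_bop :: "'a bop \<Rightarrow> 'a bop \<Rightarrow> 'a bop" is "\<lambda>S T x. S (T x)" by (rule bounded_ops_UNIV_compose)
lift_definition scaleR_bop :: "real \<Rightarrow> 'a bop \<Rightarrow> 'a bop" is "\<lambda>r S x. r *\<^sub>R S x" by (rule bounded_ops_scaleR)
lift_definition norm_bop :: "'a bop \<Rightarrow> real" is onorm .

definition dist_bop :: "'a bop \<Rightarrow> 'a bop \<Rightarrow> real" where "dist_bop S T = norm (S - T)"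
definition sgn_bop :: "'a bop \<Rightarrow> 'a bop" where "sgn_bop S = inverse (norm S) *\<^sub>R S"
definition uniformity_bop :: "('a bop \<times> 'a bop) filter" where
  "uniformity_bop = (INF e\<in>{0 <..}. principal {(x, y). dist x y < e})"
definition open_bop :: "'a bop set \<Rightarrow> bool" where
  "open_bop S = (\<forall>x\<in>S. \<forall>\<^sub>F (x', y) in uniformity. x' = x \<longrightarrow> y \<in> S)"

instance
proof
  fix S T U :: "'a bop" and r s :: real
  show "S + T + U = S + (T + U)" by transfer (simp add: add.assoc)
  show "S + T = T + S" by transfer (simp add: add.commute)
  show "0 + S = S" by transfer simp
  show "- S + S = 0" by transfer simp
  show "S - T = S + - T" by transfer simp
  show "r *\<^sub>R (S + T) = r *\<^sub>R S + r *\<^sub>R T" by transfer (simp add: scaleR_add_right)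
  show "(r + s) *\<^sub>R S = r *\<^sub>R S + s *\<^sub>R S" by transfer (simp add: scaleR_add_left)
  show "r *\<^sub>R s *\<^sub>R S = (r * s) *\<^sub>R S" by transfer simp
  show "1 *\<^sub>R S = S" by transfer simp
  show "S * T * U = S * (T * U)" by transfer simp
  show "(S + T) * U = S * U + T * U" by transfer simp
  show "S * (T + U) = S * T + S * U" by transfer (auto simp: bounded_ops_UNIV_iff linear_simps)
  show "r *\<^sub>R S * T = r *\<^sub>R (S * T)" by transfer simp
  show "S * r *\<^sub>R T = r *\<^sub>R (S * T)" by transfer (auto simp: bounded_ops_UNIV_iff linear_simps)
  show "dist S T = norm (S - T)" by (rule dist_bop_def)
  show "sgn S = inverse (norm S) *\<^sub>R S" by (rule sgn_bop_def)
  show "uniformity = (INF e\<in>{0 <..}. principal {(x :: 'a bop, y). dist x y < e})"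
    by (rule uniformity_bop_def)
  show "open V = (\<forall>x\<in>V. \<forall>\<^sub>F (x', y) in uniformity. x' = x \<longrightarrow> y \<in> V)" for V :: "'a bop set"
    by (rule open_bop_def)
  show "(norm S = 0) = (S = 0)"
    by transfer (auto simp: bounded_ops_UNIV_iff onorm_eq_0)
  show "norm (S + T) \<le> norm S + norm T"
    by transfer (auto simp: bounded_ops_UNIV_iff intro: onorm_triangle)
  show "norm (r *\<^sub>R S) = \<bar>r\<bar> * norm S"
    by transfer (auto simp: bounded_ops_UNIV_iff intro: onorm_scaleR)
  show "norm (S * T) \<le> norm S * norm T"
    using onorm_compose[of "apply_bop S" "apply_bop T"] apply_bop[of S] apply_bop[of T]
    by (simp add: norm_bop.rep_eq times_bop.rep_eq bounded_ops_UNIV_iff o_def)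
qed

end

lemma norm_apply_bop: "norm (apply_bop S x) \<le> norm S * norm x"
  by transfer (rule bounded_ops_onorm)

lemma norm_bop_le:
  assumes "0 \<le> b" "\<And>x. norm (apply_bop S x) \<le> b * norm x" shows "norm S \<le> b"
  using assms unfolding norm_bop.rep_eq by (rule onorm_bound)

lemma apply_bop_bounded: "apply_bop S \<in> bounded_ops UNIV" by (rule apply_bop)

instance bop :: (complex_banach) complete_space
proof
  fix X :: "nat \<Rightarrow> 'a bop" assume X: "Cauchy X"
  have diff: "apply_bop (X m) x - apply_bop (X n) x = apply_bop (X m - X n) x" for m n x
    by (simp add: minus_bop.rep_eq)
  have ptw: "norm (apply_bop (X m) x - apply_bop (X n) x) \<le> norm (X m - X n) * norm x" for m n x
    unfolding diff by (rule norm_apply_bop)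
  have "Cauchy (\<lambda>n. apply_bop (X n) x)" for x
  proof (rule metric_CauchyI)
    fix e :: real assume "e > 0"
    then have "e / (norm x + 1) > 0" by (simp add: add_nonneg_pos)
    from metric_CauchyD[OF X this] obtain N
      where N: "\<And>m n. m \<ge> N \<Longrightarrow> n \<ge> N \<Longrightarrow> norm (X m - X n) < e / (norm x + 1)"
      by (auto simp: dist_norm)
    have "dist (apply_bop (X m) x) (apply_bop (X n) x) < e" if mn: "m \<ge> N" "n \<ge> N" for m n
    proof -
      have "norm (X m - X n) * norm x \<le> norm (X m - X n) * (norm x + 1)"
        by (intro mult_left_mono) auto
      also have "\<dots> < e" using N[OF mn] by (simp add: less_divide_eq add_nonneg_pos)
      finally show ?thesis using ptw[of m x n] by (simp add: dist_norm)
    qed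
    then show "\<exists>M. \<forall>m\<ge>M. \<forall>n\<ge>M. dist (apply_bop (X m) x) (apply_bop (X n) x) < e" by blast
  qed
  then have "\<forall>x. \<exists>l. (\<lambda>n. apply_bop (X n) x) \<longlonglongrightarrow> l"
    using Cauchy_convergent_iff convergent_def by blast
  from choice[OF this] obtain L where L: "\<And>x. (\<lambda>n. apply_bop (X n) x) \<longlonglongrightarrow> L x" by auto
  note Xs = bounded_ops_linear_simps[OF apply_bop_bounded]
  obtain B where "\<forall>n. norm (X n) \<le> B"
    using Cauchy_Bseq[OF X] unfolding Bseq_def by (elim exE conjE)
  then have B: "norm (X n) \<le> B" for n by simp
  have "L \<in> bounded_ops UNIV" unfolding bounded_ops_iff
  proof (intro conjI ballI allI exI[of _ B])
    show "L (x + y) = L x + L y" for x y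
      using tendsto_add[OF L[of x] L[of y]] L[of "x + y"] by (simp add: Xs LIMSEQ_unique)
    show "L (c *\<^sub>C x) = c *\<^sub>C L x" for c x
      using tendsto_scaleC[OF tendsto_const[of c] L[of x]] L[of "c *\<^sub>C x"] by (simp add: Xs LIMSEQ_unique)
    show "norm (L x) \<le> B * norm x" for x
    proof (rule LIMSEQ_le_const2[OF tendsto_norm[OF L]])
      show "\<exists>N. \<forall>n\<ge>N. norm (apply_bop (X n) x) \<le> B * norm x"
        using order_trans[OF norm_apply_bop mult_right_mono[OF B norm_ge_zero]] by blast
    qed
  qed auto
  then obtain S where S: "apply_bop S = L" by (metis Bop_inverse)
  have "X \<longlonglongrightarrow> S"
  proof (rule metric_LIMSEQ_I)
    fix e :: real assume e: "e > 0"
    from metric_CauchyD[OF X half_gt_zero[OF this]] obtain N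
      where N: "\<And>m n. m \<ge> N \<Longrightarrow> n \<ge> N \<Longrightarrow> norm (X m - X n) < e / 2"
      by (auto simp: dist_norm)
    have "norm (X n - S) \<le> e / 2" if n: "n \<ge> N" for n
    proof (rule norm_bop_le)
      fix x
      have lim: "(\<lambda>m. norm (apply_bop (X n) x - apply_bop (X m) x)) \<longlonglongrightarrow> norm (apply_bop (X n - S) x)"
        unfolding minus_bop.rep_eq S by (intro tendsto_intros L)
      show "norm (apply_bop (X n - S) x) \<le> e / 2 * norm x"
      proof (rule LIMSEQ_le_const2[OF lim], intro exI[of _ N] allI impI)
        fix m assume m: "m \<ge> N"
        show "norm (apply_bop (X n) x - apply_bop (X m) x) \<le> e / 2 * norm x"
          by (rule order_trans[OF ptw mult_right_mono]) (use N[OF n m] in auto)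
      qed
    qed (use e in simp)
    then show "\<exists>no. \<forall>n\<ge>no. dist (X n) S < e"
      using e by (intro exI[of _ N]) (force simp: dist_norm)
  qed
  then show "convergent X" by (auto simp: convergent_def)
qed

instantiation bop :: (complex_banach) complex_banach_algebra
begin

lift_definition scaleC_bop :: "complex \<Rightarrow> 'a bop \<Rightarrow> 'a bop" is "\<lambda>c S x. c *\<^sub>C S x" by (rule bounded_ops_scaleC)
lift_definition one_bop :: "'a bop" is "\<lambda>x. x" by (rule bounded_ops_UNIV_ident)

instance
proof
  fix S T :: "'a bop" and c d :: complex and r :: real
  show "c *\<^sub>C (S + T) = c *\<^sub>C S + c *\<^sub>C T" by transfer (simp add: scaleC_add_right)
  show "(c + d) *\<^sub>C S = c *\<^sub>C S + d *\<^sub>C S" by transfer (simp add: scaleC_add_left)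
  show "c *\<^sub>C d *\<^sub>C S = (c * d) *\<^sub>C S" by transfer (simp add: scaleC_scaleC)
  show "1 *\<^sub>C S = S" by transfer (simp add: scaleC_one)
  show "r *\<^sub>R S = complex_of_real r *\<^sub>C S" by transfer (simp add: scaleR_scaleC)
  show "c *\<^sub>C S * T = c *\<^sub>C (S * T)" by transfer simp
  show "S * c *\<^sub>C T = c *\<^sub>C (S * T)" by transfer (simp add: bounded_ops_linear_simps)
  show "1 * S = S" by transfer simp
  show "S * 1 = S" by transfer simp
  have le: "norm (c *\<^sub>C S) \<le> cmod c * norm S" for c and S :: "'a bop"
  proof (rule norm_bop_le)
    show "norm (apply_bop (c *\<^sub>C S) x) \<le> cmod c * norm S * norm x" for x
      using mult_left_mono[OF norm_apply_bop[of S x], of "cmod c"]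
      by (simp add: scaleC_bop.rep_eq norm_scaleC mult.assoc)
  qed simp
  show "norm (c *\<^sub>C S) = cmod c * norm S"
  proof (cases "c = 0")
    case True
    have "0 *\<^sub>C S = 0" by transfer simp
    then show ?thesis using True by simp
  next
    case False
    have "S = inverse c *\<^sub>C (c *\<^sub>C S)" using False by transfer (simp add: scaleC_scaleC scaleC_one)
    then have "norm S \<le> cmod (inverse c) * norm (c *\<^sub>C S)" using le[of "inverse c" "c *\<^sub>C S"] by simp
    then have "cmod c * norm S \<le> norm (c *\<^sub>C S)" using False by (simp add: norm_divide field_simps)
    then show ?thesis using le[of c S] by simp
  qed
qed

end

section \<open>The Calkin algebra as a type\<close>

lift_definition compact_bop :: "'a::complex_banach bop \<Rightarrow> bool" is "\<lambda>S. S \<in> compact_ops UNIV" .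

lemma compact_bop_add: "compact_bop S \<Longrightarrow> compact_bop T \<Longrightarrow> compact_bop (S + T)"
  by transfer (rule compact_ops_UNIV_add)

lemma compact_bop_diff: "compact_bop S \<Longrightarrow> compact_bop T \<Longrightarrow> compact_bop (S - T)"
  by transfer (rule compact_ops_UNIV_diff)

lemma compact_bop_scaleC: "compact_bop S \<Longrightarrow> compact_bop (c *\<^sub>C S)"
  by transfer (rule compact_ops_UNIV_scale)

lemma compact_bop_mult: "compact_bop S \<Longrightarrow> compact_bop (T * S)" "compact_bop S \<Longrightarrow> compact_bop (S * T)"
  by (transfer, simp add: compact_ops_UNIV_compose)+

lemma compact_bop_0: "compact_bop 0"
  by transfer (rule compact_ops_zero)

lemma compact_bop_uminus: "compact_bop S \<Longrightarrow> compact_bop (- S)"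
  by transfer (rule compact_ops_UNIV_minus)

text \<open>A net for a nearby \<open>X n\<close> serves for \<open>S\<close> as well. Closedness of
  the ideal is what makes the quotient seminorm a norm.\<close>

lemma compact_bop_closed:
  assumes "\<And>n::nat. compact_bop (X n)" "X \<longlonglongrightarrow> S" shows "compact_bop S"
  unfolding compact_bop.rep_eq
proof (rule compact_opsI_finite_net[OF apply_bop_bounded])
  fix e :: real assume e: "e > 0"
  then have "e / 3 > 0" by simp
  from metric_LIMSEQ_D[OF assms(2) this] obtain n where n: "norm (S - X n) < e / 3"
    by (auto simp: dist_norm norm_minus_commute)
  have "apply_bop (X n) \<in> compact_ops UNIV" using assms(1)[of n] by (simp add: compact_bop.rep_eq)
  from compact_ops_finite_net[OF this \<open>e / 3 > 0\<close>]
  obtain F where F: "finite F" "F \<subseteq> cball 0 1"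
    "\<And>x. norm x \<le> 1 \<Longrightarrow> \<exists>y\<in>F. norm (apply_bop (X n) x - apply_bop (X n) y) < e / 3" by metis
  have near: "norm (apply_bop S x - apply_bop (X n) x) \<le> e / 3" if x: "norm x \<le> 1" for x
  proof -
    have "norm (apply_bop S x - apply_bop (X n) x) \<le> norm (S - X n) * norm x"
      using norm_apply_bop[of "S - X n" x] by (simp add: minus_bop.rep_eq)
    also have "\<dots> \<le> norm (S - X n) * 1" using x by (intro mult_left_mono) auto
    finally show ?thesis using n by simp
  qed
  have "\<exists>z\<in>apply_bop (X n) ` F. norm (apply_bop S x - z) < e" if x: "norm x \<le> 1" for x
  proof -
    obtain y where y: "y \<in> F" "norm (apply_bop (X n) x - apply_bop (X n) y) < e / 3" using F(3)[OF x] by blast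
    have "norm (apply_bop S x - apply_bop (X n) y) \<le>
        norm (apply_bop S x - apply_bop (X n) x) + norm (apply_bop (X n) x - apply_bop (X n) y)"
      using norm_triangle_ineq[of "apply_bop S x - apply_bop (X n) x" "apply_bop (X n) x - apply_bop (X n) y"] by simp
    also have "\<dots> < e" using near[OF x] y(2) e by simp
    finally show ?thesis using y(1) by blast
  qed
  then show "\<exists>F. finite F \<and> (\<forall>x. norm x \<le> 1 \<longrightarrow> (\<exists>y\<in>F. norm (apply_bop S x - y) < e))"
    using F(1) by (intro exI[of _ "apply_bop (X n) ` F"]) auto
qed

quotient_type (overloaded) 'a calkin = "'a::complex_banach bop" / "\<lambda>S T. compact_bop (S - T)"
  morphisms rep_calkin calkin_class
proof (rule equivpI)
  show "reflp (\<lambda>S T :: 'a bop. compact_bop (S - T))" by (rule reflpI) (simp add: compact_bop_0)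
  show "symp (\<lambda>S T :: 'a bop. compact_bop (S - T))"
    by (rule sympI) (use compact_bop_uminus in fastforce)
  show "transp (\<lambda>S T :: 'a bop. compact_bop (S - T))"
    by (rule transpI) (use compact_bop_add in fastforce)
qed

lemma calkin_class_eq_iff: "calkin_class S = calkin_class T \<longleftrightarrow> compact_bop (S - T)"
  using calkin.abs_eq_iff by auto

lemma calkin_class_surj: "\<exists>S. x = calkin_class S"
  by (induction x rule: calkin.abs_induct) auto

instantiation calkin :: (complex_banach) real_normed_algebra
begin

lift_definition zero_calkin :: "'a calkin" is 0 .
lift_definition plus_calkin :: "'a calkin \<Rightarrow> 'a calkin \<Rightarrow> 'a calkin" is "(+)"
proof -
  fix S S' T T' :: "'a bop"
  assume "compact_bop (S - S')" "compact_bop (T - T')"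
  from compact_bop_add[OF this] show "compact_bop (S + T - (S' + T'))" by (simp add: algebra_simps)
qed
lift_definition minus_calkin :: "'a calkin \<Rightarrow> 'a calkin \<Rightarrow> 'a calkin" is "(-)"
proof -
  fix S S' T T' :: "'a bop"
  assume "compact_bop (S - S')" "compact_bop (T - T')"
  from compact_bop_diff[OF this] show "compact_bop (S - T - (S' - T'))" by (simp add: algebra_simps)
qed
lift_definition uminus_calkin :: "'a calkin \<Rightarrow> 'a calkin" is uminus
proof -
  fix S S' :: "'a bop"
  assume "compact_bop (S - S')"
  from compact_bop_uminus[OF this] show "compact_bop (- S - - S')" by (simp add: algebra_simps)
qed
lift_definition times_calkin :: "'a calkin \<Rightarrow> 'a calkin \<Rightarrow> 'a calkin" is "(*)"
proof -
  fix S S' T T' :: "'a bop"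
  assume *: "compact_bop (S - S')" "compact_bop (T - T')"
  have "compact_bop ((S - S') * T + S' * (T - T'))" by (intro compact_bop_add compact_bop_mult *)
  then show "compact_bop (S * T - S' * T')" by (simp add: algebra_simps)
qed
lift_definition scaleR_calkin :: "real \<Rightarrow> 'a calkin \<Rightarrow> 'a calkin" is scaleR
proof -
  fix r :: real and S S' :: "'a bop"
  assume "compact_bop (S - S')"
  from compact_bop_scaleC[OF this, of "of_real r"] show "compact_bop (r *\<^sub>R S - r *\<^sub>R S')"
    by (simp add: scaleR_scaleC scaleC.diff_right)
qed

definition norm_calkin :: "'a calkin \<Rightarrow> real" where "norm_calkin x = (INF S\<in>{S. calkin_class S = x}. norm S)"
definition dist_calkin :: "'a calkin \<Rightarrow> 'a calkin \<Rightarrow> real" where "dist_calkin x y = norm (x - y)"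
definition sgn_calkin :: "'a calkin \<Rightarrow> 'a calkin" where "sgn_calkin x = inverse (norm x) *\<^sub>R x"
definition uniformity_calkin :: "('a calkin \<times> 'a calkin) filter" where
  "uniformity_calkin = (INF e\<in>{0 <..}. principal {(x, y). dist x y < e})"
definition open_calkin :: "'a calkin set \<Rightarrow> bool" where
  "open_calkin S = (\<forall>x\<in>S. \<forall>\<^sub>F (x', y) in uniformity. x' = x \<longrightarrow> y \<in> S)"

lemma norm_calkin_class_le: "norm (calkin_class S) \<le> norm S"
  unfolding norm_calkin_def by (rule cINF_lower) (auto intro!: bdd_belowI2[of _ 0])

lemma norm_calkin_lift:
  fixes x :: "'a calkin"
  assumes "e > 0" shows "\<exists>S. x = calkin_class S \<and> norm S < norm x + e"
proof (rule ccontr)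
  assume no: "\<nexists>S. x = calkin_class S \<and> norm S < norm x + e"
  have "norm x + e \<le> (INF S\<in>{S. calkin_class S = x}. norm S)"
  proof (rule cINF_greatest)
    show "{S. calkin_class S = x} \<noteq> {}" using calkin_class_surj[of x] by auto
    show "norm x + e \<le> norm S" if "S \<in> {S. calkin_class S = x}" for S using no that by force
  qed
  then show False using assms by (simp add: norm_calkin_def)
qed

lemma norm_calkin_leI:
  fixes x :: "'a calkin"
  assumes "\<And>e. e > 0 \<Longrightarrow> \<exists>S. x = calkin_class S \<and> norm S \<le> b + e" shows "norm x \<le> b"
proof (rule field_le_epsilon)
  fix e :: real assume "e > 0"
  then obtain S where "x = calkin_class S" "norm S \<le> b + e" using assms by blast
  then show "norm x \<le> b + e" using norm_calkin_class_le[of S] by simp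
qed

lemma norm_calkin_nonneg: "0 \<le> norm (x :: 'a calkin)"
  unfolding norm_calkin_def by (rule cINF_greatest) (use calkin_class_surj[of x] in auto)

instance
proof
  fix x y z :: "'a calkin" and r s :: real
  have *: "compact_bop S" if "S = 0" for S :: "'a bop" using that by (simp add: compact_bop_0)
  show "x + y + z = x + (y + z)" by transfer (rule *, simp add: algebra_simps)
  show "x + y = y + x" by transfer (rule *, simp add: algebra_simps)
  show "0 + x = x" by transfer (rule *, simp add: algebra_simps)
  show "- x + x = 0" by transfer (rule *, simp add: algebra_simps)
  show "x - y = x + - y" by transfer (rule *, simp add: algebra_simps)
  show "r *\<^sub>R (x + y) = r *\<^sub>R x + r *\<^sub>R y" by transfer (rule *, simp add: scaleR_add_right)
  show "(r + s) *\<^sub>R x = r *\<^sub>R x + s *\<^sub>R x" by transfer (rule *, simp add: scaleR_add_left)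
  show "r *\<^sub>R s *\<^sub>R x = (r * s) *\<^sub>R x" by transfer (rule *, simp)
  show "1 *\<^sub>R x = x" by transfer (rule *, simp)
  show "x * y * z = x * (y * z)" by transfer (rule *, simp add: mult.assoc)
  show "(x + y) * z = x * z + y * z" by transfer (rule *, simp add: distrib_right)
  show "x * (y + z) = x * y + x * z" by transfer (rule *, simp add: distrib_left)
  show "r *\<^sub>R x * y = r *\<^sub>R (x * y)" by transfer (rule *, simp)
  show "x * r *\<^sub>R y = r *\<^sub>R (x * y)" by transfer (rule *, simp)
  show "dist x y = norm (x - y)" by (rule dist_calkin_def)
  show "sgn x = inverse (norm x) *\<^sub>R x" by (rule sgn_calkin_def)
  show "uniformity = (INF e\<in>{0 <..}. principal {(x :: 'a calkin, y). dist x y < e})"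
    by (rule uniformity_calkin_def)
  show "open V = (\<forall>x\<in>V. \<forall>\<^sub>F (x', y) in uniformity. x' = x \<longrightarrow> y \<in> V)" for V :: "'a calkin set"
    by (rule open_calkin_def)
  show "(norm x = 0) = (x = 0)"
  proof
    assume "x = 0"
    then have "x = calkin_class 0" by (simp add: zero_calkin.abs_eq)
    then have "norm x \<le> 0" using norm_calkin_class_le[of 0] by simp
    then show "norm x = 0" using norm_calkin_nonneg[of x] by simp
  next
    assume n0: "norm x = 0"
    \<comment> \<open>The representatives \<open>S n\<close> tend to 0 while all differences
      \<open>S 0 - S n\<close> are compact, so \<open>S 0\<close> is a limit of compact
      operators.\<close>
    have "\<exists>S. x = calkin_class S \<and> norm S < inverse (real (Suc n))" for n
      using norm_calkin_lift[of "inverse (real (Suc n))" x] n0 by simp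
    then have "\<forall>n. \<exists>S. x = calkin_class S \<and> norm S < inverse (real (Suc n))" ..
    from choice[OF this] obtain S where S: "\<And>n. x = calkin_class (S n)" "\<And>n. norm (S n) < inverse (real (Suc n))"
      by blast
    have "S \<longlonglongrightarrow> 0"
      by (rule Lim_null_comparison[OF always_eventually LIMSEQ_inverse_real_of_nat])
         (use S(2) in \<open>auto intro: less_imp_le simp del: of_nat_Suc\<close>)
    then have lim: "(\<lambda>n. S 0 - S n) \<longlonglongrightarrow> S 0 - 0" by (intro tendsto_diff tendsto_const)
    have "compact_bop (S 0 - S n)" for n
      using S(1)[of 0] S(1)[of n] calkin_class_eq_iff by metis
    from compact_bop_closed[OF this lim] have "compact_bop (S 0 - 0)" .
    then show "x = 0" using S(1)[of 0] by (simp add: zero_calkin.abs_eq calkin_class_eq_iff)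
  qed
  show "norm (x + y) \<le> norm x + norm y"
  proof (rule norm_calkin_leI)
    fix e :: real assume "e > 0"
    then have e: "e / 2 > 0" by simp
    obtain S where S: "x = calkin_class S" "norm S < norm x + e / 2" using norm_calkin_lift[OF e] by blast
    obtain T where T: "y = calkin_class T" "norm T < norm y + e / 2" using norm_calkin_lift[OF e] by blast
    have "x + y = calkin_class (S + T)" by (simp add: S T plus_calkin.abs_eq)
    moreover have "norm (S + T) \<le> norm x + norm y + e" using norm_triangle_ineq[of S T] S(2) T(2) by linarith
    ultimately show "\<exists>S. x + y = calkin_class S \<and> norm S \<le> norm x + norm y + e" by blast
  qed
  have le: "norm (r *\<^sub>R x) \<le> \<bar>r\<bar> * norm x" for r and x :: "'a calkin"
  proof (rule norm_calkin_leI)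
    fix e :: real assume e: "e > 0"
    then have "e / (\<bar>r\<bar> + 1) > 0" by (simp add: add_nonneg_pos)
    then obtain S where S: "x = calkin_class S" "norm S < norm x + e / (\<bar>r\<bar> + 1)" using norm_calkin_lift by blast
    have "r *\<^sub>R x = calkin_class (r *\<^sub>R S)" by (simp add: S scaleR_calkin.abs_eq)
    moreover have "norm (r *\<^sub>R S) \<le> \<bar>r\<bar> * norm x + e"
    proof -
      have "norm (r *\<^sub>R S) \<le> \<bar>r\<bar> * (norm x + e / (\<bar>r\<bar> + 1))" using S(2) by (simp add: mult_left_mono)
      also have "\<dots> \<le> \<bar>r\<bar> * norm x + e" using e by (simp add: distrib_left divide_le_eq add_nonneg_pos)
      finally show ?thesis .
    qed
    ultimately show "\<exists>S. r *\<^sub>R x = calkin_class S \<and> norm S \<le> \<bar>r\<bar> * norm x + e" by blast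
  qed
  show "norm (r *\<^sub>R x) = \<bar>r\<bar> * norm x"
  proof (cases "r = 0")
    case True
    then show ?thesis using le[of r x] norm_calkin_nonneg[of "r *\<^sub>R x"] by simp
  next
    case False
    have "x = inverse r *\<^sub>R (r *\<^sub>R x)" using False by transfer (simp add: compact_bop_0)
    then have "norm x \<le> \<bar>inverse r\<bar> * norm (r *\<^sub>R x)" using le[of "inverse r" "r *\<^sub>R x"] by simp
    then have "\<bar>r\<bar> * norm x \<le> norm (r *\<^sub>R x)" using False by (simp add: field_simps)
    then show ?thesis using le[of r x] by simp
  qed
  show "norm (x * y) \<le> norm x * norm y"
  proof -
    \<comment> \<open>The infima need not be attained; the slack \<open>e\<close> enters
      quadratically and is removed by a limit.\<close>
    have "norm (x * y) \<le> (norm x + e) * (norm y + e)" if e: "e > 0" for e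
    proof -
      obtain S where S: "x = calkin_class S" "norm S < norm x + e" using norm_calkin_lift[OF e] by blast
      obtain T where T: "y = calkin_class T" "norm T < norm y + e" using norm_calkin_lift[OF e] by blast
      have "norm (x * y) \<le> norm (S * T)"
        using norm_calkin_class_le[of "S * T"] by (simp add: S T times_calkin.abs_eq)
      also have "\<dots> \<le> norm S * norm T" by (rule norm_mult_ineq)
      also have "\<dots> \<le> (norm x + e) * (norm y + e)"
        using S(2) T(2) norm_calkin_nonneg[of x] e by (intro mult_mono) auto
      finally show ?thesis .
    qed
    then have "eventually (\<lambda>e. norm (x * y) \<le> (norm x + e) * (norm y + e)) (at_right 0)"
      using eventually_at_right_less[of "0::real"] by (auto elim: eventually_mono)
    moreover have "((\<lambda>e. (norm x + e) * (norm y + e)) \<longlongrightarrow> (norm x + 0) * (norm y + 0)) (at_right 0)"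
      by (intro tendsto_intros)
    ultimately have "norm (x * y) \<le> (norm x + 0) * (norm y + 0)"
      by (intro tendsto_lowerbound[where F = "at_right 0"]) auto
    then show ?thesis by simp
  qed
qed

end

lemma calkin_class_simps:
  "calkin_class 0 = 0" "calkin_class (S + T) = calkin_class S + calkin_class T"
  "calkin_class (S - T) = calkin_class S - calkin_class T"
  "calkin_class (S * T) = calkin_class S * calkin_class T"
  "calkin_class (r *\<^sub>R S) = r *\<^sub>R calkin_class S"
  by (simp_all add: zero_calkin.abs_eq plus_calkin.abs_eq minus_calkin.abs_eq times_calkin.abs_eq scaleR_calkin.abs_eq)

lemma bounded_linear_calkin_class: "bounded_linear calkin_class"
  by (rule bounded_linear_intro[where K = 1]) (simp_all add: calkin_class_simps norm_calkin_class_le)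

text \<open>Reduces completeness of a quotient to absolutely convergent series, which can be lifted
  term by term. The index \<open>r k\<close> is the largest of the first thresholds, so it is
  admissible for every \<open>j \<le> k\<close> at once.\<close>

lemma Cauchy_convergent_if_geometric_subseq:
  fixes X :: "nat \<Rightarrow> 'a::metric_space"
  assumes X: "Cauchy X"
    and conv: "\<And>r. (\<And>k. dist (X (r (Suc k))) (X (r k)) < (1/2) ^ k) \<Longrightarrow> \<exists>l. (\<lambda>k. X (r k)) \<longlonglongrightarrow> l"
  shows "convergent X"
proof -
  have "\<exists>N. \<forall>m\<ge>N. \<forall>n\<ge>N. dist (X m) (X n) < (1/2) ^ k" for k
    using metric_CauchyD[OF X, of "(1/2) ^ k"] by simp
  then have "\<forall>k. \<exists>N. \<forall>m\<ge>N. \<forall>n\<ge>N. dist (X m) (X n) < (1/2) ^ k" ..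
  from choice[OF this] obtain N where N0: "\<forall>k. \<forall>m\<ge>N k. \<forall>n\<ge>N k. dist (X m) (X n) < (1/2) ^ k" ..
  have N: "dist (X m) (X n) < (1/2) ^ k" if "m \<ge> N k" "n \<ge> N k" for k m n
    using N0 that by simp
  define r where "r k = Max (N ` {..k})" for k
  have r: "N j \<le> r k" if "j \<le> k" for j k unfolding r_def using that by (intro Max_ge) auto
  have "dist (X (r (Suc k))) (X (r k)) < (1/2) ^ k" for k by (intro N r) auto
  from conv[OF this] obtain l where l: "(\<lambda>k. X (r k)) \<longlonglongrightarrow> l" ..
  have "X \<longlonglongrightarrow> l"
  proof (rule metric_LIMSEQ_I)
    fix e :: real assume e: "e > 0"
    obtain k0 where k0: "\<And>k. k \<ge> k0 \<Longrightarrow> dist (X (r k)) l < e / 2"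
      using metric_LIMSEQ_D[OF l half_gt_zero[OF e]] by blast
    obtain k1 where k1: "(1/2 :: real) ^ k1 < e / 2"
      using real_arch_pow_inv[of "e/2" "1/2"] e by auto
    let ?k = "max k0 k1"
    have "dist (X n) l < e" if n: "n \<ge> N k1" for n
    proof -
      have "dist (X n) (X (r ?k)) < (1/2) ^ k1" by (rule N[OF n r]) simp
      then show ?thesis using k1 k0[of ?k] dist_triangle[of "X n" l "X (r ?k)"] by simp
    qed
    then show "\<exists>no. \<forall>n\<ge>no. dist (X n) l < e" by blast
  qed
  then show ?thesis by (auto simp: convergent_def)
qed

instance calkin :: (complex_banach) complete_space
proof
  fix X :: "nat \<Rightarrow> 'a calkin" assume X: "Cauchy X"
  show "convergent X"
  proof (rule Cauchy_convergent_if_geometric_subseq[OF X])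
    fix r assume r: "\<And>k. dist (X (r (Suc k))) (X (r k)) < (1/2) ^ k"
    \<comment> \<open>The factor 2 pays for choosing a representative whose norm exceeds the
      quotient norm by at most \<open>(1/2) ^ k\<close>.\<close>
    have "\<exists>D. X (r (Suc k)) - X (r k) = calkin_class D \<and> norm D < 2 * (1/2) ^ k" for k
      using norm_calkin_lift[of "(1/2) ^ k" "X (r (Suc k)) - X (r k)"] r[of k]
      by (force simp: dist_norm)
    then have "\<forall>k. \<exists>D. X (r (Suc k)) - X (r k) = calkin_class D \<and> norm D < 2 * (1/2) ^ k" ..
    from choice[OF this] obtain D where
      D0: "\<forall>k. X (r (Suc k)) - X (r k) = calkin_class (D k) \<and> norm (D k) < 2 * (1/2) ^ k" ..
    have D: "calkin_class (D k) = X (r (Suc k)) - X (r k)" "norm (D k) < 2 * (1/2) ^ k" for k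
      using D0 by simp_all
    have "summable (\<lambda>k. norm (D k))"
      by (rule summable_comparison_test[OF _ summable_mult[OF summable_geometric[of "1/2::real"]], of _ 2])
         (use D(2) in \<open>auto intro: less_imp_le\<close>)
    then have "D sums suminf D" by (rule summable_sums[OF summable_norm_cancel])
    from bounded_linear.sums[OF bounded_linear_calkin_class this]
    have "(\<lambda>n. \<Sum>k<n. X (r (Suc k)) - X (r k)) \<longlonglongrightarrow> calkin_class (suminf D)"
      by (simp add: sums_def D)
    then have "(\<lambda>n. X (r n) - X (r 0)) \<longlonglongrightarrow> calkin_class (suminf D)"
      by (simp add: sum_lessThan_telescope[of "\<lambda>k. X (r k)"])
    from tendsto_add[OF this tendsto_const[of "X (r 0)"]]
    show "\<exists>l. (\<lambda>k. X (r k)) \<longlonglongrightarrow> l" by (intro exI) simp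
  qed
qed

instantiation calkin :: (complex_banach) complex_banach_algebra
begin

lift_definition scaleC_calkin :: "complex \<Rightarrow> 'a calkin \<Rightarrow> 'a calkin" is scaleC
proof -
  fix c :: complex and S S' :: "'a bop"
  assume "compact_bop (S - S')"
  from compact_bop_scaleC[OF this, of c] show "compact_bop (c *\<^sub>C S - c *\<^sub>C S')"
    by (simp add: scaleC.diff_right)
qed
lift_definition one_calkin :: "'a calkin" is 1 .

instance
proof
  fix x y :: "'a calkin" and c d :: complex and r :: real
  have *: "compact_bop S" if "S = 0" for S :: "'a bop" using that by (simp add: compact_bop_0)
  show "c *\<^sub>C (x + y) = c *\<^sub>C x + c *\<^sub>C y" by transfer (rule *, simp add: scaleC_add_right)
  show "(c + d) *\<^sub>C x = c *\<^sub>C x + d *\<^sub>C x" by transfer (rule *, simp add: scaleC_add_left)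
  show "c *\<^sub>C d *\<^sub>C x = (c * d) *\<^sub>C x" by transfer (rule *, simp add: scaleC_scaleC)
  show "1 *\<^sub>C x = x" by transfer (rule *, simp add: scaleC_one)
  show "r *\<^sub>R x = complex_of_real r *\<^sub>C x" by transfer (rule *, simp add: scaleR_scaleC)
  show "c *\<^sub>C x * y = c *\<^sub>C (x * y)" by transfer (rule *, simp add: scaleC_mult_left)
  show "x * c *\<^sub>C y = c *\<^sub>C (x * y)" by transfer (rule *, simp add: scaleC_mult_right)
  show "1 * x = x" by transfer (rule *, simp)
  show "x * 1 = x" by transfer (rule *, simp)
  have le: "norm (c *\<^sub>C x) \<le> cmod c * norm x" for c and x :: "'a calkin"
  proof (rule norm_calkin_leI)
    fix e :: real assume e: "e > 0"
    then have "e / (cmod c + 1) > 0" by (simp add: add_nonneg_pos)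
    then obtain S where S: "x = calkin_class S" "norm S < norm x + e / (cmod c + 1)" using norm_calkin_lift by blast
    have "c *\<^sub>C x = calkin_class (c *\<^sub>C S)" by (simp add: S scaleC_calkin.abs_eq)
    moreover have "norm (c *\<^sub>C S) \<le> cmod c * norm x + e"
    proof -
      have "norm (c *\<^sub>C S) \<le> cmod c * (norm x + e / (cmod c + 1))"
        using S(2) by (simp add: norm_scaleC mult_left_mono)
      also have "\<dots> \<le> cmod c * norm x + e" using e by (simp add: distrib_left divide_le_eq add_nonneg_pos)
      finally show ?thesis .
    qed
    ultimately show "\<exists>S. c *\<^sub>C x = calkin_class S \<and> norm S \<le> cmod c * norm x + e" by blast
  qed
  show "norm (c *\<^sub>C x) = cmod c * norm x"
  proof (cases "c = 0")
    case True
    then show ?thesis using le[of c x] norm_ge_zero[of "c *\<^sub>C x"] by simp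
  next
    case False
    have "x = inverse c *\<^sub>C (c *\<^sub>C x)" using False by transfer (simp add: compact_bop_0 scaleC_scaleC scaleC_one)
    then have "norm x \<le> cmod (inverse c) * norm (c *\<^sub>C x)" using le[of "inverse c" "c *\<^sub>C x"] by simp
    then have "cmod c * norm x \<le> norm (c *\<^sub>C x)" using False by (simp add: norm_divide field_simps)
    then show ?thesis using le[of c x] by simp
  qed
qed

end

lemma calkin_class_scaleC: "calkin_class (c *\<^sub>C S) = c *\<^sub>C calkin_class S"
  by (simp add: scaleC_calkin.abs_eq)

lemma calkin_class_one: "calkin_class 1 = 1"
  by (simp add: one_calkin.abs_eq)

lemma calkin_class_eq_0_iff: "calkin_class S = 0 \<longleftrightarrow> apply_bop S \<in> compact_ops UNIV"
  using calkin_class_eq_iff[of S 0] by (simp add: calkin_class_simps compact_bop.rep_eq)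

lemma calkin_class_power: "calkin_class (S ^ n) = calkin_class S ^ n"
  by (induction n) (simp_all add: calkin_class_one calkin_class_simps)

section \<open>Lifting idempotents from the Calkin algebra\<close>

lemma subinterval_avoiding_finite:
  fixes F :: "real set"
  assumes "finite F" "a < b"
  obtains c d where "a \<le> c" "c < d" "d \<le> b" "{c<..<d} \<inter> F = {}"
proof -
  let ?G = "insert b {x \<in> F. a < x \<and> x < b}"
  have G: "finite ?G" "?G \<noteq> {}" using assms by auto
  have m: "Min ?G \<in> ?G" using G by (rule Min_in)
  show thesis
  proof (rule that[of a "Min ?G"])
    show "a < Min ?G" "Min ?G \<le> b" using m assms(2) by auto
    show "{a<..<Min ?G} \<inter> F = {}"
    proof (rule ccontr)
      assume "{a<..<Min ?G} \<inter> F \<noteq> {}"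
      then obtain x where x: "a < x" "x < Min ?G" "x \<in> F" by auto
      moreover have "x < b" using x \<open>Min ?G \<le> b\<close> by simp
      ultimately have "Min ?G \<le> x" using G by (intro Min_le) auto
      then show False using x by simp
    qed
  qed simp
qed

lemma is_unit_el_bop_minus_compact:
  assumes K: "compact_bop K" and l: "l \<noteq> 0" and no: "\<And>x. apply_bop K x = l *\<^sub>C x \<Longrightarrow> x = 0"
  shows "is_unit_el (l *\<^sub>C 1 - K)"
proof -
  let ?K = "inverse l *\<^sub>C K"
  have K': "apply_bop ?K \<in> compact_ops UNIV"
    using compact_bop_scaleC[OF K] by (simp add: compact_bop.rep_eq)
  have inj: "x = 0" if "apply_bop ?K x = x" for x
  proof (rule no)
    have "apply_bop K x = l *\<^sub>C apply_bop ?K x"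
      using l by (simp add: scaleC_bop.rep_eq scaleC_scaleC scaleC_one)
    then show "apply_bop K x = l *\<^sub>C x" using that by simp
  qed
  from fredholm_alternative[OF K' inj]
  obtain S where S: "S \<in> bounded_ops UNIV" "\<And>x. S (x - apply_bop ?K x) = x" "\<And>x. S x - apply_bop ?K (S x) = x"
    by metis
  have ap: "apply_bop (Bop S) = S" using S(1) by (simp add: Bop_inverse)
  have "is_unit_el (1 - ?K)"
  proof (rule is_unit_elI)
    show "(1 - ?K) * Bop S = 1"
      by (rule apply_bop_inject[THEN iffD1])
         (simp add: times_bop.rep_eq minus_bop.rep_eq one_bop.rep_eq ap S fun_eq_iff)
    show "Bop S * (1 - ?K) = 1"
      by (rule apply_bop_inject[THEN iffD1])
         (simp add: times_bop.rep_eq minus_bop.rep_eq one_bop.rep_eq ap S fun_eq_iff)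
  qed
  from is_unit_el_scaleC[OF this l] show ?thesis using l by (simp add: scaleC_simps)
qed

text \<open>Since \<open>(l - S) (S - (1 - l)) = (l\<^sup>2 - l) - (S\<^sup>2 - S)\<close>, the operator \<open>l - S\<close> is invertible unless
  \<open>l\<^sup>2 - l\<close> is \<open>0\<close> or an eigenvalue of the compact operator \<open>S\<^sup>2 - S\<close>.\<close>

lemma idempotent_mod_compact_annulus:
  assumes K: "compact_bop (S * S - S)"
  obtains r1 r2 where "0 \<le> r1" "r1 < r2" "r2 < 1"
    "\<And>l. r1 < cmod l \<Longrightarrow> cmod l < r2 \<Longrightarrow> is_unit_el (l *\<^sub>C 1 - S)"
proof -
  let ?K = "S * S - S"
  \<comment> \<open>The threshold 1/8 is a lower bound of \<open>cmod (l * l - l)\<close> for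
    \<open>1/4 < cmod l < 1/2\<close>, so only finitely many eigenvalues matter.\<close>
  define E where "E = {l. 1/8 \<le> cmod l \<and> (\<exists>x. x \<noteq> 0 \<and> apply_bop ?K x = l *\<^sub>C x)}"
  have finE: "finite E" unfolding E_def
    using K by (intro finite_eigenvalues_compact) (auto simp: compact_bop.rep_eq)
  \<comment> \<open>Each eigenvalue \<open>m\<close> excludes only the two roots of a quadratic
    equation, so only finitely many moduli have to be avoided.\<close>
  have "finite {l::complex. l * l - l = m}" for m
  proof -
    have "finite {l::complex. poly [:- m, -1, 1:] l = 0}" by (rule poly_roots_finite) simp
    moreover have "{l::complex. poly [:- m, -1, 1:] l = 0} = {l. l * l - l = m}"
      by (auto simp: algebra_simps)
    ultimately show ?thesis by simp
  qed
  then have "finite (\<Union>m\<in>E. {l::complex. l * l - l = m})" using finE by blast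
  then have "finite (cmod ` (\<Union>m\<in>E. {l::complex. l * l - l = m}))" by (rule finite_imageI)
  from subinterval_avoiding_finite[OF this, of "1/4" "1/2"]
  obtain c d where cd: "1/4 \<le> c" "c < d" "d \<le> 1/2"
    "{c<..<d} \<inter> cmod ` (\<Union>m\<in>E. {l::complex. l * l - l = m}) = {}" by auto
  show thesis
  proof (rule that[of c d])
    fix l assume l: "c < cmod l" "cmod l < d"
    let ?m = "l * l - l"
    have "?m \<notin> E" using cd(4) l by auto
    moreover have "1/8 \<le> cmod ?m"
    proof -
      have "cmod l * (1 - cmod l) \<le> cmod l * cmod (l - 1)"
        using norm_triangle_ineq2[of 1 l] by (intro mult_left_mono) (simp_all add: norm_minus_commute)
      moreover have "1/4 * (1/2) \<le> cmod l * (1 - cmod l)" using l cd by (intro mult_mono) auto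
      moreover have "?m = l * (l - 1)" by (simp add: algebra_simps)
      ultimately show ?thesis by (simp add: norm_mult)
    qed
    ultimately have "(\<forall>x. apply_bop ?K x = ?m *\<^sub>C x \<longrightarrow> x = 0) \<and> ?m \<noteq> 0"
      by (auto simp: E_def)
    then have no: "apply_bop ?K x = ?m *\<^sub>C x \<Longrightarrow> x = 0" and m0: "?m \<noteq> 0" for x
      by blast+
    have u: "is_unit_el (?m *\<^sub>C 1 - ?K)" by (rule is_unit_el_bop_minus_compact[OF K m0 no])
    have f: "(l *\<^sub>C 1 - S) * (S - (1 - l) *\<^sub>C 1) = ?m *\<^sub>C 1 - ?K"
      "(S - (1 - l) *\<^sub>C 1) * (l *\<^sub>C 1 - S) = ?m *\<^sub>C 1 - ?K"
      by (simp_all add: left_diff_distrib right_diff_distrib scaleC_simps)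
    show "is_unit_el (l *\<^sub>C 1 - S)"
      by (rule is_unit_el_commuting_factor[of _ "S - (1 - l) *\<^sub>C 1"]) (simp_all only: f u)
  qed (use cd in auto)
qed

text \<open>On a circle of radius \<open>t < 1\<close> the spectral idempotent of a representative
  \<open>S\<close> is an exact idempotent operator, and its class is the spectral idempotent of
  \<open>p\<close> for the part of the spectrum at 0, that is \<open>1 - p\<close>. The complement
  therefore lifts \<open>p\<close>.\<close>

lemma calkin_idempotent_lift:
  fixes p :: "'a::complex_banach calkin"
  assumes pp: "p * p = p"
  obtains P where "calkin_class P = p" "P * P = P"
proof -
  obtain S where S: "p = calkin_class S" using calkin_class_surj by blast
  have K: "compact_bop (S * S - S)"
    using pp S by (simp add: calkin_class_simps flip: calkin_class_eq_iff)
  from idempotent_mod_compact_annulus[OF K]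
  obtain r1 r2 where r: "0 \<le> r1" "r1 < r2" "r2 < 1"
    "\<And>l. r1 < cmod l \<Longrightarrow> cmod l < r2 \<Longrightarrow> is_unit_el (l *\<^sub>C 1 - S)" by metis
  interpret resolvent_annulus S r1 r2 by standard (use r in auto)
  define t where "t = (r1 + r2) / 2"
  have t: "r1 < t" "t < r2" "0 < t" "t < 1" using r by (auto simp: t_def)
  let ?E = "spec_idem t"
  let ?s = "inverse (complex_of_real t)"
  have lim: "(\<lambda>n. calkin_class (res_avg S n t)) \<longlonglongrightarrow> calkin_class ?E"
    by (intro bounded_linear.tendsto[OF bounded_linear_calkin_class] res_avg_tendsto t)
  have eq: "calkin_class (res_avg S n t) = (1 - p) - (t ^ n / (1 - t ^ n)) *\<^sub>R p" if n: "n > 0" for n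
  proof -
    have tn: "t ^ n < 1" using t n by (simp add: power_less_one_iff)
    have u: "res_avg S n t * (1 - (?s *\<^sub>C S) ^ n) = 1"
      using t n by (intro res_avg_inverse circle_inv) auto
    have "calkin_class (res_avg S n t) * (1 - (?s *\<^sub>C p) ^ n) = 1"
      using arg_cong[OF u, of calkin_class]
      by (simp add: calkin_class_simps calkin_class_one calkin_class_power calkin_class_scaleC S)
    moreover have "(?s *\<^sub>C p) ^ n = inverse (t ^ n) *\<^sub>R p"
      using power_idempotent[OF pp n] by (simp add: power_scaleC scaleR_scaleC power_inverse)
    ultimately have 1: "calkin_class (res_avg S n t) * (1 - inverse (t ^ n) *\<^sub>R p) = 1" by simp
    \<comment> \<open>The inverse of \<open>1 - t\<^sup>-\<^sup>n p\<close> within the algebra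
      generated by \<open>p\<close>, computed separately on \<open>p\<close> and
      \<open>1 - p\<close>; its second term vanishes as \<open>n\<close> grows.\<close>
    let ?v = "(1 - p) - (t ^ n / (1 - t ^ n)) *\<^sub>R p"
    have "(1 - inverse (t ^ n) *\<^sub>R p) * ?v = 1 - p + (- (t ^ n / (1 - t ^ n)) + inverse (t ^ n) * (t ^ n / (1 - t ^ n))) *\<^sub>R p"
      by (simp add: left_diff_distrib right_diff_distrib pp scaleR_left_distrib algebra_simps)
    also have "- (t ^ n / (1 - t ^ n)) + inverse (t ^ n) * (t ^ n / (1 - t ^ n)) = 1"
      using t tn by (simp add: field_simps)
    finally have 2: "(1 - inverse (t ^ n) *\<^sub>R p) * ?v = 1" by simp
    show ?thesis using left_right_inverse_eq[OF 1 2] .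
  qed
  have t0: "(\<lambda>n. t ^ n) \<longlonglongrightarrow> 0" using t by (intro LIMSEQ_realpow_zero) auto
  have "(\<lambda>n. (1 - p) - (t ^ n / (1 - t ^ n)) *\<^sub>R p) \<longlonglongrightarrow> (1 - p) - (0 / (1 - 0)) *\<^sub>R p"
    by (intro tendsto_intros t0) simp
  then have "(\<lambda>n. (1 - p) - (t ^ n / (1 - t ^ n)) *\<^sub>R p) \<longlonglongrightarrow> 1 - p" by simp
  moreover have "eventually (\<lambda>n. (1 - p) - (t ^ n / (1 - t ^ n)) *\<^sub>R p = calkin_class (res_avg S n t)) sequentially"
    using eventually_gt_at_top[of 0] by eventually_elim (rule eq[symmetric])
  ultimately have "(\<lambda>n. calkin_class (res_avg S n t)) \<longlonglongrightarrow> 1 - p" by (rule Lim_transform_eventually)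
  from LIMSEQ_unique[OF lim this] have E: "calkin_class ?E = 1 - p" .
  have EE: "?E * ?E = ?E" using t by (intro spec_idem_idem) auto
  show thesis
  proof (rule that[of "1 - ?E"])
    show "calkin_class (1 - ?E) = p" by (simp add: calkin_class_simps calkin_class_one E)
    show "(1 - ?E) * (1 - ?E) = 1 - ?E" by (simp add: left_diff_distrib right_diff_distrib EE)
  qed
qed

section \<open>The Calkin algebra as a carrier-based algebra\<close>

lemma op_algebra_a_minus:
  assumes Y: "csubspace Y" and S: "S \<in> bounded_ops Y" and T: "T \<in> bounded_ops Y"
  shows "S \<ominus>\<^bsub>op_algebra Y\<^esub> T = (\<lambda>x\<in>Y. S x - T x)"
proof -
  interpret ring "op_algebra Y" by (rule ring_op_algebra[OF Y])
  have "\<ominus>\<^bsub>op_algebra Y\<^esub> T = (\<lambda>x\<in>Y. (-1) *\<^sub>C T x)"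
    using T bounded_ops_smult[OF Y T, of "-1"]
    by (intro minus_equality) (auto simp: fun_eq_iff restrict_def scaleC_one)
  then show ?thesis by (auto simp: a_minus_def fun_eq_iff restrict_def scaleC_one)
qed

context
  fixes Y :: "'a::complex_banach set"
  assumes Y: "csubspace Y" "closed Y"
begin

interpretation op: ring "op_algebra Y" by (rule ring_op_algebra[OF Y(1)])
interpretation cpt: ideal "compact_ops Y" "op_algebra Y" by (rule ideal_compact_ops[OF Y])

lemma calkin_algebra_ops:
  "carrier (calkin_algebra Y) = carrier (op_algebra Y Quot compact_ops Y)"
  "mult (calkin_algebra Y) = mult (op_algebra Y Quot compact_ops Y)"
  "add (calkin_algebra Y) = add (op_algebra Y Quot compact_ops Y)"
  "one (calkin_algebra Y) = one (op_algebra Y Quot compact_ops Y)"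
  "zero (calkin_algebra Y) = zero (op_algebra Y Quot compact_ops Y)"
  by (simp_all add: calkin_algebra_def quotient_algebra_def)

lemma ring_calkin_algebra: "ring (calkin_algebra Y)"
proof -
  interpret Q: ring "op_algebra Y Quot compact_ops Y" by (rule cpt.quotient_is_ring)
  show ?thesis
  proof (intro ringI abelian_groupI monoidI)
    fix x assume "x \<in> carrier (calkin_algebra Y)"
    then show "\<exists>y\<in>carrier (calkin_algebra Y). y \<oplus>\<^bsub>calkin_algebra Y\<^esub> x = \<zero>\<^bsub>calkin_algebra Y\<^esub>"
      unfolding calkin_algebra_ops using Q.l_neg Q.a_inv_closed by blast
  qed (unfold calkin_algebra_ops, simp_all add: Q.a_ac Q.m_assoc Q.l_distr Q.r_distr)
qed

lemma carrier_calkin_algebra: "carrier (calkin_algebra Y) = calkin_proj Y ` bounded_ops Y"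
  unfolding calkin_algebra_ops by (auto simp: FactRing_def A_RCOSETS_def' calkin_proj_def)

lemma calkin_proj_add:
  "S \<in> bounded_ops Y \<Longrightarrow> T \<in> bounded_ops Y \<Longrightarrow>
    calkin_proj Y S \<oplus>\<^bsub>calkin_algebra Y\<^esub> calkin_proj Y T = calkin_proj Y (\<lambda>x\<in>Y. S x + T x)"
  using ring_hom_add[OF cpt.rcos_ring_hom, of S T] by (simp add: calkin_algebra_ops calkin_proj_def)

lemma calkin_proj_mult:
  "S \<in> bounded_ops Y \<Longrightarrow> T \<in> bounded_ops Y \<Longrightarrow>
    calkin_proj Y S \<otimes>\<^bsub>calkin_algebra Y\<^esub> calkin_proj Y T = calkin_proj Y (compose Y S T)"
  using ring_hom_mult[OF cpt.rcos_ring_hom, of S T] by (simp add: calkin_algebra_ops calkin_proj_def)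

lemma calkin_proj_one: "\<one>\<^bsub>calkin_algebra Y\<^esub> = calkin_proj Y (\<lambda>x\<in>Y. x)"
  using ring_hom_one[OF cpt.rcos_ring_hom] by (simp add: calkin_algebra_ops calkin_proj_def)

lemma calkin_proj_eq_iff:
  assumes "S \<in> bounded_ops Y" "T \<in> bounded_ops Y"
  shows "calkin_proj Y S = calkin_proj Y T \<longleftrightarrow> (\<lambda>x\<in>Y. S x - T x) \<in> compact_ops Y"
  using op.quotient_eq_iff_same_a_r_cos[OF cpt.ideal_axioms, of S T] assms
  by (simp add: calkin_proj_def op_algebra_a_minus[OF Y(1)])

lemma calkin_proj_zero: "\<zero>\<^bsub>calkin_algebra Y\<^esub> = calkin_proj Y (\<lambda>x\<in>Y. 0)"
proof -
  have "compact_ops Y +>\<^bsub>op_algebra Y\<^esub> \<zero>\<^bsub>op_algebra Y\<^esub> = compact_ops Y"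
    by (rule abelian_group.a_coset_add_zero[OF op.abelian_group_axioms]) (auto simp: compact_ops_def)
  then show ?thesis by (simp add: calkin_algebra_ops FactRing_def calkin_proj_def)
qed

lemma calkin_proj_minus:
  assumes S: "S \<in> bounded_ops Y" and T: "T \<in> bounded_ops Y"
  shows "calkin_proj Y S \<ominus>\<^bsub>calkin_algebra Y\<^esub> calkin_proj Y T = calkin_proj Y (\<lambda>x\<in>Y. S x - T x)"
proof -
  interpret C: ring "calkin_algebra Y" by (rule ring_calkin_algebra)
  let ?N = "\<lambda>x\<in>Y. (-1) *\<^sub>C T x"
  have N: "?N \<in> bounded_ops Y" by (rule bounded_ops_smult[OF Y(1) T])
  have "calkin_proj Y ?N \<oplus>\<^bsub>calkin_algebra Y\<^esub> calkin_proj Y T = \<zero>\<^bsub>calkin_algebra Y\<^esub>"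
    unfolding calkin_proj_add[OF N T] calkin_proj_zero
    by (intro arg_cong[of _ _ "calkin_proj Y"]) (auto simp: fun_eq_iff restrict_def scaleC_one)
  then have "\<ominus>\<^bsub>calkin_algebra Y\<^esub> calkin_proj Y T = calkin_proj Y ?N"
    using N T by (intro C.minus_equality) (auto simp: carrier_calkin_algebra)
  then show ?thesis
    unfolding a_minus_def using calkin_proj_add[OF S N]
    by (auto intro!: arg_cong[of _ _ "calkin_proj Y"] simp: fun_eq_iff restrict_def scaleC_one)
qed

lemma mem_calkin_proj: "S \<in> bounded_ops Y \<Longrightarrow> S \<in> calkin_proj Y S"
  unfolding calkin_proj_def by (rule abelian_subgroup.a_rcos_self[OF abelian_subgroupI3])
     (auto intro: cpt.additive_subgroup_axioms op.abelian_group_axioms)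

lemma mem_calkin_projD:
  assumes S: "S \<in> bounded_ops Y" and R: "R \<in> calkin_proj Y S"
  shows "R \<in> bounded_ops Y" "(\<lambda>x\<in>Y. R x - S x) \<in> compact_ops Y"
proof -
  obtain K where K: "K \<in> compact_ops Y" "R = (\<lambda>x\<in>Y. K x + S x)"
    using R by (auto simp: calkin_proj_def a_r_coset_def')
  then show "R \<in> bounded_ops Y"
    using bounded_ops_add[OF Y(1) compact_ops_imp_bounded_ops[OF K(1)] S] by simp
  have "(\<lambda>x\<in>Y. R x - S x) = K"
    using compact_ops_imp_bounded_ops[OF K(1)] K(2)
    by (auto simp: fun_eq_iff restrict_def bounded_ops_iff extensional_def)
  then show "(\<lambda>x\<in>Y. R x - S x) \<in> compact_ops Y" using K(1) by simp
qed

text \<open>The quotient algebra defines scalar multiples as a union over all representatives. Each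
  of them contributes the same coset, and there is at least one.\<close>

lemma calkin_proj_smult:
  assumes S: "S \<in> bounded_ops Y"
  shows "c \<odot>\<^bsub>calkin_algebra Y\<^esub> calkin_proj Y S = calkin_proj Y (\<lambda>x\<in>Y. c *\<^sub>C S x)"
proof -
  have eq: "calkin_proj Y (\<lambda>x\<in>Y. c *\<^sub>C R x) = calkin_proj Y (\<lambda>x\<in>Y. c *\<^sub>C S x)" if R: "R \<in> calkin_proj Y S" for R
  proof -
    have Rb: "R \<in> bounded_ops Y" and K: "(\<lambda>x\<in>Y. R x - S x) \<in> compact_ops Y"
      using mem_calkin_projD[OF S R] by auto
    have "(\<lambda>x\<in>Y. (\<lambda>x\<in>Y. c *\<^sub>C R x) x - (\<lambda>x\<in>Y. c *\<^sub>C S x) x) = (\<lambda>x\<in>Y. c *\<^sub>C (\<lambda>x\<in>Y. R x - S x) x)"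
      by (auto simp: fun_eq_iff restrict_def scaleC.diff_right)
    then show ?thesis
      using compact_ops_smult[OF Y K, of c]
      by (subst calkin_proj_eq_iff) (simp_all add: bounded_ops_smult[OF Y(1)] Rb S)
  qed
  have "c \<odot>\<^bsub>calkin_algebra Y\<^esub> calkin_proj Y S = (\<Union>R\<in>calkin_proj Y S. calkin_proj Y (\<lambda>x\<in>Y. c *\<^sub>C R x))"
    by (simp add: calkin_algebra_def quotient_algebra_def calkin_proj_def)
  also have "\<dots> = (\<Union>R\<in>calkin_proj Y S. calkin_proj Y (\<lambda>x\<in>Y. c *\<^sub>C S x))"
    using eq by (intro SUP_cong) auto
  also have "\<dots> = calkin_proj Y (\<lambda>x\<in>Y. c *\<^sub>C S x)" using mem_calkin_proj[OF S] by auto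
  finally show ?thesis .
qed

lemma calkin_proj_unit_iff:
  assumes S: "S \<in> bounded_ops Y"
  shows "calkin_proj Y S \<in> Units (calkin_algebra Y) \<longleftrightarrow>
    (\<exists>R\<in>bounded_ops Y. (\<lambda>x\<in>Y. S (R x) - x) \<in> compact_ops Y \<and> (\<lambda>x\<in>Y. R (S x) - x) \<in> compact_ops Y)"
proof -
  have "calkin_proj Y S \<otimes>\<^bsub>calkin_algebra Y\<^esub> calkin_proj Y R = \<one>\<^bsub>calkin_algebra Y\<^esub>
      \<longleftrightarrow> (\<lambda>x\<in>Y. S (R x) - x) \<in> compact_ops Y"
    "calkin_proj Y R \<otimes>\<^bsub>calkin_algebra Y\<^esub> calkin_proj Y S = \<one>\<^bsub>calkin_algebra Y\<^esub>
      \<longleftrightarrow> (\<lambda>x\<in>Y. R (S x) - x) \<in> compact_ops Y"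
    if R: "R \<in> bounded_ops Y" for R
  proof -
    have 1: "(\<lambda>x\<in>Y. compose Y S R x - (\<lambda>x\<in>Y. x) x) = (\<lambda>x\<in>Y. S (R x) - x)"
      "(\<lambda>x\<in>Y. compose Y R S x - (\<lambda>x\<in>Y. x) x) = (\<lambda>x\<in>Y. R (S x) - x)"
      by (auto simp: fun_eq_iff restrict_def compose_def)
    show "calkin_proj Y S \<otimes>\<^bsub>calkin_algebra Y\<^esub> calkin_proj Y R = \<one>\<^bsub>calkin_algebra Y\<^esub>
      \<longleftrightarrow> (\<lambda>x\<in>Y. S (R x) - x) \<in> compact_ops Y"
      "calkin_proj Y R \<otimes>\<^bsub>calkin_algebra Y\<^esub> calkin_proj Y S = \<one>\<^bsub>calkin_algebra Y\<^esub>
      \<longleftrightarrow> (\<lambda>x\<in>Y. R (S x) - x) \<in> compact_ops Y"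
      unfolding calkin_proj_one calkin_proj_mult[OF S R] calkin_proj_mult[OF R S]
      by (simp_all only: calkin_proj_eq_iff[OF bounded_ops_compose[OF Y(1) S R] bounded_ops_one[OF Y(1)]]
          calkin_proj_eq_iff[OF bounded_ops_compose[OF Y(1) R S] bounded_ops_one[OF Y(1)]] 1)
  qed
  then show ?thesis using S by (auto simp: Units_def carrier_calkin_algebra)
qed

lemma calkin_proj_shift:
  assumes S: "S \<in> bounded_ops Y"
  shows "m \<odot>\<^bsub>calkin_algebra Y\<^esub> \<one>\<^bsub>calkin_algebra Y\<^esub> \<ominus>\<^bsub>calkin_algebra Y\<^esub> calkin_proj Y S
     = calkin_proj Y (\<lambda>x\<in>Y. m *\<^sub>C x - S x)"
    "(\<lambda>x\<in>Y. m *\<^sub>C x - S x) \<in> bounded_ops Y"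
proof -
  have M: "(\<lambda>x\<in>Y. m *\<^sub>C (\<lambda>x\<in>Y. x) x) \<in> bounded_ops Y"
    by (rule bounded_ops_smult[OF Y(1) bounded_ops_one[OF Y(1)]])
  have eq: "(\<lambda>x\<in>Y. (\<lambda>x\<in>Y. m *\<^sub>C (\<lambda>x\<in>Y. x) x) x - S x) = (\<lambda>x\<in>Y. m *\<^sub>C x - S x)"
    by (auto simp: fun_eq_iff restrict_def)
  show "m \<odot>\<^bsub>calkin_algebra Y\<^esub> \<one>\<^bsub>calkin_algebra Y\<^esub> \<ominus>\<^bsub>calkin_algebra Y\<^esub> calkin_proj Y S
     = calkin_proj Y (\<lambda>x\<in>Y. m *\<^sub>C x - S x)"
    unfolding calkin_proj_one calkin_proj_smult[OF bounded_ops_one[OF Y(1)]] calkin_proj_minus[OF M S] eq ..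
  show "(\<lambda>x\<in>Y. m *\<^sub>C x - S x) \<in> bounded_ops Y"
    using op.minus_closed[unfolded op_algebra_simps(1), OF M S]
    unfolding op_algebra_a_minus[OF Y(1) M S] eq .
qed

end

section \<open>The isometric isomorphism between the two forms of the Calkin algebra\<close>

lemma closed_csubspace_UNIV: "csubspace UNIV" "closed UNIV"
  by (simp_all add: complex_vector.subspace_UNIV)

text \<open>The isomorphism: a class goes to the set of its members, now as plain functions. Units,
  norm, spectrum and Laurent expansions of the carrier-based algebra are transferred along
  it.\<close>

definition calkin_coset :: "'a::complex_banach calkin \<Rightarrow> ('a \<Rightarrow> 'a) set" where
  "calkin_coset x = {apply_bop S |S. calkin_class S = x}"

lemma calkin_coset_class: "calkin_coset (calkin_class S) = calkin_proj UNIV (apply_bop S)"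
proof (intro equalityI subsetI)
  fix f assume "f \<in> calkin_coset (calkin_class S)"
  then obtain T where T: "f = apply_bop T" "calkin_class T = calkin_class S" by (auto simp: calkin_coset_def)
  then have "apply_bop (T - S) \<in> compact_ops UNIV" by (simp add: calkin_class_eq_iff compact_bop.rep_eq)
  moreover have "f = (\<lambda>x. apply_bop (T - S) x + apply_bop S x)" by (simp add: T minus_bop.rep_eq)
  ultimately show "f \<in> calkin_proj UNIV (apply_bop S)"
    by (auto simp: calkin_proj_def a_r_coset_def' restrict_UNIV)
next
  fix f assume "f \<in> calkin_proj UNIV (apply_bop S)"
  then have f: "f \<in> bounded_ops UNIV" "(\<lambda>x. f x - apply_bop S x) \<in> compact_ops UNIV"
    using mem_calkin_projD[OF closed_csubspace_UNIV apply_bop_bounded, of f S] by (auto simp: restrict_UNIV)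
  then have "apply_bop (Bop f) = f" by (simp add: Bop_inverse)
  then have "compact_bop (Bop f - S)" using f(2) by (simp add: compact_bop.rep_eq minus_bop.rep_eq[abs_def])
  then have "calkin_class (Bop f) = calkin_class S" by (simp add: calkin_class_eq_iff)
  then show "f \<in> calkin_coset (calkin_class S)"
    using \<open>apply_bop (Bop f) = f\<close> by (auto simp: calkin_coset_def intro!: exI[of _ "Bop f"])
qed

lemma inj_calkin_coset: "calkin_coset x = calkin_coset y \<longleftrightarrow> x = y"
proof
  assume eq: "calkin_coset x = calkin_coset y"
  obtain S where S: "x = calkin_class S" using calkin_class_surj by blast
  then have "apply_bop S \<in> calkin_coset y" using eq by (auto simp: calkin_coset_def)
  then show "x = y" using S by (auto simp: calkin_coset_def apply_bop_inject)
qed simp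

lemma calkin_coset_add:
  "calkin_coset x \<oplus>\<^bsub>calkin_algebra UNIV\<^esub> calkin_coset y = calkin_coset (x + y)"
proof -
  obtain S T where "x = calkin_class S" "y = calkin_class T" using calkin_class_surj by metis
  then show ?thesis
    using calkin_proj_add[OF closed_csubspace_UNIV apply_bop_bounded apply_bop_bounded, of S T]
    by (simp add: calkin_coset_class restrict_UNIV plus_bop.rep_eq flip: calkin_class_simps)
qed

lemma calkin_coset_minus:
  "calkin_coset x \<ominus>\<^bsub>calkin_algebra UNIV\<^esub> calkin_coset y = calkin_coset (x - y)"
proof -
  obtain S T where "x = calkin_class S" "y = calkin_class T" using calkin_class_surj by metis
  then show ?thesis
    using calkin_proj_minus[OF closed_csubspace_UNIV apply_bop_bounded apply_bop_bounded, of S T]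
    by (simp add: calkin_coset_class restrict_UNIV minus_bop.rep_eq flip: calkin_class_simps)
qed

lemma calkin_coset_mult:
  "calkin_coset x \<otimes>\<^bsub>calkin_algebra UNIV\<^esub> calkin_coset y = calkin_coset (x * y)"
proof -
  obtain S T where "x = calkin_class S" "y = calkin_class T" using calkin_class_surj by metis
  then show ?thesis
    using calkin_proj_mult[OF closed_csubspace_UNIV apply_bop_bounded apply_bop_bounded, of S T]
    by (simp add: calkin_coset_class restrict_UNIV compose_def times_bop.rep_eq flip: calkin_class_simps)
qed

lemma calkin_coset_smult: "c \<odot>\<^bsub>calkin_algebra UNIV\<^esub> calkin_coset x = calkin_coset (c *\<^sub>C x)"
proof -
  obtain S where "x = calkin_class S" using calkin_class_surj by metis
  then show ?thesis
    using calkin_proj_smult[OF closed_csubspace_UNIV apply_bop_bounded, of c S]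
    by (simp add: calkin_coset_class restrict_UNIV scaleC_bop.rep_eq flip: calkin_class_scaleC)
qed

lemma calkin_coset_one: "\<one>\<^bsub>calkin_algebra UNIV\<^esub> = calkin_coset 1"
  using calkin_proj_one[OF closed_csubspace_UNIV]
  by (simp add: calkin_coset_class restrict_UNIV one_bop.rep_eq flip: calkin_class_one)

lemma calkin_coset_zero: "\<zero>\<^bsub>calkin_algebra UNIV\<^esub> = calkin_coset 0"
  using calkin_proj_zero[OF closed_csubspace_UNIV]
  by (simp add: calkin_coset_class restrict_UNIV zero_bop.rep_eq flip: calkin_class_simps(1))

lemma calkin_coset_carrier: "carrier (calkin_algebra (UNIV :: 'a::complex_banach set)) = range calkin_coset"
proof -
  have "calkin_proj (UNIV :: 'a set) ` bounded_ops UNIV = range (\<lambda>S. calkin_proj UNIV (apply_bop S))"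
    using Bop_inverse apply_bop_bounded by (auto simp: image_iff) metis
  also have "\<dots> = range calkin_coset"
  proof -
    have "surj (calkin_class :: 'a bop \<Rightarrow> _)" by (simp add: surj_def calkin_class_surj)
    then show ?thesis
      by (simp add: image_image[of calkin_coset calkin_class UNIV, symmetric] flip: calkin_coset_class)
  qed
  finally show ?thesis by (simp add: carrier_calkin_algebra[OF closed_csubspace_UNIV])
qed

lemma norm_bop_eq_alg_norm: "alg_norm (op_algebra UNIV) (apply_bop S) = norm S"
proof -
  let ?s = "SUP x\<in>cball 0 1. norm (apply_bop S x)"
  have le: "norm (apply_bop S x) \<le> norm S" if "x \<in> cball 0 1" for x
  proof -
    have "norm S * norm x \<le> norm S * 1" using that by (intro mult_left_mono) auto
    then show ?thesis using norm_apply_bop[of S x] by linarith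
  qed
  have upper: "norm (apply_bop S x) \<le> ?s" if "x \<in> cball 0 1" for x
    by (rule cSUP_upper[OF that bdd_aboveI2]) (rule le)
  have "?s \<le> norm S" by (rule cSUP_least) (auto intro: le)
  moreover have "norm S \<le> ?s"
  proof (rule norm_bop_le)
    show "0 \<le> ?s" by (rule order_trans[OF norm_ge_zero upper[of 0]]) simp
    fix x
    show "norm (apply_bop S x) \<le> ?s * norm x"
    proof (cases "x = 0")
      case True
      then show ?thesis using bounded_ops_linear_simps(2)[OF apply_bop_bounded, of S] by simp
    next
      case False
      have "norm (apply_bop S (inverse (norm x) *\<^sub>R x)) \<le> ?s" using False by (intro upper) simp
      also have "apply_bop S (inverse (norm x) *\<^sub>R x) = inverse (norm x) *\<^sub>R apply_bop S x"
        using apply_bop_bounded[of S] by (simp add: bounded_ops_UNIV_iff linear_simps)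
      finally show ?thesis using False by (simp add: divide_simps)
    qed
  qed
  ultimately show ?thesis by (simp add: op_algebra_def)
qed

lemma calkin_coset_norm: "alg_norm (calkin_algebra UNIV) (calkin_coset x) = norm x"
proof -
  have "alg_norm (calkin_algebra UNIV) (calkin_coset x)
     = (INF f\<in>apply_bop ` {S. calkin_class S = x}. alg_norm (op_algebra UNIV) f)"
    by (simp add: calkin_algebra_def quotient_algebra_def calkin_coset_def image_Collect)
  also have "\<dots> = norm x" by (simp add: image_image norm_bop_eq_alg_norm norm_calkin_def)
  finally show ?thesis .
qed

lemma calkin_coset_unit_iff: "calkin_coset x \<in> Units (calkin_algebra UNIV) \<longleftrightarrow> is_unit_el x"
  by (auto simp: Units_def calkin_coset_carrier calkin_coset_mult calkin_coset_one inj_calkin_coset is_unit_el_def)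

lemma calkin_coset_inverse:
  fixes x :: "'a::complex_banach calkin"
  assumes "is_unit_el x" shows "inv\<^bsub>calkin_algebra UNIV\<^esub> calkin_coset x = calkin_coset (inv_el x)"
proof -
  interpret ring "calkin_algebra (UNIV::'a set)" by (rule ring_calkin_algebra[OF closed_csubspace_UNIV])
  show ?thesis
    by (rule inv_char) (simp_all add: calkin_coset_carrier calkin_coset_mult calkin_coset_one inv_el[OF assms])
qed

lemma calkin_coset_shift:
  "m \<odot>\<^bsub>calkin_algebra UNIV\<^esub> \<one>\<^bsub>calkin_algebra UNIV\<^esub> \<ominus>\<^bsub>calkin_algebra UNIV\<^esub> calkin_coset x
     = calkin_coset (m *\<^sub>C 1 - x)"
  by (simp add: calkin_coset_one calkin_coset_smult calkin_coset_minus)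

lemma spectrum_calkin_coset:
  "spectrum (calkin_algebra UNIV) (calkin_coset x) = {m. \<not> is_unit_el (m *\<^sub>C 1 - x)}"
  by (simp add: spectrum_def calkin_coset_shift calkin_coset_unit_iff)

lemma resolvent_calkin_coset:
  "is_unit_el (m *\<^sub>C 1 - x) \<Longrightarrow>
    resolvent (calkin_algebra UNIV) (calkin_coset x) m = calkin_coset (res_el x m)"
  by (simp add: resolvent_def calkin_coset_shift calkin_coset_inverse)

lemma finsum_calkin_coset:
  fixes f :: "'b \<Rightarrow> 'a::complex_banach calkin"
  assumes "finite F"
  shows "(\<Oplus>\<^bsub>calkin_algebra UNIV\<^esub>n\<in>F. calkin_coset (f n)) = calkin_coset (\<Sum>n\<in>F. f n)"
proof -
  interpret ring "calkin_algebra (UNIV::'a set)" by (rule ring_calkin_algebra[OF closed_csubspace_UNIV])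
  show ?thesis using assms
    by induction (simp_all add: calkin_coset_zero calkin_coset_add calkin_coset_carrier Pi_def)
qed

text \<open>The shift by \<open>z\<close> moves the point to the origin. An isolated point belongs
  to the spectrum, whence the first conjunct; a change of sign does not affect being a unit.\<close>

lemma iso_spectrum_calkin_coset:
  "z \<in> iso_spectrum (calkin_algebra UNIV) (calkin_coset x) \<longleftrightarrow>
     \<not> is_unit_el (x - z *\<^sub>C 1) \<and>
     (\<exists>R>0. \<forall>l. 0 < cmod l \<and> cmod l < R \<longrightarrow> is_unit_el (l *\<^sub>C 1 - (x - z *\<^sub>C 1)))"
proof -
  have neg: "is_unit_el (z *\<^sub>C 1 - x) \<longleftrightarrow> is_unit_el (x - z *\<^sub>C 1)"
    using is_unit_el_scaleC[of "z *\<^sub>C 1 - x" "-1"] is_unit_el_scaleC[of "x - z *\<^sub>C 1" "-1"]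
    by (auto simp: scaleC_one)
  have sh: "l *\<^sub>C 1 - (x - z *\<^sub>C 1) = (z + l) *\<^sub>C 1 - x" for l
    by (simp add: scaleC_add_left algebra_simps)
  have "(\<exists>e>0. \<forall>y. \<not> is_unit_el (y *\<^sub>C 1 - x) \<longrightarrow> dist z y < e \<longrightarrow> y = z) \<longleftrightarrow>
     (\<exists>R>0. \<forall>l. 0 < cmod l \<and> cmod l < R \<longrightarrow> is_unit_el ((z + l) *\<^sub>C 1 - x))"
  proof (intro iff_exI conj_cong refl iffI allI impI)
    fix e l assume "\<forall>y. \<not> is_unit_el (y *\<^sub>C 1 - x) \<longrightarrow> dist z y < e \<longrightarrow> y = z" "0 < cmod l \<and> cmod l < e"
    then show "is_unit_el ((z + l) *\<^sub>C 1 - x)"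
      by (auto dest!: spec[of _ "z + l"] simp: dist_norm)
  next
    fix e y assume "\<forall>l. 0 < cmod l \<and> cmod l < e \<longrightarrow> is_unit_el ((z + l) *\<^sub>C 1 - x)"
      "\<not> is_unit_el (y *\<^sub>C 1 - x)" "dist z y < e"
    then show "y = z" by (auto dest!: spec[of _ "y - z"] simp: dist_norm norm_minus_commute)
  qed
  then show ?thesis
    by (simp add: iso_spectrum_def isolated_in_dist_Ex_iff spectrum_calkin_coset neg sh)
qed

lemma laurent_calkin_coset_iff:
  fixes x :: "'a::complex_banach calkin"
  assumes R: "R > 0" "\<And>l. 0 < cmod l \<Longrightarrow> cmod l < R \<Longrightarrow> is_unit_el (l *\<^sub>C 1 - (x - z *\<^sub>C 1))"
  shows "laurent_expansion (calkin_algebra UNIV) (resolvent (calkin_algebra UNIV) (calkin_coset x)) z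
       (\<lambda>n. calkin_coset (a n)) \<longleftrightarrow>
     (\<exists>r>0. \<forall>l. 0 < cmod l \<and> cmod l < r \<longrightarrow>
       ((\<lambda>n. (l powi n) *\<^sub>C a n) has_sum res_el (x - z *\<^sub>C 1) l) UNIV)"
proof -
  let ?C = "calkin_algebra (UNIV::'a set)"
  have key: "((\<lambda>F. alg_norm ?C (resolvent ?C (calkin_coset x) m \<ominus>\<^bsub>?C\<^esub>
        (\<Oplus>\<^bsub>?C\<^esub>n\<in>F. ((m - z) powi n) \<odot>\<^bsub>?C\<^esub> calkin_coset (a n)))) \<longlongrightarrow> 0) (finite_subsets_at_top UNIV)
     \<longleftrightarrow> ((\<lambda>n. ((m - z) powi n) *\<^sub>C a n) has_sum res_el (x - z *\<^sub>C 1) (m - z)) UNIV"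
    if m: "0 < cmod (m - z)" "cmod (m - z) < R" for m
  proof -
    let ?f = "\<lambda>n. ((m - z) powi n) *\<^sub>C a n" and ?S = "res_el (x - z *\<^sub>C 1) (m - z)"
    have m': "(m - z) *\<^sub>C 1 - (x - z *\<^sub>C 1) = m *\<^sub>C 1 - x" by (simp add: scaleC.diff_left)
    have u: "is_unit_el (m *\<^sub>C 1 - x)" using R(2)[OF m] unfolding m' .
    have res: "resolvent ?C (calkin_coset x) m = calkin_coset ?S"
      unfolding m' by (rule resolvent_calkin_coset[OF u])
    have "alg_norm ?C (resolvent ?C (calkin_coset x) m \<ominus>\<^bsub>?C\<^esub>
        (\<Oplus>\<^bsub>?C\<^esub>n\<in>F. ((m - z) powi n) \<odot>\<^bsub>?C\<^esub> calkin_coset (a n))) = norm (sum ?f F - ?S)" if "finite F" for F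
      by (simp add: res calkin_coset_smult finsum_calkin_coset[OF that] calkin_coset_minus calkin_coset_norm
          norm_minus_commute)
    then have "eventually (\<lambda>F. alg_norm ?C (resolvent ?C (calkin_coset x) m \<ominus>\<^bsub>?C\<^esub>
        (\<Oplus>\<^bsub>?C\<^esub>n\<in>F. ((m - z) powi n) \<odot>\<^bsub>?C\<^esub> calkin_coset (a n))) = norm (sum ?f F - ?S)) (finite_subsets_at_top UNIV)"
      by (intro eventually_finite_subsets_at_top_weakI) auto
    from tendsto_cong[OF this] show ?thesis
      by (simp add: has_sum_def tendsto_norm_zero_iff LIM_zero_iff)
  qed
  show ?thesis
  proof
    assume "laurent_expansion ?C (resolvent ?C (calkin_coset x)) z (\<lambda>n. calkin_coset (a n))"
    then obtain r where r: "r > 0" "\<And>m. 0 < cmod (m - z) \<Longrightarrow> cmod (m - z) < r \<Longrightarrow>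
       ((\<lambda>F. alg_norm ?C (resolvent ?C (calkin_coset x) m \<ominus>\<^bsub>?C\<^esub>
        (\<Oplus>\<^bsub>?C\<^esub>n\<in>F. ((m - z) powi n) \<odot>\<^bsub>?C\<^esub> calkin_coset (a n)))) \<longlongrightarrow> 0) (finite_subsets_at_top UNIV)"
      unfolding laurent_expansion_def by blast
    show "\<exists>r>0. \<forall>l. 0 < cmod l \<and> cmod l < r \<longrightarrow>
       ((\<lambda>n. (l powi n) *\<^sub>C a n) has_sum res_el (x - z *\<^sub>C 1) l) UNIV"
    \<comment> \<open>Within radius \<open>R\<close> the carrier-based resolvent is a genuine
      inverse and agrees with \<open>res_el\<close>.\<close>
    proof (intro exI[of _ "min r R"] conjI allI impI)
      fix l assume "0 < cmod l \<and> cmod l < min r R"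
      then show "((\<lambda>n. (l powi n) *\<^sub>C a n) has_sum res_el (x - z *\<^sub>C 1) l) UNIV"
        using r(2)[of "z + l"] key[of "z + l"] by simp
    qed (use r R in auto)
  next
    assume "\<exists>r>0. \<forall>l. 0 < cmod l \<and> cmod l < r \<longrightarrow>
       ((\<lambda>n. (l powi n) *\<^sub>C a n) has_sum res_el (x - z *\<^sub>C 1) l) UNIV"
    then obtain r where r: "r > 0" "\<And>l. 0 < cmod l \<Longrightarrow> cmod l < r \<Longrightarrow>
       ((\<lambda>n. (l powi n) *\<^sub>C a n) has_sum res_el (x - z *\<^sub>C 1) l) UNIV" by blast
    show "laurent_expansion ?C (resolvent ?C (calkin_coset x)) z (\<lambda>n. calkin_coset (a n))"
      unfolding laurent_expansion_def
    proof (intro conjI exI[of _ "min r R"] allI impI)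
      fix m assume m: "0 < cmod (m - z) \<and> cmod (m - z) < min r R"
      then show "((\<lambda>F. alg_norm ?C (resolvent ?C (calkin_coset x) m \<ominus>\<^bsub>?C\<^esub>
        (\<Oplus>\<^bsub>?C\<^esub>n\<in>F. ((m - z) powi n) \<odot>\<^bsub>?C\<^esub> calkin_coset (a n)))) \<longlongrightarrow> 0) (finite_subsets_at_top UNIV)"
        by (subst key) (use r(2)[of "m - z"] in auto)
    qed (use r R in \<open>auto simp: calkin_coset_carrier\<close>)
  qed
qed

text \<open>A finite singular part in any expansion forces nilpotency by the growth argument.
  Conversely nilpotency makes \<open>laurent_coeff\<close> an expansion with finite singular part,
  which is nonzero because the coefficient at \<open>-1\<close> is \<open>p\<close>.\<close>

lemma spectral_split_resolvent_poles_iff: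
  fixes x :: "'a::complex_banach calkin"
  assumes split: "spectral_split (x - z *\<^sub>C 1) p b" and p: "p \<noteq> 0"
  shows "z \<in> iso_spectrum (calkin_algebra UNIV) (calkin_coset x)"
    "z \<in> resolvent_poles (calkin_algebra UNIV) (calkin_coset x) \<longleftrightarrow>
      (\<exists>n\<ge>1. ((x - z *\<^sub>C 1) * p) ^ n = 0)"
proof -
  let ?C = "calkin_algebra (UNIV::'a set)" and ?c = "x - z *\<^sub>C 1"
  \<comment> \<open>For \<open>cmod l < R\<close> the product \<open>cmod l * norm b\<close> is
    below 1, so the Neumann series in \<open>b\<close> converges.\<close>
  define R where "R = 1 / (norm b + 1)"
  have b1: "norm b + 1 > 0" by (rule add_nonneg_pos) auto
  have R0: "R > 0" using b1 by (simp add: R_def)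
  have small: "cmod l * norm b < 1" if "cmod l < R" for l
  proof -
    have "cmod l * (norm b + 1) < 1" using that b1 by (simp add: R_def less_divide_eq)
    then show ?thesis using norm_ge_zero[of l] by (simp only: distrib_left mult_1_right)
  qed
  have unit: "is_unit_el (l *\<^sub>C 1 - ?c)" if "0 < cmod l" "cmod l < R" for l
    using spectral_split_resolvent(1)[OF split _ small] that by auto
  have "\<not> is_unit_el ?c" using spectral_split_unit_imp_zero[OF split] p by blast
  then show iso: "z \<in> iso_spectrum ?C (calkin_coset x)"
    unfolding iso_spectrum_calkin_coset using R0 unit by blast
  have laurent: "laurent_expansion ?C (resolvent ?C (calkin_coset x)) z (\<lambda>n. calkin_coset (a n)) \<longleftrightarrow>
     (\<exists>r>0. \<forall>l. 0 < cmod l \<and> cmod l < r \<longrightarrow> ((\<lambda>n. (l powi n) *\<^sub>C a n) has_sum res_el ?c l) UNIV)" for a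
    by (rule laurent_calkin_coset_iff[OF R0]) (rule unit)
  show "z \<in> resolvent_poles ?C (calkin_coset x) \<longleftrightarrow> (\<exists>n\<ge>1. (?c * p) ^ n = 0)"
  proof
    assume "z \<in> resolvent_poles ?C (calkin_coset x)"
    then obtain a where a: "laurent_expansion ?C (resolvent ?C (calkin_coset x)) z a"
      "finite {n. n < 0 \<and> a n \<noteq> \<zero>\<^bsub>?C\<^esub>}" by (auto simp: resolvent_poles_def)
    then have "\<forall>n. \<exists>y. a n = calkin_coset y"
      unfolding laurent_expansion_def calkin_coset_carrier by blast
    from choice[OF this] obtain a' where "\<forall>n. a n = calkin_coset (a' n)" ..
    then have a': "a = (\<lambda>n. calkin_coset (a' n))" by auto
    have fin: "finite {n. n < 0 \<and> a' n \<noteq> 0}" using a(2) by (simp add: a' calkin_coset_zero inj_calkin_coset)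
    obtain r where r: "r > 0" "\<forall>l. 0 < cmod l \<and> cmod l < r \<longrightarrow>
       ((\<lambda>n. (l powi n) *\<^sub>C a' n) has_sum res_el ?c l) UNIV"
      using a(1) unfolding a' laurent by (elim exE conjE)
    show "\<exists>n\<ge>1. (?c * p) ^ n = 0"
      by (rule spectral_split_laurent_imp_nilpotent[OF split r(1) _ fin]) (use r(2) in simp)
  next
    assume "\<exists>n\<ge>1. (?c * p) ^ n = 0"
    then obtain N where N: "(?c * p) ^ N = 0" by blast
    let ?a = "laurent_coeff (?c * p) p b"
    have "laurent_expansion ?C (resolvent ?C (calkin_coset x)) z (\<lambda>n. calkin_coset (?a n))"
      unfolding laurent
    proof (intro exI[of _ R] conjI allI impI R0)
      fix l assume "0 < cmod l \<and> cmod l < R"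
      then show "((\<lambda>n. (l powi n) *\<^sub>C ?a n) has_sum res_el ?c l) UNIV"
        by (intro nilpotent_imp_spectral_split_laurent[OF split N] small) auto
    qed
    then show "z \<in> resolvent_poles ?C (calkin_coset x)"
      using iso laurent_coeff_singular_part[OF p N, of b]
      by (auto simp: resolvent_poles_def calkin_coset_zero inj_calkin_coset
          intro!: exI[of _ "\<lambda>n. calkin_coset (?a n)"])
  qed
qed

section \<open>Operators on the range of an idempotent\<close>

lemma calkin_class_unit_iff:
  assumes T: "T \<in> bounded_ops UNIV"
  shows "is_unit_el (calkin_class (Bop T)) \<longleftrightarrow>
    (\<exists>R\<in>bounded_ops UNIV. (\<lambda>x. T (R x) - x) \<in> compact_ops UNIV \<and> (\<lambda>x. R (T x) - x) \<in> compact_ops UNIV)"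
  using calkin_proj_unit_iff[OF closed_csubspace_UNIV T] calkin_coset_unit_iff[of "calkin_class (Bop T)"]
  by (simp add: calkin_coset_class Bop_inverse[OF T] restrict_UNIV)

section \<open>Passing between the range of an idempotent and the whole space\<close>

locale bounded_idempotent =
  fixes P :: "'a::complex_banach \<Rightarrow> 'a"
  assumes Pb: "P \<in> bounded_ops UNIV" and PP: "P (P x) = P x"
begin

lemmas P_simps = bounded_ops_linear_simps[OF Pb] bounded_ops_diff[OF Pb]

lemma mem_range_iff: "x \<in> range P \<longleftrightarrow> P x = x"
  using PP by (metis rangeE rangeI)

lemma csubspace_range: "csubspace (range P)"
  by (rule csubspace_image[OF Pb complex_vector.subspace_UNIV])

lemma continuous_P: "continuous_on UNIV P"
  by (rule bounded_ops_continuous_on[OF closed_csubspace_UNIV(1) Pb])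

lemma closed_range: "closed (range P)"
proof -
  have "range P = {x. P x = x}" using mem_range_iff by blast
  then show ?thesis using continuous_P by (simp add: closed_Collect_eq continuous_on_id)
qed

lemmas range_subspace = csubspace_range closed_range

lemma ops_in_range: "S \<in> bounded_ops (range P) \<Longrightarrow> P (S (P x)) = S (P x)"
  using mem_range_iff by (auto simp: bounded_ops_iff)

lemma extend_bounded_ops:
  assumes S: "S \<in> bounded_ops (range P)" shows "(\<lambda>x. S (P x)) \<in> bounded_ops UNIV"
proof -
  obtain C where C: "C > 0" "\<And>x. x \<in> range P \<Longrightarrow> norm (S x) \<le> C * norm x"
    by (rule bounded_ops_bound[OF S], rule that)
  obtain D where D: "D > 0 \<and> (\<forall>x. norm (P x) \<le> D * norm x)" using bounded_ops_UNIV_bound[OF Pb] ..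
  have "norm (S (P x)) \<le> C * D * norm x" for x
  proof -
    have "norm (S (P x)) \<le> C * norm (P x)" by (rule C(2)) simp
    also have "\<dots> \<le> C * (D * norm x)" using D C(1) by (intro mult_left_mono) auto
    finally show ?thesis by (simp add: mult.assoc)
  qed
  then show ?thesis using S by (auto simp: bounded_ops_iff P_simps)
qed

lemma compress_bounded_ops:
  assumes S: "S \<in> bounded_ops UNIV" shows "(\<lambda>x\<in>range P. P (S x)) \<in> bounded_ops (range P)"
proof -
  obtain C where C: "C > 0 \<and> (\<forall>x. norm (P (S x)) \<le> C * norm x)"
    using bounded_ops_UNIV_bound[OF bounded_ops_UNIV_compose[OF Pb S]] ..
  have cl: "x + y \<in> range P" "c *\<^sub>C x \<in> range P" if "x \<in> range P" "y \<in> range P" for x y c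
    using csubspace_range that by (auto intro: complex_vector.subspace_add complex_vector.subspace_scale)
  show ?thesis unfolding bounded_ops_iff
  proof (intro conjI ballI allI exI[of _ C])
    fix x y c assume "x \<in> range P" "y \<in> range P"
    then show "(\<lambda>x\<in>range P. P (S x)) (x + y) = (\<lambda>x\<in>range P. P (S x)) x + (\<lambda>x\<in>range P. P (S x)) y"
      using cl by (simp add: P_simps bounded_ops_linear_simps[OF S])
  next
    fix x c assume "x \<in> range P"
    then show "(\<lambda>x\<in>range P. P (S x)) (c *\<^sub>C x) = c *\<^sub>C (\<lambda>x\<in>range P. P (S x)) x"
      using cl(2)[of x x c] by (simp add: P_simps bounded_ops_linear_simps[OF S])
  qed (use C in auto)
qed

lemma compress_compact_ops:
  assumes K: "K \<in> compact_ops UNIV" shows "(\<lambda>x\<in>range P. P (K x)) \<in> compact_ops (range P)"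
proof -
  have "(\<lambda>x. P (K x)) \<in> compact_ops UNIV" by (rule compact_ops_UNIV_compose[OF K Pb])
  then obtain D where D: "compact D" "\<And>x. x \<in> UNIV \<Longrightarrow> norm x \<le> 1 \<Longrightarrow> P (K x) \<in> D"
    by (rule compact_opsE) auto
  show ?thesis
    by (rule compact_opsI[OF compress_bounded_ops[OF compact_ops_imp_bounded_ops[OF K]] D(1)])
       (use D(2) in auto)
qed

lemma extend_compact_ops_iff:
  assumes S: "S \<in> bounded_ops (range P)"
  shows "(\<lambda>x. S (P x)) \<in> compact_ops UNIV \<longleftrightarrow> S \<in> compact_ops (range P)"
proof
  assume "(\<lambda>x. S (P x)) \<in> compact_ops UNIV"
  from compress_compact_ops[OF this] have "(\<lambda>x\<in>range P. P (S (P x))) \<in> compact_ops (range P)" .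
  moreover have "(\<lambda>x\<in>range P. P (S (P x))) = S"
    using S mem_range_iff by (auto simp: ops_in_range[OF S] fun_eq_iff restrict_def bounded_ops_iff extensional_def)
  ultimately show "S \<in> compact_ops (range P)" by simp
next
  assume comp: "S \<in> compact_ops (range P)"
  obtain D where D: "compact D" "D \<subseteq> range P" "\<And>x. x \<in> range P \<Longrightarrow> norm x \<le> 1 \<Longrightarrow> S x \<in> D"
    by (rule compact_opsE[OF comp closed_range], rule that)
  obtain C where C: "C > 0 \<and> (\<forall>x. norm (P x) \<le> C * norm x)" using bounded_ops_UNIV_bound[OF Pb] ..
  show "(\<lambda>x. S (P x)) \<in> compact_ops UNIV"
  proof (rule compact_opsI[OF extend_bounded_ops[OF S] compact_scaling[OF D(1), of C]])
    fix x :: 'a assume x: "norm x \<le> 1"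
    \<comment> \<open>\<open>P\<close> may enlarge norms, so the unit ball is first shrunk by the
      bound \<open>C\<close> of \<open>P\<close> to land in the unit ball of the range.\<close>
    let ?u = "inverse C *\<^sub>R x"
    have "norm (P ?u) \<le> C * norm ?u" using C by blast
    also have "\<dots> = norm x" using C by simp
    also have "\<dots> \<le> 1" by (rule x)
    finally have "S (P ?u) \<in> D" by (intro D(3)) auto
    moreover have "S (P x) = C *\<^sub>R S (P ?u)"
    proof -
      have "bounded_linear (\<lambda>x. S (P x))" using extend_bounded_ops[OF S] by (simp add: bounded_ops_UNIV_iff)
      then have "S (P (C *\<^sub>R ?u)) = C *\<^sub>R S (P ?u)" by (rule linear_simps(5))
      then show ?thesis using C by simp
    qed
    ultimately show "S (P x) \<in> (*\<^sub>R) C ` D" by blast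
  qed
qed

text \<open>With respect to \<open>P\<close> the extended operator \<open>?A\<close> is diagonal,
  with blocks \<open>m - S\<close> and \<open>m\<close>. As \<open>m \<noteq> 0\<close>, an inverse
  modulo compacts on the range extends by \<open>inverse m\<close> on the complement; conversely an
  inverse on the whole space is compressed by \<open>P\<close>.\<close>

lemma calkin_unit_extend_iff:
  assumes S: "S \<in> bounded_ops (range P)" and m: "m \<noteq> 0"
  shows "calkin_proj (range P) (\<lambda>x\<in>range P. m *\<^sub>C x - S x) \<in> Units (calkin_algebra (range P)) \<longleftrightarrow>
    is_unit_el (m *\<^sub>C 1 - calkin_class (Bop (\<lambda>x. S (P x))))"
proof -
  let ?Y = "range P"
  let ?T = "\<lambda>x\<in>?Y. m *\<^sub>C x - S x" and ?A = "\<lambda>x. m *\<^sub>C x - S (P x)"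
  note SP = extend_bounded_ops[OF S]
  have T: "?T \<in> bounded_ops ?Y" by (rule calkin_proj_shift(2)[OF range_subspace S])
  have A: "?A \<in> bounded_ops UNIV"
    by (rule bounded_ops_UNIV_diff[OF bounded_ops_scaleC[OF bounded_ops_UNIV_ident] SP])
  have "m *\<^sub>C 1 - calkin_class (Bop (\<lambda>x. S (P x))) = calkin_class (m *\<^sub>C 1 - Bop (\<lambda>x. S (P x)))"
    by (simp add: calkin_class_simps calkin_class_scaleC calkin_class_one)
  also have "m *\<^sub>C 1 - Bop (\<lambda>x. S (P x)) = Bop ?A"
    by (rule apply_bop_inject[THEN iffD1])
       (simp add: Bop_inverse[OF A] Bop_inverse[OF SP] minus_bop.rep_eq scaleC_bop.rep_eq one_bop.rep_eq)
  finally have u: "is_unit_el (m *\<^sub>C 1 - calkin_class (Bop (\<lambda>x. S (P x)))) \<longleftrightarrow>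
    (\<exists>R\<in>bounded_ops UNIV. (\<lambda>x. ?A (R x) - x) \<in> compact_ops UNIV \<and> (\<lambda>x. R (?A x) - x) \<in> compact_ops UNIV)"
    using calkin_class_unit_iff[OF A] by simp
  have TY: "?T x \<in> ?Y" if "x \<in> ?Y" for x using T that unfolding bounded_ops_iff by blast
  show ?thesis unfolding u calkin_proj_unit_iff[OF range_subspace T]
  proof
    assume "\<exists>R\<in>bounded_ops ?Y. (\<lambda>x\<in>?Y. ?T (R x) - x) \<in> compact_ops ?Y \<and> (\<lambda>x\<in>?Y. R (?T x) - x) \<in> compact_ops ?Y"
    then obtain R where R: "R \<in> bounded_ops ?Y" and K1: "(\<lambda>x\<in>?Y. ?T (R x) - x) \<in> compact_ops ?Y"
      and K2: "(\<lambda>x\<in>?Y. R (?T x) - x) \<in> compact_ops ?Y" by blast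
    let ?R = "\<lambda>x. R (P x) + inverse m *\<^sub>C (x - P x)"
    have Rb: "?R \<in> bounded_ops UNIV"
      by (rule bounded_ops_UNIV_add[OF extend_bounded_ops[OF R] bounded_ops_scaleC[OF one_minus_bounded_ops[OF Pb]]])
    have RY: "R (P x) \<in> ?Y" for x using R by (auto simp: bounded_ops_iff)
    have PR: "P (?R x) = R (P x)" for x by (simp add: P_simps PP ops_in_range[OF R])
    have "?A (?R x) - x = (\<lambda>x\<in>?Y. ?T (R x) - x) (P x)" for x
      using RY[of x] m unfolding PR by (simp add: scaleC_add_right scaleC_scaleC scaleC_one)
    then have 1: "(\<lambda>x. ?A (?R x) - x) \<in> compact_ops UNIV"
      using K1 extend_compact_ops_iff[OF compact_ops_imp_bounded_ops[OF K1]] by simp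
    have PA: "P (?A x) = ?T (P x)" for x by (simp add: P_simps PP ops_in_range[OF S])
    have AP: "?A x - P (?A x) = m *\<^sub>C (x - P x)" for x
      by (simp add: P_simps PP ops_in_range[OF S] scaleC.diff_right)
    have "?R (?A x) - x = (\<lambda>x\<in>?Y. R (?T x) - x) (P x)" for x
    proof -
      have "?R (?A x) = R (?T (P x)) + (x - P x)"
        unfolding AP unfolding PA using m by (simp add: scaleC_scaleC scaleC_one)
      then show ?thesis by simp
    qed
    then have 2: "(\<lambda>x. ?R (?A x) - x) \<in> compact_ops UNIV"
      using K2 extend_compact_ops_iff[OF compact_ops_imp_bounded_ops[OF K2]] by simp
    show "\<exists>R\<in>bounded_ops UNIV. (\<lambda>x. ?A (R x) - x) \<in> compact_ops UNIV \<and> (\<lambda>x. R (?A x) - x) \<in> compact_ops UNIV"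
      by (rule bexI[of _ ?R], intro conjI, rule 1, rule 2, rule Rb)
  next
    assume "\<exists>R\<in>bounded_ops UNIV. (\<lambda>x. ?A (R x) - x) \<in> compact_ops UNIV \<and> (\<lambda>x. R (?A x) - x) \<in> compact_ops UNIV"
    then obtain R where R: "R \<in> bounded_ops UNIV" and K1: "(\<lambda>x. ?A (R x) - x) \<in> compact_ops UNIV"
      and K2: "(\<lambda>x. R (?A x) - x) \<in> compact_ops UNIV" by blast
    let ?R = "\<lambda>x\<in>?Y. P (R x)"
    have Rb: "?R \<in> bounded_ops ?Y" by (rule compress_bounded_ops[OF R])
    have "(\<lambda>x\<in>?Y. ?T (?R x) - x) = (\<lambda>x\<in>?Y. P (?A (R x) - x))"
      by (rule restrict_ext) (simp add: mem_range_iff P_simps PP ops_in_range[OF S])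
    then have 1: "(\<lambda>x\<in>?Y. ?T (?R x) - x) \<in> compact_ops ?Y" using compress_compact_ops[OF K1] by simp
    have "(\<lambda>x\<in>?Y. ?R (?T x) - x) = (\<lambda>x\<in>?Y. P (R (?A x) - x))"
    proof (rule restrict_ext)
      fix x assume x: "x \<in> ?Y"
      then have "?T x = ?A x" by (simp add: mem_range_iff)
      then show "?R (?T x) - x = P (R (?A x) - x)"
        using TY[OF x] x by (simp add: mem_range_iff P_simps)
    qed
    then have 2: "(\<lambda>x\<in>?Y. ?R (?T x) - x) \<in> compact_ops ?Y" using compress_compact_ops[OF K2] by simp
    show "\<exists>R\<in>bounded_ops ?Y. (\<lambda>x\<in>?Y. ?T (R x) - x) \<in> compact_ops ?Y \<and> (\<lambda>x\<in>?Y. R (?T x) - x) \<in> compact_ops ?Y"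
      by (rule bexI[of _ ?R], intro conjI, rule 1, rule 2, rule Rb)
  qed
qed

lemma riesz_ops_iff:
  assumes S: "S \<in> bounded_ops (range P)"
  shows "S \<in> riesz_ops (range P) \<longleftrightarrow> quasi_nil (calkin_class (Bop (\<lambda>x. S (P x))))"
proof -
  have "calkin_proj (range P) S \<in> carrier (calkin_algebra (range P))"
    using S by (simp add: carrier_calkin_algebra[OF range_subspace])
  then show ?thesis using S calkin_unit_extend_iff[OF S]
    by (auto simp: riesz_ops_def quasi_nilpotent_def spectrum_def calkin_proj_shift(1)[OF range_subspace S] quasi_nil_def)
qed

text \<open>The \<open>n\<close>-th power of \<open>S P\<close> is \<open>S\<^sup>n P\<close>,
  because \<open>S P\<close> maps into the range of \<open>P\<close>. This fails for
  \<open>n = 0\<close>, where one side is the identity and the other is \<open>P\<close>.\<close>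

lemma power_compact_ops_iff:
  assumes S: "S \<in> bounded_ops (range P)"
  shows "S \<in> power_compact_ops (range P) \<longleftrightarrow> (\<exists>n\<ge>1. calkin_class (Bop (\<lambda>x. S (P x))) ^ n = 0)"
proof -
  let ?Y = "range P" and ?A = "Bop (\<lambda>x. S (P x))"
  interpret op: ring "op_algebra ?Y" by (rule ring_op_algebra[OF csubspace_range])
  have A: "apply_bop ?A = (\<lambda>x. S (P x))" by (rule Bop_inverse[OF extend_bounded_ops[OF S]])
  have Sn: "S [^]\<^bsub>op_algebra ?Y\<^esub> n \<in> bounded_ops ?Y" for n :: nat
    using op.nat_pow_closed[of S n] S by simp
  have on_Y: "apply_bop (?A ^ n) y = (S [^]\<^bsub>op_algebra ?Y\<^esub> n) y" if "y \<in> ?Y" for n y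
    using that
  proof (induction n arbitrary: y)
    case 0 then show ?case by (simp add: one_bop.rep_eq)
  next
    case (Suc n)
    have Py: "P y = y" using Suc.prems mem_range_iff by blast
    have "S y \<in> ?Y" using S Suc.prems by (auto simp: bounded_ops_iff)
    then have "apply_bop (?A ^ n) (S y) = (S [^]\<^bsub>op_algebra ?Y\<^esub> n) (S y)" by (rule Suc.IH)
    then show ?case using Suc.prems
      by (simp add: power_Suc2 times_bop.rep_eq A Py compose_def del: power_Suc)
  qed
  have "apply_bop (?A ^ n) = (\<lambda>x. (S [^]\<^bsub>op_algebra ?Y\<^esub> n) (P x))" if n: "n \<ge> 1" for n
  proof
    fix x
    obtain k where k: "n = Suc k" using n by (cases n) auto
    have "apply_bop (?A ^ n) x = apply_bop (?A ^ n) (P x)"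
      by (simp add: k power_Suc2 times_bop.rep_eq A PP del: power_Suc)
    then show "apply_bop (?A ^ n) x = (S [^]\<^bsub>op_algebra ?Y\<^esub> n) (P x)" by (simp add: on_Y)
  qed
  then have "calkin_class ?A ^ n = 0 \<longleftrightarrow> S [^]\<^bsub>op_algebra ?Y\<^esub> n \<in> compact_ops ?Y" if "n \<ge> 1" for n
    using that extend_compact_ops_iff[OF Sn[of n]] by (simp flip: calkin_class_power add: calkin_class_eq_0_iff)
  then show ?thesis using S by (auto simp: power_compact_ops_def)
qed

text \<open>\<open>?A\<close> is \<open>S\<close> plus the identity on the complement. Its range is
  the preimage under \<open>P\<close> of the range of \<open>S\<close>, so closedness passes in both
  directions by continuity of \<open>P\<close>; the kernels coincide, and \<open>P\<close> maps
  vectors spanning one cokernel to vectors spanning the other.\<close>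

lemma fredholm_extend_iff:
  assumes S: "S \<in> bounded_ops (range P)"
  shows "S \<in> fredholm_ops (range P) \<longleftrightarrow> (\<lambda>x. S (P x) + (x - P x)) \<in> fredholm_ops UNIV"
proof -
  let ?Y = "range P" and ?A = "\<lambda>x. S (P x) + (x - P x)"
  have A: "?A \<in> bounded_ops UNIV"
    by (rule bounded_ops_UNIV_add[OF extend_bounded_ops[OF S] one_minus_bounded_ops[OF Pb]])
  have SY: "S x \<in> ?Y" if "x \<in> ?Y" for x using S that by (auto simp: bounded_ops_iff)
  have PA: "P (?A x) = S (P x)" for x by (simp add: P_simps PP ops_in_range[OF S])
  have rangeA: "range ?A = P -` (S ` ?Y)"
  proof (intro equalityI subsetI)
    fix y assume "y \<in> P -` (S ` ?Y)"
    then obtain u where u: "u \<in> ?Y" "P y = S u" by auto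
    moreover have "P (S u) = S u" using SY[OF u(1)] by (simp add: mem_range_iff)
    ultimately have "?A (u + (y - P y)) = y" by (simp add: P_simps PP mem_range_iff)
    then have "y = ?A (u + (y - P y))" by (rule sym)
    then show "y \<in> range ?A" by (rule image_eqI[where f = "?A"]) simp
  qed (auto simp: PA)
  have imS: "S ` ?Y = range ?A \<inter> ?Y"
  proof (intro equalityI subsetI)
    fix y assume "y \<in> S ` ?Y"
    then have y: "y \<in> S ` ?Y" "y \<in> ?Y" using SY by auto
    then have "P y = y" by (simp add: mem_range_iff)
    then show "y \<in> range ?A \<inter> ?Y" using y unfolding rangeA by simp
  next
    fix y assume y: "y \<in> range ?A \<inter> ?Y"
    then have "P y \<in> S ` ?Y" unfolding rangeA by simp
    moreover have "P y = y" using y by (simp only: Int_iff mem_range_iff)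
    ultimately show "y \<in> S ` ?Y" by simp
  qed
  have closed: "closed (S ` ?Y) \<longleftrightarrow> closed (range ?A)"
  proof
    assume "closed (S ` ?Y)"
    then show "closed (range ?A)" unfolding rangeA by (rule closed_vimage[OF _ continuous_P])
  next
    assume "closed (range ?A)"
    then show "closed (S ` ?Y)" unfolding imS using closed_range by (rule closed_Int)
  qed
  have ker: "{x \<in> ?Y. S x = 0} = {x. ?A x = 0}"
  proof (intro equalityI subsetI)
    fix x assume "x \<in> {x. ?A x = 0}"
    then have 0: "?A x = 0" by simp
    then have "S (P x) = 0" using PA[of x] by (simp add: P_simps)
    moreover from this 0 have "P x = x" by simp
    ultimately have "S x = 0 \<and> x \<in> ?Y" by (simp add: mem_range_iff)
    then show "x \<in> {x \<in> ?Y. S x = 0}" by simp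
  qed (auto simp: PP)
  have coker: "(\<exists>B. finite B \<and> B \<subseteq> ?Y \<and> (\<forall>y\<in>?Y. \<exists>x\<in>?Y. y - S x \<in> cspan B)) \<longleftrightarrow>
      (\<exists>B. finite B \<and> (\<forall>y. \<exists>x. y - ?A x \<in> cspan B))"
  proof
    assume "\<exists>B. finite B \<and> B \<subseteq> ?Y \<and> (\<forall>y\<in>?Y. \<exists>x\<in>?Y. y - S x \<in> cspan B)"
    then obtain B where B: "finite B" "\<forall>y\<in>?Y. \<exists>x\<in>?Y. y - S x \<in> cspan B" by blast
    have "\<exists>x. y - ?A x \<in> cspan B" for y
    proof -
      obtain x where x: "x \<in> ?Y" "P y - S x \<in> cspan B" using B(2) by blast
      have "y - ?A (x + (y - P y)) = P y - S x" using x(1) by (simp add: P_simps PP mem_range_iff)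
      then show ?thesis using x(2) by metis
    qed
    then show "\<exists>B. finite B \<and> (\<forall>y. \<exists>x. y - ?A x \<in> cspan B)" using B(1) by blast
  next
    assume "\<exists>B. finite B \<and> (\<forall>y. \<exists>x. y - ?A x \<in> cspan B)"
    then obtain B where B: "finite B" "\<forall>y. \<exists>x. y - ?A x \<in> cspan B" by blast
    have Pspan: "P s \<in> cspan (P ` B)" if "s \<in> cspan B" for s
      using that
    proof (induction rule: complex_vector.span_induct_alt)
      case base show ?case by (simp add: P_simps complex_vector.span_zero)
    next
      case (step c y z)
      then have "c *\<^sub>C P y + P z \<in> cspan (P ` B)"
        by (intro complex_vector.span_add[OF complex_vector.span_scale[OF complex_vector.span_base]]) auto
      then show ?case by (simp add: P_simps)
    qed
    have "\<exists>x\<in>?Y. y - S x \<in> cspan (P ` B)" if y: "y \<in> ?Y" for y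
    proof -
      obtain x where "y - ?A x \<in> cspan B" using B(2) by blast
      from Pspan[OF this] have "y - S (P x) \<in> cspan (P ` B)"
        using y by (simp only: bounded_ops_diff[OF Pb] PA mem_range_iff)
      then show ?thesis by blast
    qed
    then show "\<exists>B. finite B \<and> B \<subseteq> ?Y \<and> (\<forall>y\<in>?Y. \<exists>x\<in>?Y. y - S x \<in> cspan B)"
      using B(1) by (intro exI[of _ "P ` B"]) auto
  qed
  have "S \<in> fredholm_ops ?Y \<longleftrightarrow> closed (S ` ?Y) \<and> finite_dimensional {x \<in> ?Y. S x = 0} \<and>
      (\<exists>B. finite B \<and> B \<subseteq> ?Y \<and> (\<forall>y\<in>?Y. \<exists>x\<in>?Y. y - S x \<in> cspan B))"
    using S by (simp add: fredholm_ops_def)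
  also have "\<dots> \<longleftrightarrow> ?A \<in> fredholm_ops UNIV"
    unfolding closed ker coker using A by (simp add: fredholm_ops_def)
  finally show ?thesis .
qed

text \<open>The class of \<open>S P\<close> lies in the corner of the class of \<open>P\<close>.
  Adding the complementary idempotent expresses invertibility in that corner as invertibility in the
  whole algebra, where Atkinson's theorem applies.\<close>

lemma fredholm_ops_iff:
  assumes S: "S \<in> bounded_ops (range P)"
  shows "S \<in> fredholm_ops (range P) \<longleftrightarrow>
    is_unit_el (calkin_class (Bop (\<lambda>x. S (P x))) + (1 - calkin_class (Bop P)))"
proof -
  let ?A = "\<lambda>x. S (P x) + (x - P x)"
  note SP = extend_bounded_ops[OF S]
  have A: "?A \<in> bounded_ops UNIV"
    by (rule bounded_ops_UNIV_add[OF SP one_minus_bounded_ops[OF Pb]])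
  have "Bop ?A = Bop (\<lambda>x. S (P x)) + (1 - Bop P)"
    by (rule apply_bop_inject[THEN iffD1])
       (simp add: Bop_inverse[OF A] Bop_inverse[OF SP] Bop_inverse[OF Pb]
          plus_bop.rep_eq minus_bop.rep_eq one_bop.rep_eq)
  then have "calkin_class (Bop (\<lambda>x. S (P x))) + (1 - calkin_class (Bop P)) = calkin_class (Bop ?A)"
    by (simp add: calkin_class_simps calkin_class_one)
  moreover have "?A \<in> fredholm_ops UNIV \<longleftrightarrow> is_unit_el (calkin_class (Bop ?A))"
    unfolding calkin_class_unit_iff[OF A]
  proof
    assume F: "?A \<in> fredholm_ops UNIV"
    obtain R where "R \<in> bounded_ops UNIV" "(\<lambda>x. R (?A x) - x) \<in> compact_ops UNIV"
      "(\<lambda>x. ?A (R x) - x) \<in> compact_ops UNIV"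
      by (rule fredholm_imp_invertible_mod_compact[OF F], rule that)
    then show "\<exists>R\<in>bounded_ops UNIV. (\<lambda>x. ?A (R x) - x) \<in> compact_ops UNIV \<and> (\<lambda>x. R (?A x) - x) \<in> compact_ops UNIV"
      by blast
  next
    assume "\<exists>R\<in>bounded_ops UNIV. (\<lambda>x. ?A (R x) - x) \<in> compact_ops UNIV \<and> (\<lambda>x. R (?A x) - x) \<in> compact_ops UNIV"
    then obtain R where R: "R \<in> bounded_ops UNIV" "(\<lambda>x. ?A (R x) - x) \<in> compact_ops UNIV"
      "(\<lambda>x. R (?A x) - x) \<in> compact_ops UNIV" by blast
    show "?A \<in> fredholm_ops UNIV" by (rule invertible_mod_compact_imp_fredholm[OF A R(1,3,2)])
  qed
  ultimately show ?thesis using fredholm_extend_iff[OF S] by simp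
qed

lemma complement: "bounded_idempotent (\<lambda>x. x - P x)"
  by standard (simp_all add: one_minus_bounded_ops Pb P_simps PP)

end

section \<open>Isolated points and poles in the Calkin algebra\<close>

text \<open>\<open>d + p\<close> acts as \<open>d\<close> off \<open>p\<close> and as the identity
  on \<open>p\<close>, so the inverse of \<open>d\<close> on the complement is the inverse of
  \<open>d + p\<close> with its block \<open>p\<close> removed.\<close>

lemma spectral_splitI:
  fixes p q d :: "'a::complex_banach_algebra"
  assumes p: "p * p = p" "p * q = q" "q * p = q" "p * d = 0" "d * p = 0"
    and u: "is_unit_el (d + p)" and q: "quasi_nil q"
  shows "\<exists>b. spectral_split (q + d) p b" "(q + d) * p = q"
proof -
  let ?v = "inv_el (d + p)"
  have v: "(d + p) * ?v = 1" "?v * (d + p) = 1" using inv_el[OF u] by auto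
  have pv: "p * ?v = p"
  proof -
    have "p * ((d + p) * ?v) = (p * (d + p)) * ?v" by (simp only: mult.assoc)
    also have "p * (d + p) = p" by (simp add: distrib_left p)
    finally show ?thesis by (simp only: v mult_1_right)
  qed
  have vp: "?v * p = p"
  proof -
    have "(?v * (d + p)) * p = ?v * ((d + p) * p)" by (simp only: mult.assoc)
    also have "(d + p) * p = p" by (simp add: distrib_right p)
    finally show ?thesis by (simp only: v mult_1_left)
  qed
  have qv: "q * ?v = q" using p(3) pv by (metis mult.assoc)
  have vq: "?v * q = q" using p(2) vp by (metis mult.assoc)
  have dv: "d * ?v = 1 - p" using v(1) pv by (simp add: distrib_right eq_diff_eq)
  have vd: "?v * d = 1 - p" using v(2) vp by (simp add: distrib_left eq_diff_eq)
  show c: "(q + d) * p = q" by (simp add: distrib_right p)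
  show "\<exists>b. spectral_split (q + d) p b"
  proof
    show "spectral_split (q + d) p (?v - p)"
      unfolding spectral_split_def c
      by (simp add: distrib_right distrib_left left_diff_distrib right_diff_distrib p q pv vp qv vq dv vd)
  qed
qed

text \<open>The inverse is \<open>b + p\<close>, block by block.\<close>

lemma spectral_split_unit_off:
  assumes "spectral_split c p b" shows "is_unit_el (c * (1 - p) + p)"
proof -
  have s: "p * p = p" "p * c = c * p" "c * b = 1 - p" "b * c = 1 - p" "p * b = 0" "b * p = 0"
    using assms by (auto simp: spectral_split_def)
  have "c * p * b = 0" "b * (c * p) = 0"
    using s by (simp_all add: mult.assoc left_diff_distrib flip: mult.assoc[of b c p])
  moreover have "c * p * p = c * p" "p * (c * p) = c * p" using s by (metis mult.assoc)+
  ultimately show ?thesis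
    by (intro is_unit_elI[of _ "b + p"])
       (simp_all add: distrib_right distrib_left left_diff_distrib right_diff_distrib s)
qed

context
  fixes T :: "'a::complex_banach \<Rightarrow> 'a" and z :: complex
  assumes T: "T \<in> bounded_ops UNIV"
begin

text \<open>The extensions of \<open>T1\<close> and \<open>T2\<close> satisfy the block relations
  exactly, and \<open>K\<close> disappears in the quotient. The second claim identifies
  \<open>c p\<close> with the class of \<open>T1\<close>, so that poles can be recognized from the
  given \<open>T1\<close>.\<close>

lemma decomposition_imp_spectral_split:
  assumes P: "bounded_idempotent P"
    and T1: "T1 \<in> riesz_ops (range P)" and T2: "T2 \<in> fredholm_ops (range (\<lambda>x. x - P x))"
    and K: "K \<in> compact_ops UNIV" and eq: "\<And>x. T x - z *\<^sub>C x = direct_sum_op P T1 T2 x + K x"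
  shows "\<exists>b. spectral_split (calkin_class (Bop T) - z *\<^sub>C 1) (calkin_class (Bop P)) b"
    and "(calkin_class (Bop T) - z *\<^sub>C 1) * calkin_class (Bop P) = calkin_class (Bop (\<lambda>x. T1 (P x)))"
proof -
  interpret P: bounded_idempotent P by (rule P)
  interpret Q: bounded_idempotent "\<lambda>x. x - P x" by (rule P.complement)
  have T1b: "T1 \<in> bounded_ops (range P)" using T1 by (simp add: riesz_ops_def)
  have T2b: "T2 \<in> bounded_ops (range (\<lambda>x. x - P x))" using T2 by (simp add: fredholm_ops_def)
  let ?P = "Bop P" and ?A = "Bop (\<lambda>x. T1 (P x))" and ?D = "Bop (\<lambda>x. T2 (x - P x))"
  have ap: "apply_bop ?P = P" "apply_bop ?A = (\<lambda>x. T1 (P x))" "apply_bop ?D = (\<lambda>x. T2 (x - P x))"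
    "apply_bop (Bop T) = T" "apply_bop (Bop K) = K"
    by (simp_all add: Bop_inverse P.Pb T compact_ops_imp_bounded_ops[OF K]
        P.extend_bounded_ops[OF T1b] Q.extend_bounded_ops[OF T2b])
  have T0: "T1 0 = 0" "T2 0 = 0"
    using bounded_ops_linear_simps(2)[OF P.extend_bounded_ops[OF T1b]]
      bounded_ops_linear_simps(2)[OF Q.extend_bounded_ops[OF T2b]] by (simp_all add: P.P_simps)
  have PT2: "P (T2 (x - P x)) = 0" for x using Q.ops_in_range[OF T2b, of x] by simp
  have alg: "?P * ?P = ?P" "?P * ?A = ?A" "?A * ?P = ?A" "?P * ?D = 0" "?D * ?P = 0"
    by (rule apply_bop_inject[THEN iffD1],
        simp add: times_bop.rep_eq zero_bop.rep_eq ap P.PP P.ops_in_range[OF T1b] PT2 T0 P.P_simps)+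
  have sum: "Bop T - z *\<^sub>C 1 = ?A + ?D + Bop K"
    by (rule apply_bop_inject[THEN iffD1])
       (simp add: minus_bop.rep_eq plus_bop.rep_eq scaleC_bop.rep_eq one_bop.rep_eq ap eq direct_sum_op_def)
  have "calkin_class (Bop K) = 0" using K by (simp add: calkin_class_eq_0_iff ap)
  then have c: "calkin_class (Bop T) - z *\<^sub>C 1 = calkin_class ?A + calkin_class ?D"
    using arg_cong[OF sum, of calkin_class]
    by (simp add: calkin_class_simps calkin_class_scaleC calkin_class_one)
  have q: "quasi_nil (calkin_class ?A)" using T1 P.riesz_ops_iff[OF T1b] by simp
  have "Bop (\<lambda>x. x - P x) = 1 - ?P"
    by (rule apply_bop_inject[THEN iffD1])
       (simp add: Bop_inverse[OF Q.Pb] minus_bop.rep_eq one_bop.rep_eq ap)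
  then have u: "is_unit_el (calkin_class ?D + calkin_class ?P)"
    using T2 Q.fredholm_ops_iff[OF T2b] by (simp add: calkin_class_simps calkin_class_one)
  have alg': "calkin_class ?P * calkin_class ?P = calkin_class ?P" "calkin_class ?P * calkin_class ?A = calkin_class ?A"
    "calkin_class ?A * calkin_class ?P = calkin_class ?A" "calkin_class ?P * calkin_class ?D = 0"
    "calkin_class ?D * calkin_class ?P = 0"
    by (simp_all only: calkin_class_simps(4)[symmetric] alg calkin_class_simps(1))
  show "\<exists>b. spectral_split (calkin_class (Bop T) - z *\<^sub>C 1) (calkin_class ?P) b"
    "(calkin_class (Bop T) - z *\<^sub>C 1) * calkin_class ?P = calkin_class ?A"
    unfolding c by (rule spectral_splitI[OF alg' u q])+
qed

text \<open>\<open>T1\<close> and \<open>T2\<close> are the diagonal compressions of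
  \<open>T - z\<close> by a lift \<open>P\<close> of \<open>p\<close>, and \<open>K\<close> collects
  the off-diagonal blocks. These are compact because \<open>p\<close> commutes with the class of
  \<open>T - z\<close>.\<close>

lemma spectral_split_imp_decomposition:
  assumes split: "spectral_split (calkin_class (Bop T) - z *\<^sub>C 1) p b"
  obtains P T1 T2 K where "bounded_idempotent P" "calkin_class (Bop P) = p"
    "T1 \<in> riesz_ops (range P)" "T2 \<in> fredholm_ops (range (\<lambda>x. x - P x))" "K \<in> compact_ops UNIV"
    "\<And>x. T x - z *\<^sub>C x = direct_sum_op P T1 T2 x + K x"
proof -
  let ?c = "calkin_class (Bop T) - z *\<^sub>C 1" and ?T = "Bop T - z *\<^sub>C 1"
  have s: "p * p = p" "p * ?c = ?c * p" "quasi_nil (?c * p)" using split by (auto simp: spectral_split_def)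
  have cT: "calkin_class ?T = ?c" by (simp add: calkin_class_simps calkin_class_scaleC calkin_class_one)
  obtain E where E: "calkin_class E = p" "E * E = E" by (rule calkin_idempotent_lift[OF s(1)], rule that)
  define P where "P = apply_bop E"
  have EP: "Bop P = E" by (simp add: P_def apply_bop_inverse)
  interpret P: bounded_idempotent P
  proof
    show "P \<in> bounded_ops UNIV" unfolding P_def by (rule apply_bop)
    show "P (P x) = P x" for x
      using arg_cong[OF E(2), of "\<lambda>S. apply_bop S x"] by (simp add: times_bop.rep_eq P_def)
  qed
  interpret Q: bounded_idempotent "\<lambda>x. x - P x" by (rule P.complement)
  let ?F = "1 - E"
  have F: "apply_bop ?F = (\<lambda>x. x - P x)" by (simp add: minus_bop.rep_eq one_bop.rep_eq P_def)
  then have FQ: "Bop (\<lambda>x. x - P x) = ?F" using apply_bop_inverse[of ?F] by simp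
  define T1 where "T1 = (\<lambda>x\<in>range P. P (apply_bop ?T x))"
  define T2 where "T2 = (\<lambda>x\<in>range (\<lambda>x. x - P x). apply_bop ?T x - P (apply_bop ?T x))"
  define K where "K = apply_bop (?T - E * ?T * E - ?F * ?T * ?F)"
  have T1b: "T1 \<in> bounded_ops (range P)" unfolding T1_def by (rule P.compress_bounded_ops[OF apply_bop])
  have T2b: "T2 \<in> bounded_ops (range (\<lambda>x. x - P x))" unfolding T2_def by (rule Q.compress_bounded_ops[OF apply_bop])
  have ap1: "apply_bop (E * ?T * E) = (\<lambda>x. T1 (P x))" by (simp add: times_bop.rep_eq T1_def P_def)
  have ap2: "apply_bop (?F * ?T * ?F) = (\<lambda>x. T2 (x - P x))" by (simp add: times_bop.rep_eq T2_def F)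
  have B1: "Bop (\<lambda>x. T1 (P x)) = E * ?T * E" using apply_bop_inverse[of "E * ?T * E"] by (simp only: ap1)
  have B2: "Bop (\<lambda>x. T2 (x - P x)) = ?F * ?T * ?F" using apply_bop_inverse[of "?F * ?T * ?F"] by (simp only: ap2)
  have pcp: "p * ?c * p = ?c * p" using s by (metis mult.assoc)
  have c1: "calkin_class (E * ?T * E) = ?c * p" by (simp only: calkin_class_simps(4) E cT pcp)
  have F1: "calkin_class ?F = 1 - p" by (simp add: calkin_class_simps calkin_class_one E)
  have "(1 - p) * ?c * (1 - p) = ?c * (1 - p)"
  proof -
    have "(1 - p) * ?c * (1 - p) = (?c - ?c * p) * (1 - p)"
      by (simp only: left_diff_distrib[of 1 p ?c] mult_1_left s(2))
    also have "\<dots> = ?c * ((1 - p) * (1 - p))" by (simp only: right_diff_distrib[of ?c 1 p, symmetric, simplified] mult.assoc[symmetric])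
    also have "(1 - p) * (1 - p) = 1 - p" by (simp add: left_diff_distrib right_diff_distrib s(1))
    finally show ?thesis .
  qed
  then have c2: "calkin_class (?F * ?T * ?F) = ?c * (1 - p)" by (simp only: calkin_class_simps(4) F1 cT)
  show thesis
  proof (rule that)
    show "bounded_idempotent P" by (rule P.bounded_idempotent_axioms)
    show "calkin_class (Bop P) = p" by (simp add: EP E)
    show "T1 \<in> riesz_ops (range P)" unfolding P.riesz_ops_iff[OF T1b] B1 c1 by (rule s(3))
    show "T2 \<in> fredholm_ops (range (\<lambda>x. x - P x))"
      unfolding Q.fredholm_ops_iff[OF T2b] B2 c2 FQ F1 using spectral_split_unit_off[OF split] by simp
    have "calkin_class (?T - E * ?T * E - ?F * ?T * ?F) = ?c - ?c * p - ?c * (1 - p)"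
      by (simp only: calkin_class_simps(3)[of "?T - E * ?T * E"] calkin_class_simps(3)[of ?T "E * ?T * E"] cT c1 c2)
    also have "\<dots> = 0" by (simp only: right_diff_distrib mult_1_right) simp
    finally show "K \<in> compact_ops UNIV" by (simp add: calkin_class_eq_0_iff K_def)
    show "T x - z *\<^sub>C x = direct_sum_op P T1 T2 x + K x" for x
    proof -
      have "K x = apply_bop ?T x - T1 (P x) - T2 (x - P x)"
        unfolding K_def by (simp only: minus_bop.rep_eq[of "_ - _"] minus_bop.rep_eq[of ?T] ap1 ap2)
      moreover have "apply_bop ?T x = T x - z *\<^sub>C x"
        by (simp add: minus_bop.rep_eq scaleC_bop.rep_eq one_bop.rep_eq Bop_inverse[OF T])
      ultimately show ?thesis by (simp add: direct_sum_op_def)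
    qed
  qed
qed

end

text \<open>This makes power compact operators on the range of an idempotent Riesz, so that the
  decompositions in (ii) are among those in (i).\<close>

lemma quasi_nil_of_nilpotent:
  assumes "q ^ n = 0" shows "quasi_nil q"
  unfolding quasi_nil_def
proof (intro allI impI)
  fix l :: complex assume l: "l \<noteq> 0"
  have "(inverse l *\<^sub>C q) ^ n = 0" by (simp add: power_scaleC assms)
  then have "is_unit_el (1 - (inverse l *\<^sub>C q) ^ n)" using is_unit_elI[of 1 1] by simp
  then have "is_unit_el (1 - inverse l *\<^sub>C q)" by (rule is_unit_el_of_power)
  from is_unit_el_scaleC[OF this l] show "is_unit_el (l *\<^sub>C 1 - q)" using l by (simp add: scaleC_simps)
qed

theorem theorem3p7:
  fixes T :: "'a::complex_banach \<Rightarrow> 'a" and z :: complex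
  assumes "\<not> finite_dimensional (UNIV :: 'a set)"
    and "T \<in> bounded_ops UNIV"
  shows
    "(z \<in> iso_spectrum (calkin_algebra UNIV) (calkin_proj UNIV T) \<longleftrightarrow>
       (\<exists>P\<in>bounded_ops UNIV. P \<circ> P = P \<and> P \<notin> compact_ops UNIV \<and>
          (\<exists>T1\<in>riesz_ops (range P).
           \<exists>T2\<in>fredholm_ops (range (\<lambda>x. x - P x)).
           \<exists>K\<in>compact_ops UNIV.
             \<forall>x. T x - z *\<^sub>C x = direct_sum_op P T1 T2 x + K x))) \<and>
     (z \<in> resolvent_poles (calkin_algebra UNIV) (calkin_proj UNIV T) \<longleftrightarrow>
       (\<exists>P\<in>bounded_ops UNIV. P \<circ> P = P \<and> P \<notin> compact_ops UNIV \<and>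
          (\<exists>T1\<in>power_compact_ops (range P).
           \<exists>T2\<in>fredholm_ops (range (\<lambda>x. x - P x)).
           \<exists>K\<in>compact_ops UNIV.
             \<forall>x. T x - z *\<^sub>C x = direct_sum_op P T1 T2 x + K x))) \<and>
     (z \<in> iso_nonpoles (calkin_algebra UNIV) (calkin_proj UNIV T) \<longleftrightarrow>
       (\<exists>P\<in>bounded_ops UNIV. P \<circ> P = P \<and> P \<notin> compact_ops UNIV \<and>
          (\<exists>T1\<in>riesz_ops (range P) - power_compact_ops (range P).
           \<exists>T2\<in>fredholm_ops (range (\<lambda>x. x - P x)).
           \<exists>K\<in>compact_ops UNIV.
             \<forall>x. T x - z *\<^sub>C x = direct_sum_op P T1 T2 x + K x)))"
proof -
  let ?C = "calkin_algebra (UNIV :: 'a set)" and ?t = "calkin_class (Bop T)"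
  let ?c = "?t - z *\<^sub>C 1"
  note T = assms(2)
  have t: "calkin_proj UNIV T = calkin_coset ?t" by (simp add: calkin_coset_class Bop_inverse[OF T])
  define D where "D P T1 \<longleftrightarrow> P \<in> bounded_ops UNIV \<and> P \<circ> P = P \<and> P \<notin> compact_ops UNIV \<and>
      T1 \<in> riesz_ops (range P) \<and> (\<exists>T2\<in>fredholm_ops (range (\<lambda>x. x - P x)).
           \<exists>K\<in>compact_ops UNIV. \<forall>x. T x - z *\<^sub>C x = direct_sum_op P T1 T2 x + K x)" for P T1
  \<comment> \<open>Both facts hold for an arbitrary decomposition, not only for the one constructed
    in \<open>ex\<close>. Hence a single decomposition settles whether \<open>z\<close> is a pole,
    and all three equivalences become propositional.\<close>
  have iso: "z \<in> iso_spectrum ?C (calkin_coset ?t)"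
    and pole: "z \<in> resolvent_poles ?C (calkin_coset ?t) \<longleftrightarrow> T1 \<in> power_compact_ops (range P)"
    if DP: "D P T1" for P T1
  proof -
    obtain T2 K where P: "P \<in> bounded_ops UNIV" "P \<circ> P = P" "P \<notin> compact_ops UNIV"
      and T1: "T1 \<in> riesz_ops (range P)" and T2: "T2 \<in> fredholm_ops (range (\<lambda>x. x - P x))"
      and K: "K \<in> compact_ops UNIV" and eq: "\<And>x. T x - z *\<^sub>C x = direct_sum_op P T1 T2 x + K x"
      using DP unfolding D_def by blast
    interpret P: bounded_idempotent P
      by standard (use P(1) in simp, use P(2) in \<open>metis comp_apply\<close>)
    note dec = decomposition_imp_spectral_split[OF T P.bounded_idempotent_axioms T1 T2 K eq]
    obtain b where b: "spectral_split ?c (calkin_class (Bop P)) b" using dec(1) ..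
    have p0: "calkin_class (Bop P) \<noteq> 0" using P by (simp add: calkin_class_eq_0_iff Bop_inverse)
    show "z \<in> iso_spectrum ?C (calkin_coset ?t)" by (rule spectral_split_resolvent_poles_iff(1)[OF b p0])
    have T1b: "T1 \<in> bounded_ops (range P)" using T1 by (simp add: riesz_ops_def)
    show "z \<in> resolvent_poles ?C (calkin_coset ?t) \<longleftrightarrow> T1 \<in> power_compact_ops (range P)"
      unfolding spectral_split_resolvent_poles_iff(2)[OF b p0] dec(2) P.power_compact_ops_iff[OF T1b] ..
  qed
  have ex: "\<exists>P T1. D P T1" if z: "z \<in> iso_spectrum ?C (calkin_coset ?t)"
  proof -
    have nu: "\<not> is_unit_el ?c" and "\<exists>R>0. \<forall>l. 0 < cmod l \<and> cmod l < R \<longrightarrow> is_unit_el (l *\<^sub>C 1 - ?c)"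
      using z unfolding iso_spectrum_calkin_coset by simp_all
    then obtain R where R: "R > 0" "\<And>l. 0 < cmod l \<Longrightarrow> cmod l < R \<Longrightarrow> is_unit_el (l *\<^sub>C 1 - ?c)" by blast
    obtain p b where split: "spectral_split ?c p b" by (rule isolated_imp_spectral_split[OF R], assumption, assumption, rule that)
    \<comment> \<open>For \<open>p = 0\<close> the element \<open>b\<close> would invert
      \<open>?c\<close>, although \<open>z\<close> lies in the spectrum.\<close>
    have p0: "p \<noteq> 0"
    proof
      assume "p = 0"
      then have "?c * b = 1" "b * ?c = 1" using split by (simp_all add: spectral_split_def)
      then show False using nu by (metis is_unit_elI)
    qed
    obtain P T1 T2 K where d: "bounded_idempotent P" "calkin_class (Bop P) = p"
      "T1 \<in> riesz_ops (range P)" "T2 \<in> fredholm_ops (range (\<lambda>x. x - P x))" "K \<in> compact_ops UNIV"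
      "\<And>x. T x - z *\<^sub>C x = direct_sum_op P T1 T2 x + K x"
      by (rule spectral_split_imp_decomposition[OF T split], rule that)
    interpret P: bounded_idempotent P by (rule d(1))
    have "P \<notin> compact_ops UNIV"
      using p0 calkin_class_eq_0_iff[of "Bop P"] by (simp add: d(2) Bop_inverse[OF P.Pb])
    moreover have "P \<circ> P = P" by (simp add: fun_eq_iff P.PP)
    ultimately have "D P T1" unfolding D_def using P.Pb d(3-6) by blast
    then show ?thesis by blast
  qed
  have pk: "T1 \<in> riesz_ops (range P)"
    if P: "P \<in> bounded_ops UNIV" "P \<circ> P = P" and T1: "T1 \<in> power_compact_ops (range P)" for P T1
  proof -
    interpret P: bounded_idempotent P
      by standard (use P(1) in simp, use P(2) in \<open>metis comp_apply\<close>)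
    have T1b: "T1 \<in> bounded_ops (range P)" using T1 by (simp add: power_compact_ops_def)
    obtain n where "calkin_class (Bop (\<lambda>x. T1 (P x))) ^ n = 0" using T1 P.power_compact_ops_iff[OF T1b] by blast
    from quasi_nil_of_nilpotent[OF this] show ?thesis using P.riesz_ops_iff[OF T1b] by simp
  qed
  have poles_iso: "z \<in> resolvent_poles ?C (calkin_coset ?t) \<Longrightarrow> z \<in> iso_spectrum ?C (calkin_coset ?t)"
    by (simp add: resolvent_poles_def)
  have A: "(\<exists>P\<in>bounded_ops UNIV. P \<circ> P = P \<and> P \<notin> compact_ops UNIV \<and>
          (\<exists>T1\<in>riesz_ops (range P). \<exists>T2\<in>fredholm_ops (range (\<lambda>x. x - P x)). \<exists>K\<in>compact_ops UNIV.
             \<forall>x. T x - z *\<^sub>C x = direct_sum_op P T1 T2 x + K x)) \<longleftrightarrow> (\<exists>P T1. D P T1)"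
    unfolding D_def by blast
  have B: "(\<exists>P\<in>bounded_ops UNIV. P \<circ> P = P \<and> P \<notin> compact_ops UNIV \<and>
          (\<exists>T1\<in>power_compact_ops (range P). \<exists>T2\<in>fredholm_ops (range (\<lambda>x. x - P x)). \<exists>K\<in>compact_ops UNIV.
             \<forall>x. T x - z *\<^sub>C x = direct_sum_op P T1 T2 x + K x)) \<longleftrightarrow>
       (\<exists>P T1. D P T1 \<and> T1 \<in> power_compact_ops (range P))"
    unfolding D_def using pk by blast
  have C: "(\<exists>P\<in>bounded_ops UNIV. P \<circ> P = P \<and> P \<notin> compact_ops UNIV \<and>
          (\<exists>T1\<in>riesz_ops (range P) - power_compact_ops (range P).
           \<exists>T2\<in>fredholm_ops (range (\<lambda>x. x - P x)). \<exists>K\<in>compact_ops UNIV.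
             \<forall>x. T x - z *\<^sub>C x = direct_sum_op P T1 T2 x + K x)) \<longleftrightarrow>
       (\<exists>P T1. D P T1 \<and> T1 \<notin> power_compact_ops (range P))"
    unfolding D_def by blast
  have "z \<in> iso_spectrum ?C (calkin_coset ?t) \<longleftrightarrow> (\<exists>P T1. D P T1)"
    using iso ex by blast
  moreover have "z \<in> resolvent_poles ?C (calkin_coset ?t) \<longleftrightarrow>
      (\<exists>P T1. D P T1 \<and> T1 \<in> power_compact_ops (range P))"
    using pole ex poles_iso by blast
  moreover have "z \<in> iso_nonpoles ?C (calkin_coset ?t) \<longleftrightarrow>
      (\<exists>P T1. D P T1 \<and> T1 \<notin> power_compact_ops (range P))"
    unfolding iso_nonpoles_def using pole iso ex by blast
  ultimately show ?thesis unfolding A B C t by (intro conjI)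
qed

end
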